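(* Let $k$ be a field with $\operatorname{char}k=p>0$, $\Sigma$ a rational pointed fan in $\mathbb{R}^d$ ($d\ge 1$), and $\mathcal{M}$ a monoidal complex supported on $\Sigma$. If the toric face ring $k[\mathcal{M}]$ is $F$-injective, then $\mathcal{M}$ is seminormal.
   Context: Cones: a cone in $\mathbb{R}^d$ is a finite intersection of closed half-spaces bounded by hyperplanes through the origin. It is rational if the hyperplanes can be defined by homogeneous linear equations with integer coefficients. A face of a cone $C$ is $C$ itself or the intersection of $C$ with a supporting hyperplane through the origin. $C$ is pointed if $\{0\}$ is a face of $C$. All cones are rational and pointed. Monoids: an affine monoid is a finitely generated submonoid $M$ of some $\mathbb{Z}^d$; $\mathbb{Z}M$ is the subgroup it generates and $\mathbb{R}_+M$ the cone of nonnegative real combinations of its elements. $M$ is seminormal if every $x\in\mathbb{Z}M$ with $2x,3x\in M$ lies in $M$. Fans and monoidal complexes: a rational pointed fan $\Sigma$ in $\mathbb{R}^d$ is a finite nonempty set of rational pointed cones such that faces of members are members, and the intersection of two members is a common face of both. A monoidal complex $\mathcal{M}$ supported on $\Sigma$ is a family of affine monoids $(M_C)_{C\in\Sigma}$ with $M_C\subseteq C\cap\mathbb{Z}^d$, $\mathbb{R}_+M_C=C$, and $M_D=M_C\cap D$ whenever $D$ is a face of $C$. It is seminormal if all $M_C$ are seminormal. Put $|\mathcal{M}|=\bigcup_{C\in\Sigma}M_C$. Toric face ring: $R=k[\mathcal{M}]=\bigoplus_{a\in|\mathcal{M}|}k\,X^a$ as a $k$-vector space, with $X^a\cdot X^b=X^{a+b}$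 if $a,b\in M_C$ for some $C\in\Sigma$, and $X^aX^b=0$ otherwise. $\mathfrak{m}$ is the ideal spanned by the $X^a$ with $a\ne0$. $R$ is $F$-injective if for all $i$ the map $H^i_{\mathfrak{m}}(R)\to H^i_{\mathfrak{m}}(R)$ induced by the Frobenius endomorphism $F:R\to R$, $t\mapsto t^p$, is injective. *)

theory Defs
  imports
    "HOL-Analysis.Analysis"
    "HOL-Algebra.Algebra"
    "HOL-Library.Poly_Mapping"
    "HOL-Computational_Algebra.Group_Closure"
begin

section \<open>Rational pointed cones and fans\<close>

definition of_int_vec :: "int ^ 'd \<Rightarrow> real ^ 'd" where
  "of_int_vec a = (\<chi> i. real_of_int (a $ i))"

text \<open>The finite set of normals may be empty: the whole space is a cone.\<close>

definition rational_cone :: "(real ^ 'd) set \<Rightarrow> bool" where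
  "rational_cone C \<longleftrightarrow>
    (\<exists>A :: (int ^ 'd) set. finite A \<and> 0 \<notin> A \<and> C = (\<Inter>a\<in>A. {x. 0 \<le> of_int_vec a \<bullet> x}))"

text \<open>Unlike \<^const>\<open>face_of\<close>, this excludes the empty set as a face.\<close>

definition cone_face :: "(real ^ 'd) set \<Rightarrow> (real ^ 'd) set \<Rightarrow> bool" where
  "cone_face D C \<longleftrightarrow>
    D = C \<or> (\<exists>a. a \<noteq> 0 \<and> (\<forall>x\<in>C. 0 \<le> a \<bullet> x) \<and> D = C \<inter> {x. a \<bullet> x = 0})"

definition pointed_cone :: "(real ^ 'd) set \<Rightarrow> bool" where
  "pointed_cone C \<longleftrightarrow> cone_face {0} C"

definition rational_pointed_fan :: "(real ^ 'd) set set \<Rightarrow> bool" where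
  "rational_pointed_fan \<F> \<longleftrightarrow>
    finite \<F> \<and> \<F> \<noteq> {} \<and>
    (\<forall>C\<in>\<F>. rational_cone C \<and> pointed_cone C) \<and>
    (\<forall>C\<in>\<F>. \<forall>D. cone_face D C \<longrightarrow> D \<in> \<F>) \<and>
    (\<forall>C\<in>\<F>. \<forall>D\<in>\<F>. cone_face (C \<inter> D) C \<and> cone_face (C \<inter> D) D)"


section \<open>Affine monoids and monoidal complexes\<close>

inductive_set monoid_closure :: "'a::comm_monoid_add set \<Rightarrow> 'a set" for S where
  zero: "0 \<in> monoid_closure S"
| base: "s \<in> S \<Longrightarrow> s \<in> monoid_closure S"
| add: "s \<in> monoid_closure S \<Longrightarrow> t \<in> monoid_closure S \<Longrightarrow> s + t \<in> monoid_closure S"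

definition affine_monoid :: "(int ^ 'd) set \<Rightarrow> bool" where
  "affine_monoid M \<longleftrightarrow> (\<exists>S. finite S \<and> M = monoid_closure S)"

definition seminormal_monoid :: "(int ^ 'd) set \<Rightarrow> bool" where
  "seminormal_monoid M \<longleftrightarrow> (\<forall>x\<in>group_closure M. x + x \<in> M \<and> x + x + x \<in> M \<longrightarrow> x \<in> M)"

definition monoidal_complex :: "(real ^ 'd) set set \<Rightarrow> ((real ^ 'd) set \<Rightarrow> (int ^ 'd) set) \<Rightarrow> bool" where
  "monoidal_complex \<F> M \<longleftrightarrow>
    (\<forall>C\<in>\<F>. affine_monoid (M C) \<and> of_int_vec ` M C \<subseteq> C \<and>
            convex_cone hull (of_int_vec ` M C) = C) \<and>
    (\<forall>C\<in>\<F>. \<forall>D. cone_face D C \<longrightarrow> M D = {a \<in> M C. of_int_vec a \<in> D})"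

definition seminormal_complex :: "(real ^ 'd) set set \<Rightarrow> ((real ^ 'd) set \<Rightarrow> (int ^ 'd) set) \<Rightarrow> bool" where
  "seminormal_complex \<F> M \<longleftrightarrow> (\<forall>C\<in>\<F>. seminormal_monoid (M C))"


section \<open>Toric face rings\<close>

text \<open>The monomial \<open>X\<^sup>a\<close> is \<open>Poly_Mapping.single a 1\<close>. The multiplication is not the
  convolution product of the type class instance for \<open>\<Rightarrow>\<^sub>0\<close>.\<close>

definition toric_face_ring ::
  "(real ^ 'd) set set \<Rightarrow> ((real ^ 'd) set \<Rightarrow> (int ^ 'd) set) \<Rightarrow> (int ^ 'd \<Rightarrow>\<^sub>0 'k::field) ring" where
  "toric_face_ring \<F> M =
    \<lparr>carrier = {f. Poly_Mapping.keys f \<subseteq> (\<Union>C\<in>\<F>. M C)},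
     monoid.mult = (\<lambda>f g. \<Sum>a\<in>Poly_Mapping.keys f. \<Sum>b\<in>Poly_Mapping.keys g.
       if \<exists>C\<in>\<F>. a \<in> M C \<and> b \<in> M C
       then Poly_Mapping.single (a + b) (Poly_Mapping.lookup f a * Poly_Mapping.lookup g b)
       else 0),
     one = Poly_Mapping.single 0 1,
     ring.zero = 0,
     ring.add = (+)\<rparr>"

definition toric_max_ideal ::
  "(real ^ 'd) set set \<Rightarrow> ((real ^ 'd) set \<Rightarrow> (int ^ 'd) set) \<Rightarrow> (int ^ 'd \<Rightarrow>\<^sub>0 'k::field) set" where
  "toric_max_ideal \<F> M = {f \<in> carrier (toric_face_ring \<F> M). 0 \<notin> Poly_Mapping.keys f}"


section \<open>Localization of a commutative ring\<close>

text \<open>For a multiplicatively closed set \<open>S\<close>, \<open>fraction R S r s\<close> is the fraction \<open>r/s\<close>, as an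
  equivalence class of pairs. The operations on classes are unions over representatives
  of equal sets.\<close>

definition fraction :: "('a, 'c) ring_scheme \<Rightarrow> 'a set \<Rightarrow> 'a \<Rightarrow> 'a \<Rightarrow> ('a \<times> 'a) set" where
  "fraction R S r s = {(r', s'). r' \<in> carrier R \<and> s' \<in> S \<and>
     (\<exists>t\<in>S. t \<otimes>\<^bsub>R\<^esub> (s' \<otimes>\<^bsub>R\<^esub> r) = t \<otimes>\<^bsub>R\<^esub> (s \<otimes>\<^bsub>R\<^esub> r'))}"

definition localization :: "('a, 'c) ring_scheme \<Rightarrow> 'a set \<Rightarrow> ('a \<times> 'a) set ring" where
  "localization R S =
    \<lparr>carrier = {fraction R S r s | r s. r \<in> carrier R \<and> s \<in> S},
     monoid.mult = (\<lambda>A B. \<Union>(r, s)\<in>A. \<Union>(r', s')\<in>B. fraction R S (r \<otimes>\<^bsub>R\<^esub> r') (s \<otimes>\<^bsub>R\<^esub> s')),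
     one = fraction R S \<one>\<^bsub>R\<^esub> \<one>\<^bsub>R\<^esub>,
     ring.zero = fraction R S \<zero>\<^bsub>R\<^esub> \<one>\<^bsub>R\<^esub>,
     ring.add = (\<lambda>A B. \<Union>(r, s)\<in>A. \<Union>(r', s')\<in>B.
       fraction R S ((s' \<otimes>\<^bsub>R\<^esub> r) \<oplus>\<^bsub>R\<^esub> (s \<otimes>\<^bsub>R\<^esub> r')) (s \<otimes>\<^bsub>R\<^esub> s'))\<rparr>"

text \<open>The canonical map from a localization at a subset of \<open>S'\<close> to the localization at \<open>S'\<close>.\<close>

definition localization_map :: "('a, 'c) ring_scheme \<Rightarrow> 'a set \<Rightarrow> ('a \<times> 'a) set \<Rightarrow> ('a \<times> 'a) set" where
  "localization_map R S' A = (\<Union>(r, s)\<in>A. fraction R S' r s)"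


section \<open>Local cohomology\<close>

text \<open>Local cohomology \<open>H\<^sup>i\<close> of \<open>R\<close> with support in the ideal generated by
  \<open>x\<^sub>0, \<dots>, x\<^sub>n\<^sub>-\<^sub>1\<close>, via the Cech complex: its term in degree \<open>i\<close> is the direct sum, over
  the \<open>i\<close>-element sets \<open>I\<close> of indices, of the localizations \<open>R\<^sub>I\<close> of \<open>R\<close> at the product
  of the \<open>x\<^sub>j\<close> with \<open>j \<in> I\<close>. Inverting the submonoid generated by the \<open>x\<^sub>j\<close> rather than the
  powers of their product gives the same ring and makes the denominators of \<open>R\<^sub>I\<close> a subset
  of those of \<open>R\<^sub>J\<close> for \<open>I \<subseteq> J\<close>.\<close>

definition cech_ring :: "('a, 'c) ring_scheme \<Rightarrow> 'a list \<Rightarrow> nat set \<Rightarrow> ('a \<times> 'a) set ring" where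
  "cech_ring R xs I =
    localization R {finprod R (\<lambda>j. (xs ! j) [^]\<^bsub>R\<^esub> e j) I | e :: nat \<Rightarrow> nat. True}"

definition cech_map :: "('a, 'c) ring_scheme \<Rightarrow> 'a list \<Rightarrow> nat set \<Rightarrow> ('a \<times> 'a) set \<Rightarrow> ('a \<times> 'a) set" where
  "cech_map R xs J =
    localization_map R {finprod R (\<lambda>j. (xs ! j) [^]\<^bsub>R\<^esub> e j) J | e :: nat \<Rightarrow> nat. True}"

definition cech_index :: "'a list \<Rightarrow> nat \<Rightarrow> nat set set" where
  "cech_index xs i = {I. I \<subseteq> {..<length xs} \<and> card I = i}"

definition cech_group ::
  "('a, 'c) ring_scheme \<Rightarrow> 'a list \<Rightarrow> nat \<Rightarrow> (nat set \<Rightarrow> ('a \<times> 'a) set) monoid" where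
  "cech_group R xs i =
    \<lparr>carrier = (\<Pi>\<^sub>E I\<in>cech_index xs i. carrier (cech_ring R xs I)),
     monoid.mult = (\<lambda>c c'. \<lambda>I\<in>cech_index xs i. c I \<oplus>\<^bsub>cech_ring R xs I\<^esub> c' I),
     one = (\<lambda>I\<in>cech_index xs i. \<zero>\<^bsub>cech_ring R xs I\<^esub>)\<rparr>"

definition cech_diff ::
  "('a, 'c) ring_scheme \<Rightarrow> 'a list \<Rightarrow> nat \<Rightarrow> (nat set \<Rightarrow> ('a \<times> 'a) set) \<Rightarrow> nat set \<Rightarrow> ('a \<times> 'a) set" where
  "cech_diff R xs i c =
    (\<lambda>J\<in>cech_index xs (Suc i).
      finsum (cech_ring R xs J)
        (\<lambda>j. if even (card {l\<in>J. l < j}) then cech_map R xs J (c (J - {j}))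
             else \<ominus>\<^bsub>cech_ring R xs J\<^esub> cech_map R xs J (c (J - {j}))) J)"

definition cech_cocycles :: "('a, 'c) ring_scheme \<Rightarrow> 'a list \<Rightarrow> nat \<Rightarrow> (nat set \<Rightarrow> ('a \<times> 'a) set) set" where
  "cech_cocycles R xs i = kernel (cech_group R xs i) (cech_group R xs (Suc i)) (cech_diff R xs i)"

definition cech_coboundaries :: "('a, 'c) ring_scheme \<Rightarrow> 'a list \<Rightarrow> nat \<Rightarrow> (nat set \<Rightarrow> ('a \<times> 'a) set) set" where
  "cech_coboundaries R xs i =
    (case i of 0 \<Rightarrow> {\<one>\<^bsub>cech_group R xs 0\<^esub>}
     | Suc j \<Rightarrow> cech_diff R xs j ` carrier (cech_group R xs j))"

definition local_cohomology ::
  "('a, 'c) ring_scheme \<Rightarrow> 'a list \<Rightarrow> nat \<Rightarrow> (nat set \<Rightarrow> ('a \<times> 'a) set) set monoid" where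
  "local_cohomology R xs i =
    (cech_group R xs i)\<lparr>carrier := cech_cocycles R xs i\<rparr> Mod cech_coboundaries R xs i"


section \<open>F-injectivity\<close>

text \<open>The Frobenius endomorphism of \<open>R\<close> induces on each localization the map
  \<open>r/s \<mapsto> r\<^sup>p/s\<^sup>p\<close>, that is, the \<open>p\<close>-th power map of the localization.\<close>

definition cech_frobenius ::
  "nat \<Rightarrow> ('a, 'c) ring_scheme \<Rightarrow> 'a list \<Rightarrow> nat \<Rightarrow> (nat set \<Rightarrow> ('a \<times> 'a) set) \<Rightarrow> nat set \<Rightarrow> ('a \<times> 'a) set" where
  "cech_frobenius p R xs i c = (\<lambda>I\<in>cech_index xs i. c I [^]\<^bsub>cech_ring R xs I\<^esub> p)"

text \<open>The class of \<open>c\<close> is sent to the class of the Frobenius image of \<open>c\<close>; the union is over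
  the representatives \<open>c\<close> of the class \<open>A\<close>.\<close>

definition local_cohomology_frobenius ::
  "nat \<Rightarrow> ('a, 'c) ring_scheme \<Rightarrow> 'a list \<Rightarrow> nat \<Rightarrow>
    (nat set \<Rightarrow> ('a \<times> 'a) set) set \<Rightarrow> (nat set \<Rightarrow> ('a \<times> 'a) set) set" where
  "local_cohomology_frobenius p R xs i A =
    (\<Union>c\<in>A. cech_coboundaries R xs i #>\<^bsub>cech_group R xs i\<^esub> cech_frobenius p R xs i c)"

text \<open>For \<open>R\<close> of prime characteristic \<open>p\<close> and a finitely generated ideal \<open>\<mm>\<close>. Local cohomology
  and its Frobenius action do not depend on the chosen finite system of generators of \<open>\<mm>\<close>;
  injectivity is required for some system.\<close>

definition F_injective :: "nat \<Rightarrow> ('a, 'c) ring_scheme \<Rightarrow> 'a set \<Rightarrow> bool" where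
  "F_injective p R \<mm> \<longleftrightarrow>
    (\<exists>xs. set xs \<subseteq> carrier R \<and> Idl\<^bsub>R\<^esub> (set xs) = \<mm> \<and>
      (\<forall>i. inj_on (local_cohomology_frobenius p R xs i) (carrier (local_cohomology R xs i))))"

end

theory Submission
  imports Defs "HOL-Library.Function_Algebras"
begin

text \<open>Suppose that \<open>x\<close> lies in the cone \<open>C\<close>, that \<open>2x, 3x \<in> M\<^sub>C\<close> and \<open>x \<notin> M\<^sub>C\<close>. Then \<open>X\<^sup>x\<close> is an element of an
extension of the toric face ring \<open>R\<close> that is not in \<open>R\<close>, while its \<open>p\<close>-th power is. If \<open>z\<close> is a Cech cocycle over \<open>R\<close> that is the
coboundary of a cochain \<open>s\<close> with entries of this kind, then the Frobenius image of \<open>z\<close> is the coboundary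
of \<open>s\<^sup>p\<close>, which has entries in \<open>R\<close>; so F-injectivity forces \<open>z\<close> to be a coboundary over \<open>R\<close>
(\<open>koszul_inj_generators\<close>, \<open>koszul_inj\<close>). The proof constructs \<open>z\<close> and \<open>s\<close> for which this is impossible.

The Cech complex belongs to an unknown system of generators of the maximal ideal, whereas the
construction needs monomials. All Cech cochains are written with a common denominator \<open>x\<^sub>I\<^sup>N\<close>, so that the
Cech complex becomes the colimit over \<open>N\<close> of the Koszul complexes on \<open>x\<^sub>j\<^sup>N\<close>. In this language the
injectivity statement passes from one system of generators to another by adding and removing
elements one at a time: an element of the ideal of the \<open>x\<^sub>j\<close> acts on the Koszul complex as zero up to an
explicit homotopy (\<open>koszul_inj_change\<close>). The ring \<open>R\<close> itself is embedded by the map \<open>Theta\<close> into the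
product over the cones of copies of the Laurent polynomial ring, where one computes.

For the obstruction choose a pair \<open>(b, E)\<close> of a lattice point \<open>b\<close> and a cone \<open>E\<close> of the fan, contained in
a common cone \<open>K\<close>, with \<open>2b\<close> and \<open>3b\<close> in the support, \<open>b + M\<^sub>E\<close> disjoint from it, and \<open>E\<close> as large as
possible. So \<open>X\<^sup>b\<close> is not in the localization of \<open>R\<close> at \<open>E\<close>, but in those at all larger
cones that are contained in a common cone with \<open>b\<close> (\<open>larger_face\<close>). Shift the degree \<open>b\<close> by \<open>-c\<close>, where \<open>c\<close> is deep in the relative interior of \<open>E\<close>.
The part of the Cech complex of \<open>k[M\<^sub>K]\<close> in degree \<open>b - c\<close> then has a basis indexed by those sets \<open>I\<close> of
generators for which the smallest face containing \<open>I\<close> is strictly larger than \<open>E\<close>; adjoining \<open>X\<^sup>b\<close> also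
admits the sets whose smallest face is \<open>E\<close>. The family of sets whose smallest face contains \<open>E\<close> is
acyclic, because \<open>E\<close> is a proper face of \<open>K\<close>, while the family of sets whose smallest face is \<open>E\<close> is
not. Hence some cocycle \<open>s\<close> on the latter family has a coboundary that does not bound over \<open>R\<close>
(\<open>no_extension\<close>).

The two statements about families of sets express that a ball is contractible and a sphere is not.
Both are instances of \<open>acyclic_on_hit_family\<close>, proved by sweeping the cone along a generic line from the given
point into the interior: at each crossing of a facet the family changes by a family of the same kind
in the facet.\<close>


section \<open>Koszul complexes with powers of a sequence\<close>

text \<open>The position of \<open>j\<close> in \<open>J\<close> determines the sign of the \<open>j\<close>-th summand of the Cech differential.\<close>

definition ksgn :: "nat \<Rightarrow> nat set \<Rightarrow> 'a::comm_ring_1" where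
  "ksgn j J = (- 1) ^ card {l \<in> J. l < j}"

definition kd :: "(nat \<Rightarrow> 'a) \<Rightarrow> (nat set \<Rightarrow> 'a) \<Rightarrow> nat set \<Rightarrow> 'a::comm_ring_1" where
  "kd x r J = (\<Sum>j\<in>J. ksgn j J * x j * r (J - {j}))"

text \<open>Contraction with the \<open>j\<close>-th basis vector of the exterior algebra.\<close>

definition contract :: "nat \<Rightarrow> (nat set \<Rightarrow> 'a) \<Rightarrow> nat set \<Rightarrow> 'a::comm_ring_1" where
  "contract j r I = (if j \<in> I then 0 else ksgn j I * r (insert j I))"

lemma ksgn_sq [simp]: "ksgn j J * ksgn j J = 1"
  by (simp add: ksgn_def power_mult_distrib [symmetric])

lemma ksgn_sq' [simp]: "ksgn j J * (ksgn j J * z) = z"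
  by (simp add: mult.assoc [symmetric])

lemma ksgn_remove_self [simp]: "ksgn j (J - {j}) = ksgn j J"
  unfolding ksgn_def by (rule arg_cong [where f = "\<lambda>S. (- 1) ^ card S"]) auto

lemma ksgn_insert_self [simp]: "ksgn j (insert j J) = ksgn j J"
  unfolding ksgn_def by (rule arg_cong [where f = "\<lambda>S. (- 1) ^ card S"]) auto

lemma ksgn_remove:
  assumes "finite J" "l \<in> J"
  shows "ksgn j (J - {l}) = (if l < j then - ksgn j J else ksgn j J)"
proof (cases "l < j")
  case True
  have eq: "{i \<in> J. i < j} = insert l {i \<in> J - {l}. i < j}" using True assms by auto
  have "card {i \<in> J. i < j} = Suc (card {i \<in> J - {l}. i < j})"
    by (subst eq) (rule card_insert_disjoint; use assms in auto)
  then show ?thesis using True by (simp add: ksgn_def)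
next
  case False
  then have "{i \<in> J - {l}. i < j} = {i \<in> J. i < j}" by auto
  then show ?thesis using False by (simp add: ksgn_def)
qed

lemma ksgn_insert:
  assumes "finite J" "l \<notin> J"
  shows "ksgn j (insert l J) = (if l < j then - ksgn j J else ksgn j J)"
  using ksgn_remove [of "insert l J" l j, where 'a = 'a] assms by (auto split: if_splits)

lemma kd_cong:
  assumes "\<And>j. j \<in> J \<Longrightarrow> x j * r (J - {j}) = y j * s (J - {j})"
  shows "kd x r J = kd y s J"
  unfolding kd_def by (rule sum.cong) (simp_all add: assms mult.assoc)

lemma kd_add: "kd x (\<lambda>I. r I + s I) J = kd x r J + kd x s J"
  by (simp add: kd_def algebra_simps sum.distrib)

lemma kd_diff: "kd x (\<lambda>I. r I - s I) J = kd x r J - kd x s J"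
  by (simp add: kd_def algebra_simps sum_subtractf)

lemma kd_sum: "kd x (\<lambda>I. \<Sum>i\<in>S. r i I) J = (\<Sum>i\<in>S. kd x (r i) J)"
  unfolding kd_def by (subst sum.swap) (simp add: sum_distrib_left)

lemma kd_mult: "kd x (\<lambda>I. c * r I) J = c * kd x r J"
  by (simp add: kd_def sum_distrib_left algebra_simps)

lemma kd_zero: "(\<And>j. j \<in> J \<Longrightarrow> r (J - {j}) = 0) \<Longrightarrow> kd x r J = 0"
  by (simp add: kd_def)

text \<open>The transition maps of the system of Koszul complexes on the powers of a sequence; the
  Cech complex is the colimit of this system.\<close>

lemma kd_rescale:
  assumes "finite J"
  shows "kd (\<lambda>j. c j * x j) (\<lambda>I. (\<Prod>j\<in>I. c j) * r I) J = (\<Prod>j\<in>J. c j) * kd x r J"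
  unfolding kd_def sum_distrib_left
proof (rule sum.cong)
  fix j assume "j \<in> J"
  then have "prod c J = c j * prod c (J - {j})" using assms by (simp add: prod.remove)
  then show "ksgn j J * (c j * x j) * (prod c (J - {j}) * r (J - {j})) = prod c J * (ksgn j J * x j * r (J - {j}))"
    by (simp add: algebra_simps)
qed simp

lemma kd_kd:
  assumes "finite J"
  shows "kd x (kd x r) J = 0"
proof -
  define f where "f j l = ksgn j J * x j * (ksgn l (J - {j}) * x l * r (J - {j} - {l}))" for j l
  have f: "f l j = - f j l" if "j \<in> J" "l \<in> J" "j < l" for j l
  proof -
    have "J - {l} - {j} = J - {j} - {l}" by auto
    then show ?thesis
      using that assms by (simp add: f_def ksgn_remove)
  qed
  have "kd x (kd x r) J = (\<Sum>j\<in>J. \<Sum>l\<in>J - {j}. f j l)"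
    by (simp add: kd_def f_def sum_distrib_left)
  also have "\<dots> = (\<Sum>(j, l)\<in>(SIGMA j:J. J - {j}). f j l)"
    using assms by (simp add: sum.Sigma)
  also have "(SIGMA j:J. J - {j}) = {(j, l) \<in> J \<times> J. j < l} \<union> {(j, l) \<in> J \<times> J. l < j}"
    by auto
  also have "(\<Sum>(j, l)\<in>\<dots>. f j l)
      = (\<Sum>(j, l)\<in>{(j, l) \<in> J \<times> J. j < l}. f j l) + (\<Sum>(j, l)\<in>{(j, l) \<in> J \<times> J. l < j}. f j l)"
  proof (rule sum.union_disjoint)
    have "finite (J \<times> J)" using assms by simp
    then show "finite {(j, l) \<in> J \<times> J. j < l}" "finite {(j, l) \<in> J \<times> J. l < j}"
      by (rule rev_finite_subset; auto)+
  qed auto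
  also have "(\<Sum>(j, l)\<in>{(j, l) \<in> J \<times> J. l < j}. f j l) = (\<Sum>(j, l)\<in>{(j, l) \<in> J \<times> J. j < l}. f l j)"
    by (rule sum.reindex_bij_witness [of _ prod.swap prod.swap]) auto
  also have "\<dots> = (\<Sum>(j, l)\<in>{(j, l) \<in> J \<times> J. j < l}. - f j l)"
    by (rule sum.cong) (auto simp: f)
  finally show ?thesis by (simp add: split_def sum_negf)
qed

text \<open>The homotopy that makes every element of the sequence act as zero on Koszul cohomology.\<close>

lemma kd_contract:
  assumes J: "finite J"
  shows "kd x (contract j r) J + contract j (kd x r) J = x j * r J"
proof (cases "j \<in> J")
  case True
  have "kd x (contract j r) J = (\<Sum>l\<in>J. if l = j then x j * r J else 0)"
    unfolding kd_def
  proof (rule sum.cong)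
    fix l assume "l \<in> J"
    show "ksgn l J * x l * contract j r (J - {l}) = (if l = j then x j * r J else 0)"
      using True by (auto simp: contract_def insert_absorb algebra_simps)
  qed simp
  then show ?thesis using True J by (simp add: contract_def)
next
  case False
  have "contract j (kd x r) J
      = ksgn j J * (ksgn j J * x j * r J + (\<Sum>l\<in>J. ksgn l (insert j J) * x l * r (insert j J - {l})))"
    using False J by (simp add: contract_def kd_def)
  also have "\<dots> = x j * r J + (\<Sum>l\<in>J. ksgn j J * (ksgn l (insert j J) * x l * r (insert j J - {l})))"
    by (simp add: algebra_simps sum_distrib_left)
  also have "(\<Sum>l\<in>J. ksgn j J * (ksgn l (insert j J) * x l * r (insert j J - {l}))) = - kd x (contract j r) J"
    unfolding kd_def sum_negf [symmetric]
  proof (rule sum.cong)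
    fix l assume l: "l \<in> J"
    have "insert j J - {l} = insert j (J - {l})" "l \<noteq> j" using l False by auto
    then show "ksgn j J * (ksgn l (insert j J) * x l * r (insert j J - {l}))
        = - (ksgn l J * x l * contract j r (J - {l}))"
      using l False J by (auto simp: contract_def ksgn_remove ksgn_insert algebra_simps)
  qed simp
  finally show ?thesis by simp
qed

definition contract_sum :: "nat set \<Rightarrow> (nat \<Rightarrow> 'a) \<Rightarrow> (nat set \<Rightarrow> 'a) \<Rightarrow> nat set \<Rightarrow> 'a::comm_ring_1" where
  "contract_sum T a r I = (\<Sum>j\<in>T. a j * contract j r I)"

lemma kd_contract_sum:
  assumes J: "finite J"
  shows "kd x (contract_sum T a r) J + contract_sum T a (kd x r) J = (\<Sum>j\<in>T. a j * x j) * r J"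
proof -
  have "kd x (contract_sum T a r) J = (\<Sum>j\<in>T. a j * kd x (contract j r) J)"
    unfolding contract_sum_def kd_sum kd_mult ..
  then have "kd x (contract_sum T a r) J + contract_sum T a (kd x r) J
      = (\<Sum>j\<in>T. a j * (kd x (contract j r) J + contract j (kd x r) J))"
    by (simp add: contract_sum_def algebra_simps sum.distrib)
  then show ?thesis by (simp add: kd_contract [OF J] sum_distrib_right mult.assoc)
qed

lemma contract_sum_cong:
  assumes "\<And>j. j \<in> T \<Longrightarrow> j \<notin> I \<Longrightarrow> r (insert j I) = s (insert j I)"
  shows "contract_sum T a r I = contract_sum T a s I"
  unfolding contract_sum_def by (rule sum.cong) (auto simp: contract_def assms)

locale subring_set =
  fixes A :: "'a::comm_ring_1 set"
  assumes one_mem: "1 \<in> A"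
    and diff_mem: "a \<in> A \<Longrightarrow> b \<in> A \<Longrightarrow> a - b \<in> A"
    and mult_mem: "a \<in> A \<Longrightarrow> b \<in> A \<Longrightarrow> a * b \<in> A"
begin

lemma zero_mem: "0 \<in> A"
  using diff_mem [OF one_mem one_mem] by simp

lemma uminus_mem: "a \<in> A \<Longrightarrow> - a \<in> A"
  using diff_mem [OF zero_mem] by simp

lemma add_mem: "a \<in> A \<Longrightarrow> b \<in> A \<Longrightarrow> a + b \<in> A"
  using diff_mem [OF _ uminus_mem] by simp

lemma sum_mem: "(\<And>i. i \<in> S \<Longrightarrow> f i \<in> A) \<Longrightarrow> sum f S \<in> A"
  by (induction S rule: infinite_finite_induct) (auto simp: zero_mem add_mem)

lemma prod_mem: "(\<And>i. i \<in> S \<Longrightarrow> f i \<in> A) \<Longrightarrow> prod f S \<in> A"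
  by (induction S rule: infinite_finite_induct) (auto simp: one_mem mult_mem)

lemma power_mem: "a \<in> A \<Longrightarrow> a ^ n \<in> A"
  by (induction n) (auto simp: one_mem mult_mem)

lemma of_nat_mem: "of_nat n \<in> A"
  by (induction n) (auto simp: zero_mem one_mem add_mem)

lemma ksgn_mem: "ksgn j J \<in> A"
  unfolding ksgn_def by (intro power_mem uminus_mem one_mem)

lemma kd_mem:
  assumes "\<And>j. j \<in> J \<Longrightarrow> x j \<in> A" "\<And>j. j \<in> J \<Longrightarrow> r (J - {j}) \<in> A"
  shows "kd x r J \<in> A"
  unfolding kd_def by (intro sum_mem mult_mem ksgn_mem assms)

lemma contract_sum_mem:
  assumes "\<And>j. j \<in> T \<Longrightarrow> a j \<in> A" "\<And>j. j \<in> T \<Longrightarrow> j \<notin> I \<Longrightarrow> r (insert j I) \<in> A"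
  shows "contract_sum T a r I \<in> A"
  unfolding contract_sum_def by (intro sum_mem mult_mem assms)
    (auto simp: contract_def zero_mem intro!: mult_mem ksgn_mem assms)

definition in_ideal :: "(nat \<Rightarrow> 'a) \<Rightarrow> nat set \<Rightarrow> 'a \<Rightarrow> bool" where
  "in_ideal x T y \<longleftrightarrow> (\<exists>a. (\<forall>j\<in>T. a j \<in> A) \<and> y = (\<Sum>j\<in>T. a j * x j))"

lemma in_idealI: "(\<And>j. j \<in> T \<Longrightarrow> a j \<in> A) \<Longrightarrow> y = (\<Sum>j\<in>T. a j * x j) \<Longrightarrow> in_ideal x T y"
  unfolding in_ideal_def by blast

lemma in_ideal_zero: "in_ideal x T 0"
  by (rule in_idealI [of _ "\<lambda>_. 0"]) (auto simp: zero_mem)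

lemma in_ideal_add:
  assumes "in_ideal x T y" "in_ideal x T z"
  shows "in_ideal x T (y + z)"
proof -
  obtain a b where "\<forall>j\<in>T. a j \<in> A" "y = (\<Sum>j\<in>T. a j * x j)" "\<forall>j\<in>T. b j \<in> A" "z = (\<Sum>j\<in>T. b j * x j)"
    using assms unfolding in_ideal_def by blast
  then show ?thesis
    by (intro in_idealI [of _ "\<lambda>j. a j + b j"]) (auto simp: add_mem algebra_simps sum.distrib)
qed

lemma in_ideal_mult:
  assumes "c \<in> A" "in_ideal x T y"
  shows "in_ideal x T (c * y)"
proof -
  obtain a where "\<forall>j\<in>T. a j \<in> A" "y = (\<Sum>j\<in>T. a j * x j)"
    using assms unfolding in_ideal_def by blast
  then show ?thesis
    by (intro in_idealI [of _ "\<lambda>j. c * a j"]) (auto simp: mult_mem assms sum_distrib_left mult.assoc)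
qed

lemma in_ideal_sum: "(\<And>i. i \<in> S \<Longrightarrow> in_ideal x T (f i)) \<Longrightarrow> in_ideal x T (sum f S)"
  by (induction S rule: infinite_finite_induct) (auto simp: in_ideal_zero in_ideal_add)

lemma in_ideal_mono:
  assumes "finite T'" "T \<subseteq> T'" "in_ideal x T y"
  shows "in_ideal x T' y"
proof -
  obtain a where "\<forall>j\<in>T. a j \<in> A" "y = (\<Sum>j\<in>T. a j * x j)"
    using assms unfolding in_ideal_def by blast
  then show ?thesis
    using assms(1,2)
    by (intro in_idealI [of _ "\<lambda>j. if j \<in> T then a j else 0"])
       (auto simp: zero_mem if_distrib [of "\<lambda>c. c * _"] sum.If_cases Int_absorb1 cong: if_cong)
qed

lemma in_ideal_gen: "finite T \<Longrightarrow> j \<in> T \<Longrightarrow> in_ideal x T (x j)"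
  by (rule in_idealI [of _ "\<lambda>i. if i = j then 1 else 0"])
     (auto simp: zero_mem one_mem if_distrib [of "\<lambda>c. c * _"] cong: if_cong)

text \<open>In the expansion of a high power of \<open>y = a\<^sub>t x\<^sub>t + y'\<close> each term contains a high power of
  \<open>x\<^sub>t\<close> or of \<open>y'\<close>, and \<open>y'\<close> involves one generator less.\<close>

lemma power_in_ideal:
  assumes "finite T" "\<And>j. j \<in> T \<Longrightarrow> x j \<in> A" "in_ideal x T y"
  shows "\<exists>m. in_ideal (\<lambda>j. x j ^ N) T (y ^ m)"
  using assms
proof (induction T arbitrary: y rule: finite_induct)
  case empty
  then have "y ^ 1 = 0" by (simp add: in_ideal_def)
  then show ?case using in_ideal_zero by metis
next
  case (insert t T)
  obtain a where a: "\<forall>j\<in>insert t T. a j \<in> A" "y = (\<Sum>j\<in>insert t T. a j * x j)"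
    using insert.prems unfolding in_ideal_def by blast
  define y' where "y' = (\<Sum>j\<in>T. a j * x j)"
  have y': "y = a t * x t + y'" "in_ideal x T y'" "y' \<in> A"
    using a insert by (auto simp: y'_def intro!: in_idealI [of _ a] sum_mem mult_mem)
  obtain m where m: "in_ideal (\<lambda>j. x j ^ N) T (y' ^ m)"
    using insert.IH [OF _ y'(2)] insert.prems by auto
  have "in_ideal (\<lambda>j. x j ^ N) (insert t T)
      (of_nat ((N + m) choose k) * (a t * x t) ^ k * y' ^ (N + m - k))" if "k \<le> N + m" for k
  proof (cases "k \<ge> N")
    case True
    then have "(a t * x t) ^ k = a t ^ k * x t ^ (k - N) * x t ^ N"
      by (simp add: power_mult_distrib power_add [symmetric] mult.assoc)
    then have *: "of_nat ((N + m) choose k) * (a t * x t) ^ k * y' ^ (N + m - k)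
      = (of_nat ((N + m) choose k) * a t ^ k * x t ^ (k - N) * y' ^ (N + m - k)) * x t ^ N"
      by (simp add: algebra_simps)
    show ?thesis unfolding *
      by (rule in_ideal_mult)
         (use insert a y' in \<open>auto intro!: mult_mem power_mem of_nat_mem in_ideal_gen [of _ t "\<lambda>j. x j ^ N"]\<close>)
  next
    case False
    then have "y' ^ (N + m - k) = y' ^ (N - k) * y' ^ m"
      by (simp add: power_add [symmetric])
    then have *: "of_nat ((N + m) choose k) * (a t * x t) ^ k * y' ^ (N + m - k)
      = (of_nat ((N + m) choose k) * (a t * x t) ^ k * y' ^ (N - k)) * y' ^ m"
      by (simp add: algebra_simps)
    show ?thesis unfolding *
      by (rule in_ideal_mult)
         (use insert a y' in_ideal_mono [OF _ subset_insertI m] in \<open>auto intro!: mult_mem power_mem of_nat_mem\<close>)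
  qed
  then have "in_ideal (\<lambda>j. x j ^ N) (insert t T) (y ^ (N + m))"
    unfolding y'(1) binomial_ring by (intro in_ideal_sum) auto
  then show ?case by blast
qed

end

locale frobenius_subring = subring_set A for A :: "'a::comm_ring_1 set" +
  fixes p :: nat
  assumes p_pos: "p > 0"
    and frobenius_add: "(f + g :: 'a) ^ p = f ^ p + g ^ p"
begin

definition frobenius_preimage :: "'a set" where
  "frobenius_preimage = {g. g ^ p \<in> A}"

lemma mem_frobenius_preimage: "a \<in> A \<Longrightarrow> a \<in> frobenius_preimage"
  by (simp add: frobenius_preimage_def power_mem)

lemma frobenius_preimage_add: "f \<in> frobenius_preimage \<Longrightarrow> g \<in> frobenius_preimage \<Longrightarrow> f + g \<in> frobenius_preimage"
  by (simp add: frobenius_preimage_def frobenius_add add_mem)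

lemma frobenius_preimage_mult: "a \<in> A \<Longrightarrow> g \<in> frobenius_preimage \<Longrightarrow> a * g \<in> frobenius_preimage"
  by (simp add: frobenius_preimage_def power_mult_distrib mult_mem power_mem)

lemma frobenius_preimage_sum: "(\<And>i. i \<in> S \<Longrightarrow> f i \<in> frobenius_preimage) \<Longrightarrow> sum f S \<in> frobenius_preimage"
  by (induction S rule: infinite_finite_induct) (auto simp: mem_frobenius_preimage zero_mem frobenius_preimage_add)

text \<open>In the colimit over \<open>N\<close>, this says that the cohomology with coefficients in \<open>A\<close> injects into
  the cohomology with coefficients in \<open>frobenius_preimage\<close>, the elements whose \<open>p\<close>-th power is in \<open>A\<close>.\<close>

definition koszul_inj :: "(nat \<Rightarrow> 'a) \<Rightarrow> nat set \<Rightarrow> bool" where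
  "koszul_inj x T \<longleftrightarrow> (\<forall>N s.
     (\<forall>I. I \<subseteq> T \<longrightarrow> s I \<in> frobenius_preimage) \<longrightarrow>
     (\<forall>J. J \<subseteq> T \<longrightarrow> kd (\<lambda>j. x j ^ N) s J \<in> A) \<longrightarrow>
     (\<exists>t w. (\<forall>I. I \<subseteq> T \<longrightarrow> w I \<in> A) \<and>
        (\<forall>J. J \<subseteq> T \<longrightarrow> (\<Prod>j\<in>J. x j ^ t) * kd (\<lambda>j. x j ^ N) s J = kd (\<lambda>j. x j ^ (N + t)) w J)))"

text \<open>After subtracting a coboundary, a cocycle on the larger index set is supported on sets containing
  \<open>t\<close>. There a power of \<open>x\<^sub>t\<close> is among the transition factors, and it is null-homotopic because it lies
  in the ideal of the other elements.\<close>

lemma koszul_inj_insert: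
  assumes "finite T" "t \<notin> T" "\<And>j. j \<in> insert t T \<Longrightarrow> x j \<in> A" "in_ideal x T (x t)"
    and inj: "koszul_inj x T"
  shows "koszul_inj x (insert t T)"
  unfolding koszul_inj_def
proof (intro allI impI)
  fix N s
  let ?T = "insert t T"
  assume s: "\<forall>I. I \<subseteq> ?T \<longrightarrow> s I \<in> frobenius_preimage" and z: "\<forall>J. J \<subseteq> ?T \<longrightarrow> kd (\<lambda>j. x j ^ N) s J \<in> A"
  then obtain e w0 where w0: "\<And>I. I \<subseteq> T \<Longrightarrow> w0 I \<in> A"
    "\<And>J. J \<subseteq> T \<Longrightarrow> (\<Prod>j\<in>J. x j ^ e) * kd (\<lambda>j. x j ^ N) s J = kd (\<lambda>j. x j ^ (N + e)) w0 J"
    using inj unfolding koszul_inj_def by (metis subset_insertI2)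
  define M where "M = N + e"
  define w where "w I = (if t \<in> I then 0 else w0 I)" for I
  define z1 where "z1 J = (\<Prod>j\<in>J. x j ^ e) * kd (\<lambda>j. x j ^ N) s J - kd (\<lambda>j. x j ^ M) w J" for J
  have fin: "finite J" if "J \<subseteq> ?T" for J using that assms(1) finite_subset by auto
  have wA: "w I \<in> A" if "I \<subseteq> ?T" for I using that w0(1) [of I] by (auto simp: w_def zero_mem)
  have z1A: "z1 J \<in> A" if "J \<subseteq> ?T" for J
  proof -
    have "kd (\<lambda>j. x j ^ M) w J \<in> A"
      using that assms(3) by (intro kd_mem power_mem wA) auto
    moreover have "(\<Prod>j\<in>J. x j ^ e) \<in> A"
      using that assms(3) by (intro prod_mem power_mem) auto
    ultimately show ?thesis unfolding z1_def using that z by (intro diff_mem mult_mem) auto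
  qed
  have z1_0: "z1 J = 0" if "J \<subseteq> T" for J
  proof -
    have "kd (\<lambda>j. x j ^ M) w J = kd (\<lambda>j. x j ^ M) w0 J"
      by (rule kd_cong) (use that assms(2) in \<open>auto simp: w_def\<close>)
    then show ?thesis using w0(2) [OF that] by (simp add: z1_def M_def)
  qed
  have dz1: "kd (\<lambda>j. x j ^ M) z1 J = 0" if J: "J \<subseteq> ?T" for J
  proof -
    have "kd (\<lambda>j. x j ^ M) z1 J = kd (\<lambda>j. x j ^ M) (\<lambda>J. (\<Prod>j\<in>J. x j ^ e) * kd (\<lambda>j. x j ^ N) s J) J"
      unfolding z1_def [abs_def] kd_diff kd_kd [OF fin [OF J]] by simp
    also have "\<dots> = (\<Prod>j\<in>J. x j ^ e) * kd (\<lambda>j. x j ^ N) (kd (\<lambda>j. x j ^ N) s) J"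
      using kd_rescale [OF fin [OF J], of "\<lambda>j. x j ^ e" "\<lambda>j. x j ^ N" "kd (\<lambda>j. x j ^ N) s"]
      by (simp add: M_def power_add mult.commute)
    finally show ?thesis by (simp add: kd_kd [OF fin [OF J]])
  qed
  obtain m where "in_ideal (\<lambda>j. x j ^ M) T (x t ^ m)"
    using power_in_ideal [of T x "x t"] assms by auto
  then obtain a where a: "\<And>j. j \<in> T \<Longrightarrow> a j \<in> A" "x t ^ m = (\<Sum>j\<in>T. a j * x j ^ M)"
    unfolding in_ideal_def by blast
  define h where "h = contract_sum T a z1"
  have hA: "h I \<in> A" if "I \<subseteq> ?T" for I
    unfolding h_def by (rule contract_sum_mem) (use a that z1A in auto)
  have h0: "h I = 0" if "I \<subseteq> T" for I
    unfolding h_def contract_sum_def by (rule sum.neutral) (use that z1_0 in \<open>auto simp: contract_def\<close>)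
  have dh: "kd (\<lambda>j. x j ^ M) h J = x t ^ m * z1 J" if J: "J \<subseteq> ?T" for J
  proof -
    have "contract_sum T a (kd (\<lambda>j. x j ^ M) z1) J = contract_sum T a (\<lambda>_. 0) J"
      by (rule contract_sum_cong) (use J in \<open>auto intro!: dz1\<close>)
    also have "\<dots> = 0" by (auto simp: contract_sum_def contract_def intro!: sum.neutral)
    finally have "contract_sum T a (kd (\<lambda>j. x j ^ M) z1) J = 0" .
    then show ?thesis
      using kd_contract_sum [OF fin [OF J], of "\<lambda>j. x j ^ M" T a z1] a(2) by (simp add: h_def)
  qed
  define u where "u I = (\<Prod>j\<in>I - {t}. x j ^ m) * h I" for I
  have du: "kd (\<lambda>j. x j ^ (M + m)) u J = (\<Prod>j\<in>J. x j ^ m) * z1 J" if J: "J \<subseteq> ?T" for J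
  proof (cases "t \<in> J")
    case True
    have "kd (\<lambda>j. x j ^ (M + m)) u J
        = kd (\<lambda>j. (if j = t then 1 else x j ^ m) * x j ^ M)
            (\<lambda>I. (\<Prod>j\<in>I. if j = t then 1 else x j ^ m) * h I) J"
    proof (rule kd_cong)
      fix j assume j: "j \<in> J"
      have eq: "(\<Prod>j\<in>I. if j = t then 1 else x j ^ m) = (\<Prod>j\<in>I - {t}. x j ^ m)" if "finite I" for I
        using that by (intro prod.mono_neutral_cong_right) auto
      show "x j ^ (M + m) * u (J - {j})
          = (if j = t then 1 else x j ^ m) * x j ^ M * ((\<Prod>j\<in>J - {j}. if j = t then 1 else x j ^ m) * h (J - {j}))"
      proof (cases "j = t")
        case True
        then have "h (J - {j}) = 0" using J by (intro h0) auto
        then show ?thesis by (simp add: u_def)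
      next
        case False
        then show ?thesis using fin [OF J] by (simp add: u_def eq power_add algebra_simps)
      qed
    qed
    also have "\<dots> = (\<Prod>j\<in>J. if j = t then 1 else x j ^ m) * kd (\<lambda>j. x j ^ M) h J"
      by (rule kd_rescale [OF fin [OF J]])
    also have "\<dots> = (\<Prod>j\<in>J. if j = t then 1 else x j ^ m) * x t ^ m * z1 J"
      by (simp add: dh [OF J])
    also have "(\<Prod>j\<in>J. if j = t then 1 else x j ^ m) * x t ^ m = (\<Prod>j\<in>J. x j ^ m)"
      using True fin [OF J] by (simp add: prod.remove [of J t "\<lambda>j. x j ^ m"] prod.remove [of J t "\<lambda>j. if j = t then 1 else x j ^ m"] mult.commute)
    finally show ?thesis .
  next
    case False
    then have "z1 J = 0" using J by (intro z1_0) auto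
    moreover have "kd (\<lambda>j. x j ^ (M + m)) u J = 0"
    proof (rule kd_zero)
      fix j assume "j \<in> J"
      have "h (J - {j}) = 0" by (rule h0) (use False J in auto)
      then show "u (J - {j}) = 0" by (simp add: u_def)
    qed
    ultimately show ?thesis by simp
  qed
  define v where "v I = (\<Prod>j\<in>I. x j ^ m) * w I + u I" for I
  have "v I \<in> A" if "I \<subseteq> ?T" for I
    unfolding v_def u_def using that assms(3)
    by (intro add_mem mult_mem prod_mem power_mem wA hA) auto
  moreover have "(\<Prod>j\<in>J. x j ^ (e + m)) * kd (\<lambda>j. x j ^ N) s J = kd (\<lambda>j. x j ^ (N + (e + m))) v J"
    if J: "J \<subseteq> ?T" for J
  proof -
    have "kd (\<lambda>j. x j ^ (M + m)) (\<lambda>I. (\<Prod>j\<in>I. x j ^ m) * w I) J = (\<Prod>j\<in>J. x j ^ m) * kd (\<lambda>j. x j ^ M) w J"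
      using kd_rescale [OF fin [OF J], of "\<lambda>j. x j ^ m" "\<lambda>j. x j ^ M" w]
      by (simp add: power_add mult.commute)
    then have "kd (\<lambda>j. x j ^ (M + m)) v J = (\<Prod>j\<in>J. x j ^ m) * (\<Prod>j\<in>J. x j ^ e) * kd (\<lambda>j. x j ^ N) s J"
      unfolding v_def [abs_def] kd_add du [OF J] by (simp add: z1_def algebra_simps)
    also have "(\<Prod>j\<in>J. x j ^ m) * (\<Prod>j\<in>J. x j ^ e) = (\<Prod>j\<in>J. x j ^ (e + m))"
      by (simp add: power_add prod.distrib mult.commute)
    finally show ?thesis by (simp add: M_def add.assoc)
  qed
  ultimately show "\<exists>e w. (\<forall>I. I \<subseteq> ?T \<longrightarrow> w I \<in> A) \<and>
        (\<forall>J. J \<subseteq> ?T \<longrightarrow> (\<Prod>j\<in>J. x j ^ e) * kd (\<lambda>j. x j ^ N) s J = kd (\<lambda>j. x j ^ (N + e)) w J)"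
    by blast
qed

text \<open>A cochain \<open>s\<close> on the subsets of \<open>T\<close> is extended to sets containing \<open>t\<close> by a homotopy for
  multiplication by a power of \<open>x\<^sub>t\<close>. The extension is compatible with coboundaries, so the coboundary
  of the extension has entries in \<open>A\<close> as soon as that of \<open>s\<close> has.\<close>

lemma koszul_inj_remove:
  assumes T: "finite T" "t \<notin> T" "\<And>j. j \<in> insert t T \<Longrightarrow> x j \<in> A" "in_ideal x T (x t)"
    and inj: "koszul_inj x (insert t T)"
  shows "koszul_inj x T"
  unfolding koszul_inj_def
proof (intro allI impI)
  fix N s
  let ?T = "insert t T"
  assume s: "\<forall>I. I \<subseteq> T \<longrightarrow> s I \<in> frobenius_preimage" and z: "\<forall>J. J \<subseteq> T \<longrightarrow> kd (\<lambda>j. x j ^ N) s J \<in> A"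
  have fin: "finite J" if "J \<subseteq> ?T" for J using that assms(1) finite_subset by auto
  obtain m where "in_ideal (\<lambda>j. x j ^ N) T (x t ^ m)"
    using power_in_ideal [of T x "x t"] assms by auto
  then have "in_ideal (\<lambda>j. x j ^ N) T (x t ^ N * x t ^ m)"
    using T(3) by (intro in_ideal_mult power_mem) auto
  then obtain a where a: "\<And>j. j \<in> T \<Longrightarrow> a j \<in> A" "x t ^ (N + m) = (\<Sum>j\<in>T. a j * x j ^ N)"
    unfolding in_ideal_def by (auto simp: power_add)
  define \<xi> where "\<xi> j = (if j = t then x t ^ (N + m) else x j ^ N)" for j
  define c where "c j = (if j = t then 1 else x j ^ m)" for j
  have c\<xi>: "c j * \<xi> j = x j ^ (N + m)" for j by (simp add: c_def \<xi>_def power_add mult.commute)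
  define s' where "s' I = (if t \<in> I then ksgn t I * contract_sum T a s (I - {t}) else s I)" for I
  have s'T: "s' I \<in> frobenius_preimage" if I: "I \<subseteq> ?T" for I
  proof (cases "t \<in> I")
    case True
    have "contract j s (I - {t}) \<in> frobenius_preimage" if "j \<in> T" for j
    proof -
      have "insert j (I - {t}) \<subseteq> T" using I that by auto
      then have "s (insert j (I - {t})) \<in> frobenius_preimage" using s by blast
      then show ?thesis
        unfolding contract_def by (auto intro: frobenius_preimage_mult ksgn_mem mem_frobenius_preimage [OF zero_mem])
    qed
    then show ?thesis using True a
      by (auto simp: s'_def contract_sum_def intro!: frobenius_preimage_mult ksgn_mem frobenius_preimage_sum)
  next
    case False
    then show ?thesis using I s by (auto simp: s'_def)
  qed
  have low: "kd \<xi> s' J = kd (\<lambda>j. x j ^ N) s J" if "J \<subseteq> T" for J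
    by (rule kd_cong) (use that T(2) in \<open>auto simp: \<xi>_def s'_def\<close>)
  have high: "kd \<xi> s' (insert t I) = ksgn t I * contract_sum T a (kd (\<lambda>j. x j ^ N) s) I" if I: "I \<subseteq> T" for I
  proof -
    have tI: "t \<notin> I" "finite I" using I T fin by auto
    have "kd \<xi> s' (insert t I) = ksgn t I * x t ^ (N + m) * s I
        + (\<Sum>j\<in>I. ksgn j (insert t I) * x j ^ N * s' (insert t I - {j}))"
      using tI by (simp add: kd_def \<xi>_def s'_def cong: sum.cong) (rule sum.cong; use tI in auto)
    also have "(\<Sum>j\<in>I. ksgn j (insert t I) * x j ^ N * s' (insert t I - {j}))
        = - (ksgn t I * kd (\<lambda>j. x j ^ N) (contract_sum T a s) I)"
      unfolding kd_def sum_distrib_left sum_negf [symmetric]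
    proof (rule sum.cong)
      fix j assume j: "j \<in> I"
      then have "insert t I - {j} = insert t (I - {j})" "insert t I - {j} - {t} = I - {j}" "j \<noteq> t"
        using tI by auto
      then show "ksgn j (insert t I) * x j ^ N * s' (insert t I - {j})
          = - (ksgn t I * (ksgn j I * x j ^ N * contract_sum T a s (I - {j})))"
        using j tI by (auto simp: s'_def ksgn_insert ksgn_remove algebra_simps)
    qed simp
    also have "kd (\<lambda>j. x j ^ N) (contract_sum T a s) I = x t ^ (N + m) * s I - contract_sum T a (kd (\<lambda>j. x j ^ N) s) I"
      using kd_contract_sum [OF tI(2), of "\<lambda>j. x j ^ N" T a s] a(2) by (simp add: algebra_simps)
    finally show ?thesis by (simp add: algebra_simps)
  qed
  have zA: "kd \<xi> s' J \<in> A" if J: "J \<subseteq> ?T" for J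
  proof (cases "t \<in> J")
    case True
    have *: "insert t (J - {t}) = J" using True by auto
    have "contract_sum T a (kd (\<lambda>j. x j ^ N) s) (J - {t}) \<in> A"
    proof (rule contract_sum_mem)
      fix j assume "j \<in> T"
      then have "insert j (J - {t}) \<subseteq> T" using J by auto
      then show "kd (\<lambda>j. x j ^ N) s (insert j (J - {t})) \<in> A" using z by blast
    qed (use a in auto)
    moreover have "J - {t} \<subseteq> T" using J by auto
    ultimately show ?thesis using high [of "J - {t}"] ksgn_mem mult_mem unfolding * by auto
  next
    case False
    then have "J \<subseteq> T" using J by auto
    then show ?thesis using low z by auto
  qed
  define s2 where "s2 I = (\<Prod>j\<in>I. c j) * s' I" for I
  have cA: "c j \<in> A" if "j \<in> ?T" for j using that T by (auto simp: c_def one_mem intro!: power_mem)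
  have ds2: "kd (\<lambda>j. x j ^ (N + m)) s2 J = (\<Prod>j\<in>J. c j) * kd \<xi> s' J" if "J \<subseteq> ?T" for J
    using kd_rescale [OF fin [OF that], of c \<xi> s'] by (simp add: c\<xi> s2_def [abs_def])
  have "s2 I \<in> frobenius_preimage" if "I \<subseteq> ?T" for I
    unfolding s2_def using that by (intro frobenius_preimage_mult prod_mem s'T cA) auto
  moreover have "kd (\<lambda>j. x j ^ (N + m)) s2 J \<in> A" if "J \<subseteq> ?T" for J
    unfolding ds2 [OF that] using that by (intro mult_mem prod_mem zA cA) auto
  ultimately obtain e w where w: "\<And>I. I \<subseteq> ?T \<Longrightarrow> w I \<in> A"
    "\<And>J. J \<subseteq> ?T \<Longrightarrow> (\<Prod>j\<in>J. x j ^ e) * kd (\<lambda>j. x j ^ (N + m)) s2 J = kd (\<lambda>j. x j ^ (N + m + e)) w J"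
    using inj unfolding koszul_inj_def by metis
  have "(\<Prod>j\<in>J. x j ^ (m + e)) * kd (\<lambda>j. x j ^ N) s J = kd (\<lambda>j. x j ^ (N + (m + e))) w J"
    if J: "J \<subseteq> T" for J
  proof -
    have "(\<Prod>j\<in>J. c j) = (\<Prod>j\<in>J. x j ^ m)" by (rule prod.cong) (use J T in \<open>auto simp: c_def\<close>)
    then have "(\<Prod>j\<in>J. x j ^ (m + e)) * kd (\<lambda>j. x j ^ N) s J = (\<Prod>j\<in>J. x j ^ e) * kd (\<lambda>j. x j ^ (N + m)) s2 J"
      using ds2 [of J] low [OF J] J by (simp add: power_add prod.distrib mult.assoc mult.left_commute subset_insertI2)
    also have "\<dots> = kd (\<lambda>j. x j ^ (N + m + e)) w J" using J w(2) [of J] by auto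
    finally show ?thesis by (simp add: add.assoc)
  qed
  then show "\<exists>e w. (\<forall>I. I \<subseteq> T \<longrightarrow> w I \<in> A) \<and>
        (\<forall>J. J \<subseteq> T \<longrightarrow> (\<Prod>j\<in>J. x j ^ e) * kd (\<lambda>j. x j ^ N) s J = kd (\<lambda>j. x j ^ (N + e)) w J)"
    using w(1) by (intro exI [of _ "m + e"] exI [of _ w]) auto
qed

lemma koszul_inj_change:
  assumes fin: "finite S" "finite T" and A: "\<And>j. j \<in> S \<union> T \<Longrightarrow> x j \<in> A"
    and ST: "\<And>j. j \<in> T \<Longrightarrow> in_ideal x S (x j)" and TS: "\<And>j. j \<in> S \<Longrightarrow> in_ideal x T (x j)"
    and inj: "koszul_inj x S"
  shows "koszul_inj x T"
proof -
  have up: "koszul_inj x (S \<union> U)" if "finite U" "U \<subseteq> T" for U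
    using that
  proof (induction U rule: finite_induct)
    case (insert t U)
    show ?case
    proof (cases "t \<in> S \<union> U")
      case False
      then show ?thesis
        using koszul_inj_insert [of "S \<union> U" t x] insert A fin
          in_ideal_mono [of "S \<union> U" S x "x t"] ST by auto
    qed (use insert in \<open>simp add: insert_absorb\<close>)
  qed (use inj in simp)
  have ST': "koszul_inj x (T \<union> S)" using up [of T] fin by (simp add: Un_commute)
  have "koszul_inj x (T \<union> U) \<longrightarrow> koszul_inj x T" if "finite U" "U \<subseteq> S" for U
    using that
  proof (induction U rule: finite_induct)
    case (insert t U)
    show ?case
    proof (cases "t \<in> T \<union> U")
      case False
      then show ?thesis
        using koszul_inj_remove [of "T \<union> U" t x] insert A fin
          in_ideal_mono [of "T \<union> U" T x "x t"] TS by auto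
    qed (use insert in \<open>simp add: insert_absorb\<close>)
  qed simp
  then show ?thesis using ST' fin by blast
qed

end


section \<open>Acyclic families of faces of a cone\<close>

abbreviation cobd :: "(nat set \<Rightarrow> 'k) \<Rightarrow> nat set \<Rightarrow> 'k::comm_ring_1" where
  "cobd \<equiv> kd (\<lambda>_. 1)"

text \<open>The cochains supported on \<open>\<W>\<close> are a complex when \<open>\<W>\<close> is convex with respect to inclusion: a
  difference of two up-closed families. Acyclicity refers to all degrees at once.\<close>

definition acyclic_on :: "'k::comm_ring_1 itself \<Rightarrow> nat set set \<Rightarrow> bool" where
  "acyclic_on _ \<W> \<longleftrightarrow> (\<forall>c :: nat set \<Rightarrow> 'k. (\<forall>I. I \<notin> \<W> \<longrightarrow> c I = 0) \<longrightarrow> (\<forall>J\<in>\<W>. cobd c J = 0) \<longrightarrow>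
     (\<exists>e. (\<forall>I. I \<notin> \<W> \<longrightarrow> e I = 0) \<and> (\<forall>J\<in>\<W>. cobd e J = c J)))"

lemma acyclic_onE:
  fixes c :: "nat set \<Rightarrow> 'k::comm_ring_1"
  assumes "acyclic_on TYPE('k) \<W>"
    and "\<And>I. I \<notin> \<W> \<Longrightarrow> c I = 0" "\<And>J. J \<in> \<W> \<Longrightarrow> cobd c J = 0"
  obtains e where "\<And>I. I \<notin> \<W> \<Longrightarrow> e I = 0" "\<And>J. J \<in> \<W> \<Longrightarrow> cobd e J = c J"
  using assms unfolding acyclic_on_def by metis

lemma acyclic_on_empty: "acyclic_on TYPE('k::comm_ring_1) {}"
  unfolding acyclic_on_def by (auto intro!: exI [of _ "\<lambda>_. 0"])

lemma not_acyc_singleton: "\<not> acyclic_on TYPE('k::comm_ring_1) {{}}"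
proof
  assume a: "acyclic_on TYPE('k) {{}}"
  define c :: "nat set \<Rightarrow> 'k" where "c I = (if I = {} then 1 else 0)" for I
  have c: "c I = 0" if "I \<notin> {{}}" for I using that by (simp add: c_def)
  have dc: "cobd c J = 0" if "J \<in> {{}}" for J using that by (simp add: kd_def)
  obtain e where e: "\<And>I. I \<notin> {{}} \<Longrightarrow> e I = 0" "\<And>J. J \<in> {{}} \<Longrightarrow> cobd e J = c J"
    using acyclic_onE [OF a c dc] by blast
  from e(2) [of "{}"] show False by (simp add: c_def kd_def)
qed

lemma acyclic_on_Pow:
  assumes "finite T" "T \<noteq> {}"
  shows "acyclic_on TYPE('k::comm_ring_1) (Pow T)"
  unfolding acyclic_on_def
proof (intro allI impI)
  fix c :: "nat set \<Rightarrow> 'k"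
  assume c: "\<forall>I. I \<notin> Pow T \<longrightarrow> c I = 0" "\<forall>J\<in>Pow T. cobd c J = 0"
  obtain l where l: "l \<in> T" using assms by auto
  show "\<exists>e. (\<forall>I. I \<notin> Pow T \<longrightarrow> e I = 0) \<and> (\<forall>J\<in>Pow T. cobd e J = c J)"
  proof (intro exI [of _ "contract l c"] conjI allI impI ballI)
    fix I assume "I \<notin> Pow T"
    then show "contract l c I = 0" using c(1) by (auto simp: contract_def)
  next
    fix J assume J: "J \<in> Pow T"
    then have "finite J" using assms(1) finite_subset by auto
    moreover have "contract l (cobd c) J = 0" using c(2) J l by (auto simp: contract_def)
    ultimately show "cobd (contract l c) J = c J" using kd_contract [of J "\<lambda>_. 1" l c] by simp
  qed
qed

context
  fixes T :: "nat set" and \<V> \<U> :: "nat set set"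
  assumes fin: "finite T" and sub: "\<U> \<subseteq> \<V>" "\<V> \<subseteq> Pow T"
    and upX: "\<And>I J. I \<in> \<V> \<Longrightarrow> I \<subseteq> J \<Longrightarrow> J \<subseteq> T \<Longrightarrow> J \<in> \<V>"
    and upU: "\<And>I J. I \<in> \<U> \<Longrightarrow> I \<subseteq> J \<Longrightarrow> J \<subseteq> T \<Longrightarrow> J \<in> \<U>"
begin

lemma finite_member: "J \<in> \<V> \<Longrightarrow> finite J"
  using sub fin by (meson PowD finite_subset subsetD)

text \<open>For up-closed families \<open>\<U> \<subseteq> \<V>\<close> the cochains on \<open>\<U>\<close> are a subcomplex of those on \<open>\<V>\<close> with
  quotient the cochains on \<open>\<V> - \<U>\<close>. This lemma and the next are the two parts of the long exact
  sequence that the sweep needs.\<close>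

lemma acyclic_on_sub:
  assumes X: "acyclic_on TYPE('k::comm_ring_1) \<V>" and Y: "acyclic_on TYPE('k) (\<V> - \<U>)"
  shows "acyclic_on TYPE('k) \<U>"
  unfolding acyclic_on_def
proof (intro allI impI)
  fix c :: "nat set \<Rightarrow> 'k"
  assume c: "\<forall>I. I \<notin> \<U> \<longrightarrow> c I = 0" "\<forall>J\<in>\<U>. cobd c J = 0"
  have cX: "cobd c J = 0" if "J \<in> \<V>" for J
  proof (cases "J \<in> \<U>")
    case False
    then have "J - {j} \<notin> \<U>" for j using upU that sub by blast
    then show ?thesis using c(1) by (intro kd_zero) auto
  qed (use c in auto)
  have c0: "c I = 0" if "I \<notin> \<V>" for I using c(1) sub that by blast
  obtain e where e: "\<And>I. I \<notin> \<V> \<Longrightarrow> e I = 0" "\<And>J. J \<in> \<V> \<Longrightarrow> cobd e J = c J"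
    using acyclic_onE [OF X c0 cX] by blast
  define y where "y I = (if I \<in> \<U> then 0 else e I)" for I
  have dy: "cobd y J = 0" if J: "J \<in> \<V> - \<U>" for J
  proof -
    have "J - {j} \<notin> \<U>" for j using upU J sub by blast
    then have "cobd y J = cobd e J" by (intro kd_cong) (auto simp: y_def)
    then show ?thesis using e(2) [of J] c(1) J by auto
  qed
  have y0: "y I = 0" if "I \<notin> \<V> - \<U>" for I using that by (auto simp: y_def e)
  obtain e' where e': "\<And>I. I \<notin> \<V> - \<U> \<Longrightarrow> e' I = 0" "\<And>J. J \<in> \<V> - \<U> \<Longrightarrow> cobd e' J = y J"
    using acyclic_onE [OF Y y0 dy] by blast
  define f where "f I = (if I \<in> \<U> then e I - cobd e' I else 0)" for I
  have "cobd f J = c J" if J: "J \<in> \<U>" for J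
  proof -
    have "f (J - {j}) = e (J - {j}) - cobd e' (J - {j})" for j
    proof (cases "J - {j} \<in> \<V> - \<U>")
      case True
      then show ?thesis using e'(2) by (auto simp: f_def y_def)
    next
      case False
      have "cobd e' (J - {j}) = 0" if "J - {j} \<notin> \<U>"
      proof (rule kd_zero)
        fix l
        have "J - {j} - {l} \<notin> \<V>"
          using False that upX [of "J - {j} - {l}" "J - {j}"] J sub by blast
        then show "e' (J - {j} - {l}) = 0" using e'(1) by auto
      qed
      then show ?thesis using False e(1) by (auto simp: f_def)
    qed
    then have "cobd f J = cobd (\<lambda>I. e I - cobd e' I) J" by (intro kd_cong) auto
    also have "\<dots> = cobd e J - cobd (cobd e') J" by (rule kd_diff)
    finally show ?thesis using J sub e(2) [of J] kd_kd [OF finite_member, of J "\<lambda>_. 1" e'] by auto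
  qed
  then show "\<exists>e. (\<forall>I. I \<notin> \<U> \<longrightarrow> e I = 0) \<and> (\<forall>J\<in>\<U>. cobd e J = c J)"
    by (intro exI [of _ f]) (auto simp: f_def)
qed

lemma acyclic_on_quotient:
  assumes X: "acyclic_on TYPE('k::comm_ring_1) \<V>" and U: "acyclic_on TYPE('k) \<U>"
  shows "acyclic_on TYPE('k) (\<V> - \<U>)"
  unfolding acyclic_on_def
proof (intro allI impI)
  fix y :: "nat set \<Rightarrow> 'k"
  assume y: "\<forall>I. I \<notin> \<V> - \<U> \<longrightarrow> y I = 0" "\<forall>J\<in>\<V> - \<U>. cobd y J = 0"
  define c where "c J = (if J \<in> \<U> then cobd y J else 0)" for J
  have c: "c J = cobd y J" if "J \<in> \<V>" for J using y(2) that by (auto simp: c_def)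
  have dc: "cobd c J = 0" if J: "J \<in> \<U>" for J
  proof -
    have "c (J - {j}) = cobd y (J - {j})" for j
    proof (cases "J - {j} \<in> \<V>")
      case False
      have "cobd y (J - {j}) = 0"
      proof (rule kd_zero)
        fix l
        have "J - {j} - {l} \<notin> \<V>"
          using False upX [of "J - {j} - {l}" "J - {j}"] J sub by blast
        then show "y (J - {j} - {l}) = 0" using y(1) by auto
      qed
      then show ?thesis using False sub by (auto simp: c_def)
    qed (rule c)
    then have "cobd c J = cobd (cobd y) J" by (intro kd_cong) auto
    then show ?thesis using J sub kd_kd [OF finite_member, of J "\<lambda>_. 1" y] by auto
  qed
  have c0: "c I = 0" if "I \<notin> \<U>" for I using that by (simp add: c_def)
  obtain u where u: "\<And>I. I \<notin> \<U> \<Longrightarrow> u I = 0" "\<And>J. J \<in> \<U> \<Longrightarrow> cobd u J = c J"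
    using acyclic_onE [OF U c0 dc] by blast
  have u': "cobd u J = c J" if J: "J \<in> \<V>" for J
  proof (cases "J \<in> \<U>")
    case False
    then have "J - {j} \<notin> \<U>" for j using upU that sub by blast
    then show ?thesis using u(1) False by (auto intro!: kd_zero simp: c_def)
  qed (use u in auto)
  define g where "g I = y I - u I" for I
  have dg: "cobd g J = 0" if "J \<in> \<V>" for J
    unfolding g_def [abs_def] kd_diff using that u' c by simp
  have g0: "g I = 0" if "I \<notin> \<V>" for I using that y(1) u(1) [of I] sub by (auto simp: g_def)
  obtain e where e: "\<And>I. I \<notin> \<V> \<Longrightarrow> e I = 0" "\<And>J. J \<in> \<V> \<Longrightarrow> cobd e J = g J"
    using acyclic_onE [OF X g0 dg] by blast
  define f where "f I = (if I \<in> \<U> then 0 else e I)" for I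
  have "cobd f J = y J" if J: "J \<in> \<V> - \<U>" for J
  proof -
    have "J - {j} \<notin> \<U>" for j using upU J sub by blast
    then have "cobd f J = cobd e J" by (intro kd_cong) (auto simp: f_def)
    then show ?thesis using e(2) [of J] J u(1) by (auto simp: g_def)
  qed
  then show "\<exists>e. (\<forall>I. I \<notin> \<V> - \<U> \<longrightarrow> e I = 0) \<and> (\<forall>J\<in>\<V> - \<U>. cobd e J = y J)"
    by (intro exI [of _ f]) (auto simp: f_def e)
qed

end

text \<open>Along a line in a direction \<open>v l\<close> outside one of the subspaces, a subspace that does not contain the
  line is met at most once; so the coefficients can be corrected for one subspace after another.\<close>

lemma avoid_subspaces:
  fixes v :: "nat \<Rightarrow> 'v::real_vector"
  assumes "finite \<S>" "finite T" "0 < \<delta>"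
    and "\<And>U. U \<in> \<S> \<Longrightarrow> subspace U \<and> (\<exists>l\<in>T. v l \<notin> U)"
  shows "\<exists>c. (\<forall>l\<in>T. 0 < c l \<and> c l < \<delta>) \<and> (\<forall>U\<in>\<S>. q + (\<Sum>l\<in>T. c l *\<^sub>R v l) \<notin> U)"
  using assms(1,4)
proof (induction \<S> rule: finite_induct)
  case empty
  show ?case using assms(3) by (intro exI [of _ "\<lambda>_. \<delta> / 2"]) auto
next
  case (insert U \<S>)
  then obtain c where c: "\<forall>l\<in>T. 0 < c l \<and> c l < \<delta>" "\<And>U. U \<in> \<S> \<Longrightarrow> q + (\<Sum>l\<in>T. c l *\<^sub>R v l) \<notin> U"
    by auto
  define x where "x = q + (\<Sum>l\<in>T. c l *\<^sub>R v l)"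
  obtain l where l: "l \<in> T" "v l \<notin> U" using insert.prems by auto
  have "finite {\<tau>. x + \<tau> *\<^sub>R v l \<in> V}" if V: "V \<in> insert U \<S>" for V
  proof -
    have sV: "subspace V" using insert.prems V by auto
    have "\<sigma> = \<tau>" if "x + \<tau> *\<^sub>R v l \<in> V" "x + \<sigma> *\<^sub>R v l \<in> V" for \<sigma> \<tau>
    proof (rule ccontr)
      assume ne: "\<sigma> \<noteq> \<tau>"
      have "(x + \<sigma> *\<^sub>R v l) - (x + \<tau> *\<^sub>R v l) \<in> V" using sV that by (intro subspace_diff)
      moreover have "(x + \<sigma> *\<^sub>R v l) - (x + \<tau> *\<^sub>R v l) = (\<sigma> - \<tau>) *\<^sub>R v l"
        by (simp add: scaleR_left_diff_distrib)
      ultimately have "(\<sigma> - \<tau>) *\<^sub>R v l \<in> V" by metis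
      then have "(1 / (\<sigma> - \<tau>)) *\<^sub>R (\<sigma> - \<tau>) *\<^sub>R v l \<in> V" by (rule subspace_scale [OF sV])
      then have vl: "v l \<in> V" using ne by simp
      then have "V \<in> \<S>" using V l by auto
      moreover have "(x + \<tau> *\<^sub>R v l) - \<tau> *\<^sub>R v l \<in> V"
        using sV that vl by (intro subspace_diff subspace_scale)
      ultimately show False using c(2) [of V] by (simp add: x_def)
    qed
    then have "{\<tau>. x + \<tau> *\<^sub>R v l \<in> V} \<subseteq> {\<tau>} \<or> {\<tau>. x + \<tau> *\<^sub>R v l \<in> V} = {}"
      if "x + \<tau> *\<^sub>R v l \<in> V" for \<tau> using that by auto
    then show ?thesis by (metis (no_types, lifting) Collect_empty_eq finite.simps finite_subset)
  qed
  then have "finite (\<Union>V\<in>insert U \<S>. {\<tau>. x + \<tau> *\<^sub>R v l \<in> V})" using insert.hyps by blast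
  moreover have "infinite {0<..<\<delta> - c l}" using c(1) l(1) by (simp add: infinite_Ioo)
  ultimately obtain \<tau> where \<tau>: "\<tau> \<in> {0<..<\<delta> - c l}" "\<tau> \<notin> (\<Union>V\<in>insert U \<S>. {\<tau>. x + \<tau> *\<^sub>R v l \<in> V})"
    by (meson finite_subset subsetI)
  have "q + (\<Sum>i\<in>T. (c(l := c l + \<tau>)) i *\<^sub>R v i) = x + \<tau> *\<^sub>R v l"
  proof -
    have "(\<Sum>i\<in>T. (c(l := c l + \<tau>)) i *\<^sub>R v i) = (\<Sum>i\<in>T. c i *\<^sub>R v i + (if i = l then \<tau> *\<^sub>R v l else 0))"
      by (rule sum.cong) (auto simp: algebra_simps)
    then show ?thesis using l(1) assms(2) by (simp add: x_def sum.distrib)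
  qed
  moreover have "0 < (c(l := c l + \<tau>)) i \<and> (c(l := c l + \<tau>)) i < \<delta>" if "i \<in> T" for i
    using c(1) \<tau>(1) that l(1) by (auto intro: add_pos_pos)
  ultimately show ?case using \<tau>(2) by (intro exI [of _ "c(l := c l + \<tau>)"]) auto
qed

text \<open>If \<open>H\<close> consists of the normals of the cone \<open>K\<close> spanned by the \<open>v l\<close> with \<open>l \<in> T\<close>, then \<open>I\<close> is in
  this family if and only if \<open>q + m \<in> K\<close> for some \<open>m\<close> in the cone spanned by the \<open>v l\<close> with \<open>l \<in> I\<close>. For
  \<open>q\<close> in the relative interior of \<open>-E\<close>, where \<open>E\<close> is a face of \<open>K\<close>, these are the sets \<open>I\<close> for
  which every face of \<open>K\<close> that contains all \<open>v l\<close> with \<open>l \<in> I\<close> also contains \<open>E\<close>.\<close>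

definition hit_family :: "(nat \<Rightarrow> 'v::real_inner) \<Rightarrow> 'v set \<Rightarrow> nat set \<Rightarrow> 'v \<Rightarrow> nat set set" where
  "hit_family v H T q = {I. I \<subseteq> T \<and> (\<forall>h\<in>H. h \<bullet> q < 0 \<longrightarrow> (\<exists>l\<in>I. 0 < h \<bullet> v l))}"

text \<open>Redundant normals are admitted, since the normals of a cone restrict to normals of its faces,
  but not to an irredundant system. The last condition makes the cone pointed.\<close>

definition cone_presentation :: "(nat \<Rightarrow> 'v::real_inner) \<Rightarrow> 'v set \<Rightarrow> nat set \<Rightarrow> bool" where
  "cone_presentation v H T \<longleftrightarrow> finite T \<and> finite H \<and> (\<forall>h\<in>H. \<forall>l\<in>T. 0 \<le> h \<bullet> v l) \<and>
     (\<forall>x\<in>span (v ` T). (\<forall>h\<in>H. 0 \<le> h \<bullet> x) \<longrightarrow>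
        (\<exists>c. (\<forall>l\<in>T. 0 \<le> c l) \<and> x = (\<Sum>l\<in>T. c l *\<^sub>R v l))) \<and>
     (\<forall>l\<in>T. \<exists>h\<in>H. 0 < h \<bullet> v l)"

lemma hit_family_up: "I \<in> hit_family v H T q \<Longrightarrow> I \<subseteq> J \<Longrightarrow> J \<subseteq> T \<Longrightarrow> J \<in> hit_family v H T q"
  unfolding hit_family_def by blast

lemma span_orth:
  assumes "x \<in> span S" "\<And>y. y \<in> S \<Longrightarrow> h \<bullet> y = 0"
  shows "(h :: 'v::real_inner) \<bullet> x = 0"
  using assms(1)
proof (rule span_induct)
  show "subspace {x. h \<bullet> x = 0}" by (auto simp: subspace_def inner_simps)
qed (use assms in auto)

lemma cone_boundary:
  assumes cp: "cone_presentation v H T" and x: "x \<in> span (v ` T)" "\<And>g. g \<in> H \<Longrightarrow> 0 \<le> g \<bullet> x"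
    and h: "h \<in> H" "h \<bullet> x = 0"
  shows "\<exists>c. (\<forall>l\<in>T. 0 \<le> c l) \<and> x = (\<Sum>l\<in>{l\<in>T. h \<bullet> v l = 0}. c l *\<^sub>R v l)"
proof -
  obtain c where c: "\<forall>l\<in>T. 0 \<le> c l" "x = (\<Sum>l\<in>T. c l *\<^sub>R v l)"
    using cp x unfolding cone_presentation_def by blast
  have fT: "finite T" and nn: "\<And>l. l \<in> T \<Longrightarrow> 0 \<le> h \<bullet> v l"
    using cp h unfolding cone_presentation_def by auto
  have "(\<Sum>l\<in>T. c l * (h \<bullet> v l)) = 0"
    using h(2) by (simp add: c(2) inner_sum_right)
  then have "\<forall>l\<in>T. c l * (h \<bullet> v l) = 0"
    using c(1) nn fT by (subst (asm) sum_nonneg_eq_0_iff) auto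
  then have "x = (\<Sum>l\<in>{l\<in>T. h \<bullet> v l = 0}. c l *\<^sub>R v l)"
    unfolding c(2) using fT by (intro sum.mono_neutral_right) auto
  then show ?thesis using c(1) by blast
qed

lemma cone_boundary_span:
  assumes "cone_presentation v H T" "x \<in> span (v ` T)" "\<And>g. g \<in> H \<Longrightarrow> 0 \<le> g \<bullet> x"
    and "h \<in> H" "h \<bullet> x = 0"
  shows "x \<in> span (v ` {l\<in>T. h \<bullet> v l = 0})"
proof -
  obtain c where "x = (\<Sum>l\<in>{l\<in>T. h \<bullet> v l = 0}. c l *\<^sub>R v l)"
    using cone_boundary [OF assms] by blast
  then show ?thesis by (simp only:) (rule span_sum, rule span_scale, rule span_base, auto)
qed

lemma cone_presentation_face:
  assumes cp: "cone_presentation v H T" and h: "h \<in> H"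
  shows "cone_presentation v H {l\<in>T. h \<bullet> v l = 0}"
proof -
  let ?F = "{l\<in>T. h \<bullet> v l = 0}"
  have "\<exists>c. (\<forall>l\<in>?F. 0 \<le> c l) \<and> x = (\<Sum>l\<in>?F. c l *\<^sub>R v l)"
    if x: "x \<in> span (v ` ?F)" "\<forall>g\<in>H. 0 \<le> g \<bullet> x" for x
  proof -
    have "h \<bullet> x = 0" by (rule span_orth [OF x(1)]) auto
    moreover have "x \<in> span (v ` T)" using x(1) span_mono [of "v ` ?F" "v ` T"] by auto
    ultimately show ?thesis using cone_boundary [OF cp _ _ h, of x] x(2) by auto
  qed
  then show ?thesis using cp unfolding cone_presentation_def by auto
qed

text \<open>A redundant normal \<open>h\<close> may vanish only on a face of codimension at least two. In that case a
  generic point of its hyperplane is not in the span of the face, and by this lemma crossing the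
  hyperplane there does not change the family. For the proof, adding to \<open>q\<close> a large multiple of an
  interior point of the face yields a point of the cone on which \<open>h\<close> vanishes.\<close>

lemma face_hit_family_nonempty:
  assumes cp: "cone_presentation v H T" and h: "h \<in> H" "h \<bullet> q = 0" and q: "q \<in> span (v ` T)"
    and I: "I \<in> hit_family v H {l\<in>T. h \<bullet> v l = 0} q"
  shows "q \<in> span (v ` {l\<in>T. h \<bullet> v l = 0})"
proof -
  let ?F = "{l\<in>T. h \<bullet> v l = 0}"
  define d where "d = (\<Sum>l\<in>?F. v l)"
  have nn: "0 \<le> g \<bullet> v l" if "g \<in> H" "l \<in> T" for g l
    using cp that unfolding cone_presentation_def by auto
  have fin: "finite T" "finite H" using cp unfolding cone_presentation_def by auto
  have "\<exists>C. \<forall>c\<ge>C. 0 \<le> g \<bullet> (q + c *\<^sub>R d)" if g: "g \<in> H" for g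
  proof (cases "\<exists>l\<in>?F. 0 < g \<bullet> v l")
    case True
    then obtain l where l: "l \<in> ?F" "0 < g \<bullet> v l" by auto
    have "0 < g \<bullet> d"
      unfolding d_def inner_sum_right by (rule sum_pos2 [where i = l]) (use l fin nn [OF g] in auto)
    then show ?thesis
      by (intro exI [of _ "- (g \<bullet> q) / (g \<bullet> d)"]) (auto simp: inner_simps field_simps)
  next
    case False
    then have "0 \<le> g \<bullet> q" using I g unfolding hit_family_def by fastforce
    moreover have "0 \<le> g \<bullet> d"
      unfolding d_def inner_sum_right using nn [OF g] by (intro sum_nonneg) auto
    ultimately show ?thesis by (intro exI [of _ 0]) (auto simp: inner_simps)
  qed
  then obtain C where C: "\<And>g c. g \<in> H \<Longrightarrow> C g \<le> c \<Longrightarrow> 0 \<le> g \<bullet> (q + c *\<^sub>R d)" by metis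
  define c where "c = Max (insert 0 (C ` H))"
  have "0 \<le> g \<bullet> (q + c *\<^sub>R d)" if "g \<in> H" for g
    by (rule C [OF that]) (use that fin in \<open>auto simp: c_def\<close>)
  moreover have dF: "d \<in> span (v ` ?F)" unfolding d_def by (rule span_sum, rule span_base) auto
  then have "d \<in> span (v ` T)" using span_mono [of "v ` ?F" "v ` T"] by auto
  then have "q + c *\<^sub>R d \<in> span (v ` T)" using q by (intro span_add span_scale)
  moreover have "h \<bullet> d = 0" by (rule span_orth [OF dF]) auto
  then have "h \<bullet> (q + c *\<^sub>R d) = 0" using h by (simp add: inner_simps)
  ultimately have "q + c *\<^sub>R d \<in> span (v ` ?F)" using cone_boundary_span [OF cp _ _ h(1)] by blast
  then have "(q + c *\<^sub>R d) - c *\<^sub>R d \<in> span (v ` ?F)" using dF by (intro span_diff span_scale)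
  then show ?thesis by simp
qed


text \<open>By induction on the number of generators. Move \<open>q\<close> along a line in the direction of an
  interior point \<open>d\<close>. Far out the family consists of all subsets and is acyclic. When the line
  crosses the hyperplane of \<open>h\<close> in a point \<open>Q t\<close> of the span of the face on which \<open>h\<close> vanishes, the family
  grows by the family of that face and the point \<open>Q t\<close>. This family is acyclic by induction unless \<open>Q t\<close>
  is in the relative interior of the negative of the face, which happens only when the line leaves
  the negative of the cone, hence at no more than one crossing. For a line in general position, distinct
  faces are not crossed at the same time.\<close>

theorem acyclic_on_hit_family:
  fixes v :: "nat \<Rightarrow> 'v::real_inner"
  assumes "cone_presentation v H T" "q \<in> span (v ` T)"
  shows "acyclic_on TYPE('k::comm_ring_1) (hit_family v H T q) \<longleftrightarrow>
    \<not> (\<forall>h\<in>H. (\<exists>l\<in>T. 0 < h \<bullet> v l) \<longrightarrow> h \<bullet> q < 0)"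
  using assms
proof (induction "card T" arbitrary: T q rule: less_induct)
  case less
  note cp = less.prems(1) and q = less.prems(2) and IH = less.hyps
  have fin: "finite T" "finite H" and nn: "\<And>h l. h \<in> H \<Longrightarrow> l \<in> T \<Longrightarrow> 0 \<le> h \<bullet> v l"
    and pos: "\<And>l. l \<in> T \<Longrightarrow> \<exists>h\<in>H. 0 < h \<bullet> v l"
    using cp unfolding cone_presentation_def by auto
  show ?case
  proof (cases "T = {}")
    case True
    then have "hit_family v H T q = {{}}" using q by (auto simp: hit_family_def)
    then show ?thesis using True not_acyc_singleton by simp
  next
    case ne: False
    define F where "F h = {l \<in> T. h \<bullet> v l = 0}" for h
    define S where "S h = span (v ` F h)" for h
    define nv where "nv h \<longleftrightarrow> (\<exists>l\<in>T. 0 < h \<bullet> v l)" for h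
    define d where "d = (\<Sum>l\<in>T. v l)"
    have dT: "d \<in> span (v ` T)" unfolding d_def by (rule span_sum, rule span_base) auto
    have d_pos: "0 < h \<bullet> d" if h: "h \<in> H" "nv h" for h
    proof -
      obtain l where l: "l \<in> T" "0 < h \<bullet> v l" using h(2) by (auto simp: nv_def)
      show ?thesis unfolding d_def inner_sum_right by (rule sum_pos2 [where i = l]) (use l fin nn that in auto)
    qed
    have not_nv: "h \<bullet> x = 0" if "h \<in> H" "\<not> nv h" "x \<in> span (v ` T)" for h x
      by (rule span_orth [OF that(3)]) (use that(1,2) nn in \<open>force simp: nv_def\<close>)
    have S_orth: "h \<bullet> x = 0" if "x \<in> S h" for h x
      using that unfolding S_def by (rule span_orth) (auto simp: F_def)

    \<comment> \<open>Move \<open>q\<close> into general position without changing the family.\<close>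
    define U where "U h g = {x + c *\<^sub>R d | x c. x \<in> S h \<inter> S g}" for h g
    define \<S> where "\<S> = (\<lambda>(h, g). U h g) ` {(h, g) \<in> H \<times> H. nv h \<and> \<not> F h \<subseteq> F g}"
    have "finite \<S>" unfolding \<S>_def
      by (intro finite_imageI finite_subset [of "{(h, g) \<in> H \<times> H. nv h \<and> \<not> F h \<subseteq> F g}" "H \<times> H"])
         (use fin in auto)
    moreover have "subspace V \<and> (\<exists>l\<in>T. v l \<notin> V)" if V: "V \<in> \<S>" for V
    proof -
      obtain h g where hg: "V = U h g" "h \<in> H" "g \<in> H" "nv h" "\<not> F h \<subseteq> F g"
        using V by (auto simp: \<S>_def)
      have "subspace (S h \<inter> S g)" unfolding S_def by (intro subspace_inter subspace_span)
      moreover have "U h g = {x + y | x y. x \<in> S h \<inter> S g \<and> y \<in> span {d}}"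
        by (auto simp: U_def span_singleton)
      ultimately have "subspace V"
        using subspace_sums [of "S h \<inter> S g" "span {d}"] hg(1) by simp
      moreover obtain l where l: "l \<in> F h" "l \<notin> F g" using hg(5) by auto
      have "v l \<notin> V"
      proof
        assume "v l \<in> V"
        then obtain x c where x: "v l = x + c *\<^sub>R d" "x \<in> S h" "x \<in> S g" using hg(1) by (auto simp: U_def)
        have "h \<bullet> v l = 0" using l(1) by (auto simp: F_def)
        then have "c = 0" using x(1) S_orth [OF x(2)] d_pos [OF hg(2,4)] by (simp add: inner_simps)
        then have "g \<bullet> v l = 0" using x S_orth by simp
        then show False using l by (auto simp: F_def)
      qed
      ultimately show ?thesis using l(1) by (auto simp: F_def)
    qed
    moreover obtain \<delta> where \<delta>: "0 < \<delta>" "\<And>h. h \<in> H \<Longrightarrow> h \<bullet> q < 0 \<Longrightarrow> \<delta> * (h \<bullet> d) < - (h \<bullet> q)"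
    proof -
      have "\<exists>\<delta>>0. \<delta> * (h \<bullet> d) < - (h \<bullet> q)" if "h \<in> H" "h \<bullet> q < 0" for h
      proof -
        have "0 < h \<bullet> d" using that q not_nv d_pos by fastforce
        then show ?thesis
          using that by (intro exI [of _ "- (h \<bullet> q) / (2 * (h \<bullet> d))"]) (auto simp: field_simps)
      qed
      then obtain f where f: "\<And>h. h \<in> H \<Longrightarrow> h \<bullet> q < 0 \<Longrightarrow> 0 < f h \<and> f h * (h \<bullet> d) < - (h \<bullet> q)" by metis
      define \<delta> where "\<delta> = Min (insert 1 (f ` {h \<in> H. h \<bullet> q < 0}))"
      have "0 < \<delta>" unfolding \<delta>_def using fin f by (subst Min_gr_iff) auto
      moreover have "\<delta> * (h \<bullet> d) < - (h \<bullet> q)" if "h \<in> H" "h \<bullet> q < 0" for h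
      proof -
        have "\<delta> \<le> f h" unfolding \<delta>_def using fin that by (intro Min_le) auto
        moreover have "0 \<le> h \<bullet> d" unfolding d_def inner_sum_right using nn that by (intro sum_nonneg) auto
        ultimately have "\<delta> * (h \<bullet> d) \<le> f h * (h \<bullet> d)" by (rule mult_right_mono)
        then show ?thesis using f [OF that] by linarith
      qed
      ultimately show ?thesis using that by blast
    qed
    ultimately obtain c where c: "\<And>l. l \<in> T \<Longrightarrow> 0 < c l \<and> c l < \<delta>"
      "\<And>V. V \<in> \<S> \<Longrightarrow> q + (\<Sum>l\<in>T. c l *\<^sub>R v l) \<notin> V"
      using avoid_subspaces [of \<S> T \<delta> v q] fin by blast
    define r where "r = q + (\<Sum>l\<in>T. c l *\<^sub>R v l)"
    have rT: "r \<in> span (v ` T)"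
      unfolding r_def by (rule span_add [OF q], rule span_sum, rule span_scale, rule span_base) auto
    have r_gt: "h \<bullet> q < h \<bullet> r" if h: "h \<in> H" "nv h" for h
    proof -
      obtain l where l: "l \<in> T" "0 < h \<bullet> v l" using h(2) by (auto simp: nv_def)
      have "0 < (\<Sum>l\<in>T. c l * (h \<bullet> v l))"
        by (rule sum_pos2 [where i = l]) (use l fin nn [OF h(1)] c(1) in \<open>auto intro!: mult_pos_pos simp: less_imp_le\<close>)
      then show ?thesis by (simp add: r_def inner_simps inner_sum_right)
    qed
    have r_neg: "h \<bullet> r < 0 \<longleftrightarrow> h \<bullet> q < 0" if h: "h \<in> H" for h
    proof (cases "nv h")
      case True
      show ?thesis
      proof
        assume *: "h \<bullet> q < 0"
        have "(\<Sum>l\<in>T. c l * (h \<bullet> v l)) \<le> (\<Sum>l\<in>T. \<delta> * (h \<bullet> v l))"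
          by (intro sum_mono mult_right_mono) (use c(1) nn h in \<open>auto simp: less_imp_le\<close>)
        also have "\<dots> = \<delta> * (h \<bullet> d)" by (simp add: d_def inner_sum_right sum_distrib_left)
        finally show "h \<bullet> r < 0" using \<delta>(2) [OF h *] by (simp add: r_def inner_simps inner_sum_right)
      qed (use r_gt [OF h True] in auto)
    qed (use not_nv h q rT in auto)
    have fam_r: "hit_family v H T q = hit_family v H T r" using r_neg by (auto simp: hit_family_def)
    have generic: "F h \<subseteq> F g"
      if "h \<in> H" "g \<in> H" "nv h" "r + s *\<^sub>R d \<in> S h" "r + s *\<^sub>R d \<in> S g" for h g s
    proof (rule ccontr)
      assume "\<not> F h \<subseteq> F g"
      then have "U h g \<in> \<S>" using that by (auto simp: \<S>_def)
      moreover have "r = (r + s *\<^sub>R d) + (- s) *\<^sub>R d" by simp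
      then have "r \<in> U h g" using that unfolding U_def by blast
      ultimately show False using c(2) by (simp add: r_def)
    qed

    \<comment> \<open>Sweep along the line \<open>Q\<close> from \<open>r\<close> in the direction \<open>d\<close> of the relative interior.\<close>
    define Q where "Q s = r + s *\<^sub>R d" for s
    define \<F> where "\<F> s = hit_family v H T (Q s)" for s
    have QT: "Q s \<in> span (v ` T)" for s unfolding Q_def using rT dT by (intro span_add span_scale)
    have hQ: "h \<bullet> Q s = h \<bullet> r + s * (h \<bullet> d)" for h s by (simp add: Q_def inner_simps)
    have Q_nv: "nv h" if "h \<in> H" "h \<bullet> Q s < 0" for h s using not_nv [OF that(1) _ QT] that(2) by force
    have Q_mono: "h \<bullet> Q s < h \<bullet> Q t" if "h \<in> H" "nv h" "s < t" for h s t
      using d_pos [OF that(1,2)] that(3) by (simp add: hQ)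
    define neg where "neg s = {h \<in> H. h \<bullet> Q s < 0}" for s
    define tied where "tied s t = {h \<in> neg s. h \<bullet> Q t = 0}" for s t
    have crossing: "\<exists>t>s. tied s t \<noteq> {} \<and> (\<forall>h\<in>neg s. h \<bullet> Q t \<le> 0)" if "neg s \<noteq> {}" for s
    proof -
      define \<tau> where "\<tau> h = - (h \<bullet> r) / (h \<bullet> d)" for h
      have \<tau>: "h \<bullet> Q t = (t - \<tau> h) * (h \<bullet> d)" if "h \<in> neg s" for h t
        using d_pos [of h] Q_nv [of h s] that by (auto simp: \<tau>_def hQ neg_def field_simps)
      have fneg: "finite (neg s)" using fin by (simp add: neg_def)
      define t where "t = Min (\<tau> ` neg s)"
      have "t \<in> \<tau> ` neg s" unfolding t_def using that fneg by (intro Min_in) auto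
      then obtain h where h: "h \<in> neg s" "t = \<tau> h" by auto
      have le: "t \<le> \<tau> g" if "g \<in> neg s" for g unfolding t_def using that fneg by (intro Min_le) auto
      have dp: "0 < g \<bullet> d" if "g \<in> neg s" for g using that Q_nv d_pos by (auto simp: neg_def)
      have "s < t" using h \<tau> [OF h(1), of s] dp [OF h(1)] by (auto simp: neg_def mult_less_0_iff)
      moreover have "h \<in> tied s t" using h \<tau> [OF h(1), of t] by (auto simp: tied_def)
      moreover have "g \<bullet> Q t \<le> 0" if "g \<in> neg s" for g
        using \<tau> [OF that, of t] le [OF that] dp [OF that] by (simp add: mult_nonpos_nonneg)
      ultimately show ?thesis by blast
    qed
    have jump: "\<F> t - \<F> s = (\<Union>h\<in>tied s t. hit_family v H (F h) (Q t))" and jump_mono: "\<F> s \<subseteq> \<F> t"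
      if "s < t" "\<forall>h\<in>neg s. h \<bullet> Q t \<le> 0" for s t
    proof -
      have mono: "h \<in> neg s" if "h \<in> H" "h \<bullet> Q t < 0" for h
        using Q_mono [OF that(1) Q_nv [OF that] \<open>s < t\<close>] that by (auto simp: neg_def)
      then show "\<F> s \<subseteq> \<F> t" by (auto simp: \<F>_def hit_family_def neg_def)
      show "\<F> t - \<F> s = (\<Union>h\<in>tied s t. hit_family v H (F h) (Q t))"
      proof (intro equalityI subsetI)
        fix I assume I: "I \<in> \<F> t - \<F> s"
        then obtain h where h: "h \<in> H" "h \<bullet> Q s < 0" "\<not> (\<exists>l\<in>I. 0 < h \<bullet> v l)"
          by (auto simp: \<F>_def hit_family_def)
        have IT: "I \<subseteq> T" using I by (auto simp: \<F>_def hit_family_def)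
        have "\<not> h \<bullet> Q t < 0" using I h by (auto simp: \<F>_def hit_family_def)
        then have "h \<in> tied s t" using h that(2) by (force simp: tied_def neg_def)
        moreover have "I \<subseteq> F h" using h nn IT by (force simp: F_def)
        then have "I \<in> hit_family v H (F h) (Q t)" using I by (auto simp: \<F>_def hit_family_def)
        ultimately show "I \<in> (\<Union>h\<in>tied s t. hit_family v H (F h) (Q t))" by blast
      next
        fix I assume "I \<in> (\<Union>h\<in>tied s t. hit_family v H (F h) (Q t))"
        then obtain h where h: "h \<in> H" "h \<bullet> Q s < 0" "I \<in> hit_family v H (F h) (Q t)"
          by (auto simp: tied_def neg_def)
        then have "\<not> (\<exists>l\<in>I. 0 < h \<bullet> v l)" by (force simp: hit_family_def F_def)
        then show "I \<in> \<F> t - \<F> s" using h by (force simp: \<F>_def hit_family_def F_def)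
      qed
    qed
    have jump_eq: "\<F> t - \<F> s = hit_family v H (F h) (Q t)"
      if st: "s < t" "\<forall>h\<in>neg s. h \<bullet> Q t \<le> 0" and h: "h \<in> tied s t" "Q t \<in> S h" for s t h
    proof -
      have eq: "hit_family v H (F g) (Q t) = {} \<or> F g = F h" if g: "g \<in> tied s t" for g
      proof (cases "Q t \<in> S g")
        case True
        have *: "h \<in> H" "g \<in> H" "nv h" "nv g" using h(1) g Q_nv by (auto simp: tied_def neg_def)
        have "F h \<subseteq> F g" "F g \<subseteq> F h"
          using generic [of h g t] generic [of g h t] * True h(2) by (auto simp: Q_def)
        then show ?thesis by auto
      next
        case False
        then show ?thesis
          using face_hit_family_nonempty [OF cp _ _ QT, of g t] g
          by (auto simp: tied_def neg_def S_def F_def)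
      qed
      show ?thesis unfolding jump [OF st]
      proof (intro equalityI subsetI)
        fix I assume "I \<in> (\<Union>g\<in>tied s t. hit_family v H (F g) (Q t))"
        then obtain g where g: "g \<in> tied s t" "I \<in> hit_family v H (F g) (Q t)" by (rule UN_E)
        then have "F g = F h" using eq [OF g(1)] by auto
        then show "I \<in> hit_family v H (F h) (Q t)" using g(2) by simp
      qed (rule UN_I [OF h(1)])
    qed
    have face: "cone_presentation v H (F h)" "card (F h) < card T" if "h \<in> tied s t" for h s t
    proof -
      have h: "h \<in> H" "nv h" using that Q_nv by (auto simp: tied_def neg_def)
      then show "cone_presentation v H (F h)" unfolding F_def using cone_presentation_face [OF cp] by auto
      obtain l where "l \<in> T" "0 < h \<bullet> v l" using h(2) by (auto simp: nv_def)
      then have "l \<in> T - F h" by (auto simp: F_def)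
      moreover have "F h \<subseteq> T" by (auto simp: F_def)
      ultimately have "F h \<subset> T" by blast
      then show "card (F h) < card T" using fin by (intro psubset_card_mono)
    qed
    have up: "J \<in> \<F> s" if "I \<in> \<F> s" "I \<subseteq> J" "J \<subseteq> T" for I J s
      using that hit_family_up unfolding \<F>_def by blast
    have FPow: "\<F> s \<subseteq> Pow T" for s by (auto simp: \<F>_def hit_family_def)
    have outside: "acyclic_on TYPE('k) (\<F> s)" if "h0 \<in> H" "nv h0" "0 \<le> h0 \<bullet> Q s" for s h0
      using that(3)
    proof (induction "card (neg s)" arbitrary: s rule: less_induct)
      case (less s)
      show ?case
      proof (cases "neg s = {}")
        case True
        then have "\<F> s = Pow T" by (auto simp: \<F>_def hit_family_def neg_def)
        then show ?thesis using acyclic_on_Pow fin ne by auto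
      next
        case False
        then obtain t where t: "s < t" "tied s t \<noteq> {}" "\<forall>h\<in>neg s. h \<bullet> Q t \<le> 0" using crossing by blast
        have h0: "0 < h0 \<bullet> Q t" using Q_mono [OF that(1,2) t(1)] less.prems by linarith
        have "neg t \<subseteq> neg s" using Q_mono [OF _ _ t(1)] Q_nv by (fastforce simp: neg_def)
        moreover obtain h where "h \<in> tied s t" using t(2) by auto
        then have "h \<in> neg s" "h \<notin> neg t" by (auto simp: tied_def neg_def)
        ultimately have "neg t \<subset> neg s" by blast
        then have "card (neg t) < card (neg s)" using fin by (intro psubset_card_mono) (auto simp: neg_def)
        then have ac: "acyclic_on TYPE('k) (\<F> t)" using less.hyps h0 by auto
        have "acyclic_on TYPE('k) (\<F> t - \<F> s)"
        proof (cases "\<exists>h\<in>tied s t. Q t \<in> S h")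
          case True
          then obtain h where h: "h \<in> tied s t" "Q t \<in> S h" by auto
          have "\<exists>l\<in>F h. 0 < h0 \<bullet> v l"
          proof (rule ccontr)
            assume "\<not> (\<exists>l\<in>F h. 0 < h0 \<bullet> v l)"
            then have no: "\<not> 0 < h0 \<bullet> v l" if "l \<in> F h" for l using that by blast
            have "h0 \<bullet> y = 0" if y: "y \<in> v ` F h" for y
            proof -
              obtain l where l: "l \<in> F h" "y = v l" using y by blast
              then show ?thesis using no [OF l(1)] nn [OF \<open>h0 \<in> H\<close>, of l] by (auto simp: F_def)
            qed
            then have "h0 \<bullet> Q t = 0" by (rule span_orth [OF h(2) [unfolded S_def]])
            then show False using h0 by simp
          qed
          then have "acyclic_on TYPE('k) (hit_family v H (F h) (Q t))"
            using IH [OF face(2) [OF h(1)] face(1) [OF h(1)]] h(2) that(1) h0 by (auto simp: S_def)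
          then show ?thesis using jump_eq [OF t(1,3) h] by simp
        next
          case False
          then have "hit_family v H (F h) (Q t) = {}" if "h \<in> tied s t" for h
            using face_hit_family_nonempty [OF cp _ _ QT, of h t] that
            by (auto simp: tied_def neg_def S_def F_def)
          then have "\<F> t - \<F> s = {}" unfolding jump [OF t(1,3)] by auto
          then show ?thesis by (simp only: acyclic_on_empty)
        qed
        then show ?thesis
          by (intro acyclic_on_sub [OF fin(1) jump_mono [OF t(1,3)] FPow _ _ ac]) (erule up; assumption)+
      qed
    qed
    have Q0: "Q 0 = r" by (simp add: Q_def)
    show ?thesis
    proof (cases "\<forall>h\<in>H. nv h \<longrightarrow> h \<bullet> q < 0")
      case False
      then obtain h0 where h0: "h0 \<in> H" "nv h0" "0 \<le> h0 \<bullet> q" by force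
      then have "0 \<le> h0 \<bullet> Q 0" using r_gt Q0 by force
      then have "acyclic_on TYPE('k) (hit_family v H T q)" using outside [OF h0(1,2)] fam_r Q0 by (auto simp: \<F>_def)
      then show ?thesis using False by (auto simp: nv_def)
    next
      case True
      then have all_neg: "h \<in> neg 0" if "h \<in> H" "nv h" for h using that r_neg Q0 by (auto simp: neg_def)
      obtain l g where "l \<in> T" "g \<in> H" "0 < g \<bullet> v l" using ne pos by blast
      then have "neg 0 \<noteq> {}" using all_neg by (auto simp: nv_def)
      then obtain t where t: "0 < t" "tied 0 t \<noteq> {}" "\<forall>h\<in>neg 0. h \<bullet> Q t \<le> 0" using crossing by blast
      then obtain h where h: "h \<in> tied 0 t" by auto
      then have hH: "h \<in> H" "nv h" "h \<bullet> Q t = 0" using Q_nv by (auto simp: tied_def neg_def)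
      have le0: "g \<bullet> Q t \<le> 0" if "g \<in> H" for g
        using t(3) all_neg not_nv [OF that _ QT] that by force
      have bd: "Q t \<in> S g" if "g \<in> H" "g \<bullet> Q t = 0" for g
      proof -
        have "- Q t \<in> S g" unfolding S_def F_def
          by (rule cone_boundary_span [OF cp _ _ that(1)]) (use QT le0 that in \<open>auto intro: span_neg\<close>)
        then show ?thesis unfolding S_def using span_neg [of "- Q t"] by simp
      qed
      have "acyclic_on TYPE('k) (\<F> t)" using outside [OF hH(1,2)] hH(3) by auto
      moreover have "\<not> acyclic_on TYPE('k) (\<F> t - \<F> 0)"
      proof -
        have "g \<bullet> Q t < 0" if g: "g \<in> H" "\<exists>l\<in>F h. 0 < g \<bullet> v l" for g
        proof (rule ccontr)
          assume "\<not> g \<bullet> Q t < 0"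
          then have g0: "g \<bullet> Q t = 0" using le0 g by force
          have "F h \<subseteq> F g" using generic [of h g t] hH g bd g0 by (auto simp: Q_def)
          then show False using g(2) by (auto simp: F_def)
        qed
        then have "\<not> acyclic_on TYPE('k) (hit_family v H (F h) (Q t))"
          using IH [OF face(2) [OF h] face(1) [OF h]] bd [OF hH(1,3)] by (auto simp: S_def)
        then show ?thesis using jump_eq [OF t(1,3) h bd [OF hH(1,3)]] by simp
      qed
      moreover have "acyclic_on TYPE('k) (\<F> t - \<F> 0)" if "acyclic_on TYPE('k) (\<F> t)" "acyclic_on TYPE('k) (\<F> 0)"
        by (rule acyclic_on_quotient [OF fin(1) jump_mono [OF t(1,3)] FPow _ _ that]) (erule up; assumption)+
      ultimately have "\<not> acyclic_on TYPE('k) (\<F> 0)" by blast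
      then show ?thesis using True fam_r Q0 by (auto simp: \<F>_def nv_def)
    qed
  qed
qed


section \<open>Cech cohomology with common denominators\<close>

text \<open>Identities of \<open>R\<close> are verified in a commutative ring given by a type class, to which \<open>\<theta>\<close>
  transports them.\<close>

locale embedded_ring = cring R for R (structure) +
  fixes \<theta> :: "'a \<Rightarrow> 'w::comm_ring_1"
  assumes inj: "inj_on \<theta> (carrier R)"
    and theta_add: "a \<in> carrier R \<Longrightarrow> b \<in> carrier R \<Longrightarrow> \<theta> (a \<oplus> b) = \<theta> a + \<theta> b"
    and theta_mult: "a \<in> carrier R \<Longrightarrow> b \<in> carrier R \<Longrightarrow> \<theta> (a \<otimes> b) = \<theta> a * \<theta> b"
    and theta_one: "\<theta> \<one> = 1"
begin

lemma theta_eqI: "a \<in> carrier R \<Longrightarrow> b \<in> carrier R \<Longrightarrow> \<theta> a = \<theta> b \<Longrightarrow> a = b"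
  using inj by (auto dest: inj_onD)

lemma theta_zero: "\<theta> \<zero> = 0"
  using theta_add [of \<zero> \<zero>] by simp

lemma theta_minus: "a \<in> carrier R \<Longrightarrow> \<theta> (\<ominus> a) = - \<theta> a"
  using theta_add [of "\<ominus> a" a] by (simp add: theta_zero l_neg eq_neg_iff_add_eq_0)

lemma theta_pow: "a \<in> carrier R \<Longrightarrow> \<theta> (a [^] (n::nat)) = \<theta> a ^ n"
  by (induction n) (auto simp: theta_one theta_mult)

lemma theta_finsum: "finite J \<Longrightarrow> f \<in> J \<rightarrow> carrier R \<Longrightarrow> \<theta> (finsum R f J) = (\<Sum>j\<in>J. \<theta> (f j))"
  by (induction J rule: finite_induct) (auto simp: theta_zero theta_add Pi_def)

lemma theta_finprod: "finite J \<Longrightarrow> f \<in> J \<rightarrow> carrier R \<Longrightarrow> \<theta> (finprod R f J) = (\<Prod>j\<in>J. \<theta> (f j))"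
  by (induction J rule: finite_induct) (auto simp: theta_one theta_mult Pi_def)

lemmas theta = theta_add theta_mult theta_one theta_zero theta_minus theta_pow

end

locale denominators = embedded_ring R \<theta> for R (structure) and \<theta> :: "'a \<Rightarrow> 'w::comm_ring_1" +
  fixes S :: "'a set"
  assumes S_sub: "S \<subseteq> carrier R" and S_one: "\<one> \<in> S"
    and S_mult: "s \<in> S \<Longrightarrow> t \<in> S \<Longrightarrow> s \<otimes> t \<in> S"
begin

lemma S_carr [simp]: "s \<in> S \<Longrightarrow> s \<in> carrier R"
  using S_sub by auto

lemma mem_fraction:
  assumes "r \<in> carrier R" "s \<in> S"
  shows "(r', s') \<in> fraction R S r s \<longleftrightarrow>
    r' \<in> carrier R \<and> s' \<in> S \<and> (\<exists>t\<in>S. \<theta> t * (\<theta> s' * \<theta> r) = \<theta> t * (\<theta> s * \<theta> r'))"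
proof -
  have "t \<otimes> (s' \<otimes> r) = t \<otimes> (s \<otimes> r') \<longleftrightarrow> \<theta> t * (\<theta> s' * \<theta> r) = \<theta> t * (\<theta> s * \<theta> r')"
    if "r' \<in> carrier R" "s' \<in> S" "t \<in> S" for t
    using theta_eqI [of "t \<otimes> (s' \<otimes> r)" "t \<otimes> (s \<otimes> r')"] that assms
    by (auto simp: theta_mult) (metis theta_mult S_carr m_closed)+
  then show ?thesis by (auto simp: fraction_def)
qed

lemma fraction_self: "r \<in> carrier R \<Longrightarrow> s \<in> S \<Longrightarrow> (r, s) \<in> fraction R S r s"
  using S_one by (auto simp: mem_fraction)

lemma fraction_trans:
  assumes "r \<in> carrier R" "s \<in> S" "(r', s') \<in> fraction R S r s" "(r'', s'') \<in> fraction R S r' s'"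
  shows "(r'', s'') \<in> fraction R S r s"
proof -
  obtain t where t: "r' \<in> carrier R" "s' \<in> S" "t \<in> S" "\<theta> t * (\<theta> s' * \<theta> r) = \<theta> t * (\<theta> s * \<theta> r')"
    using assms by (auto simp: mem_fraction)
  obtain u where u: "r'' \<in> carrier R" "s'' \<in> S" "u \<in> S" "\<theta> u * (\<theta> s'' * \<theta> r') = \<theta> u * (\<theta> s' * \<theta> r'')"
    using assms t by (auto simp: mem_fraction)
  have "\<theta> (t \<otimes> u \<otimes> s') * (\<theta> s'' * \<theta> r) = \<theta> u * \<theta> s'' * (\<theta> t * (\<theta> s' * \<theta> r))"
    using t(1-3) u(1-3) S_mult by (simp add: theta_mult algebra_simps)
  also have "\<dots> = \<theta> t * \<theta> s * (\<theta> u * (\<theta> s'' * \<theta> r'))" unfolding t(4) by (simp add: algebra_simps)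
  also have "\<dots> = \<theta> (t \<otimes> u \<otimes> s') * (\<theta> s * \<theta> r'')"
    unfolding u(4) using t(1-3) u(1-3) S_mult by (simp add: theta_mult algebra_simps)
  finally show ?thesis
    using t u assms S_mult by (auto simp: mem_fraction intro!: bexI [of _ "t \<otimes> u \<otimes> s'"])
qed

lemma fraction_sym:
  assumes "r \<in> carrier R" "s \<in> S" "(r', s') \<in> fraction R S r s"
  shows "(r, s) \<in> fraction R S r' s'"
  using assms by (auto simp: mem_fraction) metis

lemma fraction_cong:
  assumes "r \<in> carrier R" "s \<in> S" "(r', s') \<in> fraction R S r s"
  shows "fraction R S r' s' = fraction R S r s"
proof -
  have "r' \<in> carrier R" "s' \<in> S" using assms by (auto simp: mem_fraction)
  then show ?thesis
    using fraction_trans [OF assms] fraction_trans [OF _ _ fraction_sym [OF assms]] by auto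
qed

lemma fraction_eq_iff:
  assumes "r \<in> carrier R" "s \<in> S" "r' \<in> carrier R" "s' \<in> S"
  shows "fraction R S r s = fraction R S r' s' \<longleftrightarrow>
    (\<exists>t\<in>S. \<theta> t * (\<theta> s' * \<theta> r) = \<theta> t * (\<theta> s * \<theta> r'))"
  using fraction_cong [OF assms(1,2), of r' s'] fraction_self [OF assms(3,4)] assms
    mem_fraction [OF assms(1,2), of r' s'] by auto

lemma fraction_eqI:
  assumes "r \<in> carrier R" "s \<in> S" "r' \<in> carrier R" "s' \<in> S" "\<theta> s' * \<theta> r = \<theta> s * \<theta> r'"
  shows "fraction R S r s = fraction R S r' s'"
  unfolding fraction_eq_iff [OF assms(1-4)] using S_one assms(5) by auto

lemma UN_fraction:
  assumes "r \<in> carrier R" "s \<in> S"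
    and "\<And>a b. (a, b) \<in> fraction R S r s \<Longrightarrow> f a b = Z"
  shows "(\<Union>(a, b)\<in>fraction R S r s. f a b) = Z"
  using fraction_self [OF assms(1,2)] assms(3) by fastforce

lemma localization_mult:
  assumes "r \<in> carrier R" "s \<in> S" "r' \<in> carrier R" "s' \<in> S"
  shows "fraction R S r s \<otimes>\<^bsub>localization R S\<^esub> fraction R S r' s' = fraction R S (r \<otimes> r') (s \<otimes> s')"
  unfolding localization_def monoid.simps
proof (intro UN_fraction assms)
  fix a b a' b' assume "(a, b) \<in> fraction R S r s" "(a', b') \<in> fraction R S r' s'"
  then obtain t t' where t: "a \<in> carrier R" "b \<in> S" "t \<in> S" "\<theta> t * (\<theta> b * \<theta> r) = \<theta> t * (\<theta> s * \<theta> a)"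
    "a' \<in> carrier R" "b' \<in> S" "t' \<in> S" "\<theta> t' * (\<theta> b' * \<theta> r') = \<theta> t' * (\<theta> s' * \<theta> a')"
    using assms by (auto simp: mem_fraction)
  have "\<theta> (t \<otimes> t') * (\<theta> (b \<otimes> b') * \<theta> (r \<otimes> r')) = (\<theta> t * (\<theta> b * \<theta> r)) * (\<theta> t' * (\<theta> b' * \<theta> r'))"
    using t(1-3,5-7) assms S_mult by (simp add: theta_mult algebra_simps)
  also have "\<dots> = \<theta> (t \<otimes> t') * (\<theta> (s \<otimes> s') * \<theta> (a \<otimes> a'))"
    unfolding t(4,8) using t(1-3,5-7) assms S_mult by (simp add: theta_mult algebra_simps)
  finally have *: "\<exists>u\<in>S. \<theta> u * (\<theta> (s \<otimes> s') * \<theta> (a \<otimes> a')) = \<theta> u * (\<theta> (b \<otimes> b') * \<theta> (r \<otimes> r'))"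
    using S_mult t by metis
  show "fraction R S (a \<otimes> a') (b \<otimes> b') = fraction R S (r \<otimes> r') (s \<otimes> s')"
    by (subst fraction_eq_iff) (use t assms S_mult * in auto)
qed

lemma localization_add:
  assumes "r \<in> carrier R" "s \<in> S" "r' \<in> carrier R" "s' \<in> S"
  shows "fraction R S r s \<oplus>\<^bsub>localization R S\<^esub> fraction R S r' s'
    = fraction R S ((s' \<otimes> r) \<oplus> (s \<otimes> r')) (s \<otimes> s')"
  unfolding localization_def ring.simps
proof (intro UN_fraction assms)
  fix a b a' b' assume "(a, b) \<in> fraction R S r s" "(a', b') \<in> fraction R S r' s'"
  then obtain t t' where t: "a \<in> carrier R" "b \<in> S" "t \<in> S" "\<theta> t * (\<theta> b * \<theta> r) = \<theta> t * (\<theta> s * \<theta> a)"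
    "a' \<in> carrier R" "b' \<in> S" "t' \<in> S" "\<theta> t' * (\<theta> b' * \<theta> r') = \<theta> t' * (\<theta> s' * \<theta> a')"
    using assms by (auto simp: mem_fraction)
  have "\<theta> (t \<otimes> t') * (\<theta> (b \<otimes> b') * \<theta> ((s' \<otimes> r) \<oplus> (s \<otimes> r')))
      = \<theta> t' * \<theta> b' * \<theta> s' * (\<theta> t * (\<theta> b * \<theta> r)) + \<theta> t * \<theta> b * \<theta> s * (\<theta> t' * (\<theta> b' * \<theta> r'))"
    using t(1-3,5-7) assms S_mult by (simp add: theta algebra_simps)
  also have "\<dots> = \<theta> (t \<otimes> t') * (\<theta> (s \<otimes> s') * \<theta> ((b' \<otimes> a) \<oplus> (b \<otimes> a')))"
    unfolding t(4,8) using t(1-3,5-7) assms S_mult by (simp add: theta algebra_simps)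
  finally have *: "\<exists>u\<in>S. \<theta> u * (\<theta> (s \<otimes> s') * \<theta> ((b' \<otimes> a) \<oplus> (b \<otimes> a')))
      = \<theta> u * (\<theta> (b \<otimes> b') * \<theta> ((s' \<otimes> r) \<oplus> (s \<otimes> r')))"
    using S_mult t by metis
  show "fraction R S ((b' \<otimes> a) \<oplus> (b \<otimes> a')) (b \<otimes> b') = fraction R S ((s' \<otimes> r) \<oplus> (s \<otimes> r')) (s \<otimes> s')"
    by (subst fraction_eq_iff) (use t assms S_mult * in auto)
qed

lemma localization_add_same:
  assumes "r \<in> carrier R" "s \<in> S" "r' \<in> carrier R"
  shows "fraction R S r s \<oplus>\<^bsub>localization R S\<^esub> fraction R S r' s = fraction R S (r \<oplus> r') s"
  unfolding localization_add [OF assms assms(2)]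
  by (rule fraction_eqI) (use assms S_mult in \<open>auto simp: theta algebra_simps\<close>)

lemma localization_carrierE:
  assumes "c \<in> carrier (localization R S)"
  obtains r s where "r \<in> carrier R" "s \<in> S" "c = fraction R S r s"
  using assms by (auto simp: localization_def)

lemma localization_carrierI: "r \<in> carrier R \<Longrightarrow> s \<in> S \<Longrightarrow> fraction R S r s \<in> carrier (localization R S)"
  by (auto simp: localization_def)

lemma localization_zero: "s \<in> S \<Longrightarrow> \<zero>\<^bsub>localization R S\<^esub> = fraction R S \<zero> s"
  unfolding localization_def ring.simps
  by (rule fraction_eqI) (auto simp: S_one theta)

lemma localization_abelian_group: "abelian_group (localization R S)"
proof (rule abelian_groupI)
  let ?L = "localization R S"
  show "\<zero>\<^bsub>?L\<^esub> \<in> carrier ?L" using localization_carrierI [of \<zero> \<one>] S_one by (simp add: localization_zero)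
  fix a assume "a \<in> carrier ?L"
  then obtain r s where a: "r \<in> carrier R" "s \<in> S" "a = fraction R S r s" by (rule localization_carrierE)
  show "\<zero>\<^bsub>?L\<^esub> \<oplus>\<^bsub>?L\<^esub> a = a"
    unfolding localization_zero [OF a(2)] a(3) by (subst localization_add_same) (use a in auto)
  have "fraction R S (\<ominus> r) s \<oplus>\<^bsub>?L\<^esub> a = \<zero>\<^bsub>?L\<^esub>"
    unfolding localization_zero [OF a(2)] a(3)
    by (subst localization_add_same) (use a in \<open>auto simp: l_neg\<close>)
  then show "\<exists>b\<in>carrier ?L. b \<oplus>\<^bsub>?L\<^esub> a = \<zero>\<^bsub>?L\<^esub>"
    using a by (intro bexI [of _ "fraction R S (\<ominus> r) s"] localization_carrierI) auto
  fix b assume "b \<in> carrier ?L"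
  then obtain r' s' where b: "r' \<in> carrier R" "s' \<in> S" "b = fraction R S r' s'" by (rule localization_carrierE)
  show "a \<oplus>\<^bsub>?L\<^esub> b \<in> carrier ?L"
    using a b S_mult by (auto simp: localization_add intro!: localization_carrierI)
  show "a \<oplus>\<^bsub>?L\<^esub> b = b \<oplus>\<^bsub>?L\<^esub> a"
    unfolding a(3) b(3) localization_add [OF a(1,2) b(1,2)] localization_add [OF b(1,2) a(1,2)]
    by (rule fraction_eqI) (use a b S_mult in \<open>auto simp: theta algebra_simps\<close>)
  fix c assume "c \<in> carrier ?L"
  then obtain r'' s'' where c: "r'' \<in> carrier R" "s'' \<in> S" "c = fraction R S r'' s''" by (rule localization_carrierE)
  show "a \<oplus>\<^bsub>?L\<^esub> b \<oplus>\<^bsub>?L\<^esub> c = a \<oplus>\<^bsub>?L\<^esub> (b \<oplus>\<^bsub>?L\<^esub> c)"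
  proof -
    have ab: "(s' \<otimes> r) \<oplus> (s \<otimes> r') \<in> carrier R" "s \<otimes> s' \<in> S"
      and bc: "(s'' \<otimes> r') \<oplus> (s' \<otimes> r'') \<in> carrier R" "s' \<otimes> s'' \<in> S"
      using a b c S_mult by auto
    show ?thesis
      unfolding a(3) b(3) c(3) localization_add [OF a(1,2) b(1,2)] localization_add [OF b(1,2) c(1,2)]
        localization_add [OF ab c(1,2)] localization_add [OF a(1,2) bc]
      by (rule fraction_eqI) (use a b c S_mult in \<open>auto simp: theta algebra_simps\<close>)
  qed
qed

lemma localization_minus:
  assumes "r \<in> carrier R" "s \<in> S"
  shows "\<ominus>\<^bsub>localization R S\<^esub> fraction R S r s = fraction R S (\<ominus> r) s"
proof -
  interpret L: abelian_group "localization R S" by (rule localization_abelian_group)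
  show ?thesis
    by (rule L.minus_equality)
       (use assms in \<open>auto simp: localization_add_same localization_zero [OF assms(2)] l_neg
          intro!: localization_carrierI\<close>)
qed

lemma localization_finsum:
  assumes "finite J" "f \<in> J \<rightarrow> carrier R" "s \<in> S"
  shows "finsum (localization R S) (\<lambda>j. fraction R S (f j) s) J = fraction R S (finsum R f J) s"
  using assms
proof (induction J rule: finite_induct)
  interpret L: abelian_group "localization R S" by (rule localization_abelian_group)
  {
    case empty
    then show ?case by (simp add: localization_zero)
  next
    case (insert j J)
    then show ?case
      by (subst L.finsum_insert) (auto intro!: localization_carrierI simp: localization_add_same Pi_def)
  }
qed

lemma localization_pow:
  assumes "r \<in> carrier R" "s \<in> S"
  shows "fraction R S r s [^]\<^bsub>localization R S\<^esub> (n::nat) = fraction R S (r [^] n) (s [^] n) \<and> s [^] n \<in> S"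
proof (induction n)
  case 0
  then show ?case by (simp add: nat_pow_def S_one) (simp add: localization_def)
next
  case (Suc n)
  have "fraction R S r s [^]\<^bsub>localization R S\<^esub> Suc n
      = fraction R S r s [^]\<^bsub>localization R S\<^esub> n \<otimes>\<^bsub>localization R S\<^esub> fraction R S r s"
    by (simp add: nat_pow_def)
  then show ?case using Suc assms S_mult by (auto simp: localization_mult)
qed

lemma localization_map_fraction:
  assumes "denominators R \<theta> S'" "S \<subseteq> S'" "r \<in> carrier R" "s \<in> S"
  shows "localization_map R S' (fraction R S r s) = fraction R S' r s"
  unfolding localization_map_def
proof (rule UN_fraction [OF assms(3,4)])
  interpret D: denominators R \<theta> S' by (fact assms)
  fix a b assume "(a, b) \<in> fraction R S r s"
  moreover have "s \<in> S'" using assms by auto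
  ultimately show "fraction R S' a b = fraction R S' r s"
    using assms by (intro D.fraction_cong) (auto simp: mem_fraction D.mem_fraction)
qed

end


locale cech = embedded_ring R \<theta> for R (structure) and \<theta> :: "'a \<Rightarrow> 'w::comm_ring_1" +
  fixes xs :: "'a list"
  assumes xs: "set xs \<subseteq> carrier R"
begin

definition x :: "nat \<Rightarrow> 'w" where
  "x j = \<theta> (xs ! j)"

definition denoms :: "nat set \<Rightarrow> 'a set" where
  "denoms I = {finprod R (\<lambda>j. (xs ! j) [^] e j) I | e :: nat \<Rightarrow> nat. True}"

definition den :: "nat \<Rightarrow> nat set \<Rightarrow> 'a" where
  "den N I = finprod R (\<lambda>j. (xs ! j) [^] N) I"

definition over_den :: "nat set \<Rightarrow> nat \<Rightarrow> 'a \<Rightarrow> ('a \<times> 'a) set" where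
  "over_den I N r = fraction R (denoms I) r (den N I)"

lemma cech_ring_eq: "cech_ring R xs I = localization R (denoms I)"
  by (simp add: cech_ring_def denoms_def)

lemma cech_map_eq: "cech_map R xs J = localization_map R (denoms J)"
  by (simp add: cech_map_def denoms_def fun_eq_iff)

lemma xs_carr: "j < length xs \<Longrightarrow> xs ! j \<in> carrier R"
  using xs by auto

lemma fin_ix: "I \<subseteq> {..<length xs} \<Longrightarrow> finite I"
  using finite_subset by auto

lemma prod_carr: "I \<subseteq> {..<length xs} \<Longrightarrow> finprod R (\<lambda>j. (xs ! j) [^] (e j :: nat)) I \<in> carrier R"
  using xs_carr by (intro finprod_closed) auto

lemma theta_prod:
  "I \<subseteq> {..<length xs} \<Longrightarrow> \<theta> (finprod R (\<lambda>j. (xs ! j) [^] (e j :: nat)) I) = (\<Prod>j\<in>I. x j ^ e j)"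
  using xs_carr by (subst theta_finprod) (auto simp: fin_ix x_def theta_pow Pi_def subset_iff intro!: prod.cong)

lemma den_carr: "I \<subseteq> {..<length xs} \<Longrightarrow> den N I \<in> carrier R"
  unfolding den_def by (rule prod_carr)

lemma theta_den: "I \<subseteq> {..<length xs} \<Longrightarrow> \<theta> (den N I) = (\<Prod>j\<in>I. x j ^ N)"
  unfolding den_def by (rule theta_prod)

lemma den_in: "den N I \<in> denoms I"
  unfolding den_def denoms_def by (auto intro: exI [of _ "\<lambda>_. N"])

lemma den_mult: "I \<subseteq> {..<length xs} \<Longrightarrow> den M I \<otimes> den N I = den (M + N) I"
  by (rule theta_eqI) (auto simp: den_carr theta theta_den prod.distrib power_add)

lemma denominators: "I \<subseteq> {..<length xs} \<Longrightarrow> denominators R \<theta> (denoms I)"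
proof
  assume I: "I \<subseteq> {..<length xs}"
  show "denoms I \<subseteq> carrier R" using prod_carr [OF I] by (auto simp: denoms_def)
  have "den 0 I = \<one>" by (rule theta_eqI) (auto simp: den_carr theta theta_den I)
  then show "\<one> \<in> denoms I" using den_in by metis
  fix s t assume "s \<in> denoms I" "t \<in> denoms I"
  then obtain e f where "s = finprod R (\<lambda>j. (xs ! j) [^] (e j :: nat)) I"
    "t = finprod R (\<lambda>j. (xs ! j) [^] (f j :: nat)) I" by (auto simp: denoms_def)
  then have "s \<otimes> t = finprod R (\<lambda>j. (xs ! j) [^] (e j + f j)) I"
    by (intro theta_eqI) (auto simp: prod_carr theta theta_prod I prod.distrib power_add)
  then show "s \<otimes> t \<in> denoms I" unfolding denoms_def by (auto intro: exI [of _ "\<lambda>j. e j + f j"])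
qed

text \<open>Hence every fraction, and then every cochain, can be written with a denominator \<open>den N I\<close>, with
  the same \<open>N\<close> for all components.\<close>

lemma denoms_cofinal:
  assumes I: "I \<subseteq> {..<length xs}" and s: "s \<in> denoms I"
  shows "\<exists>N. \<forall>M\<ge>N. \<exists>u\<in>carrier R. den M I = u \<otimes> s"
proof -
  obtain e where e: "s = finprod R (\<lambda>j. (xs ! j) [^] (e j :: nat)) I" using s by (auto simp: denoms_def)
  define N where "N = Max (insert 0 (e ` I))"
  have le: "e j \<le> N" if "j \<in> I" for j using fin_ix [OF I] that by (auto simp: N_def)
  have "\<exists>u\<in>carrier R. den M I = u \<otimes> s" if M: "M \<ge> N" for M
  proof (rule bexI)
    have "x j ^ M = x j ^ (M - e j) * x j ^ e j" if "j \<in> I" for j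
      using le [OF that] M by (simp add: power_add [symmetric])
    then have "\<theta> (den M I) = \<theta> (finprod R (\<lambda>j. (xs ! j) [^] (M - e j)) I \<otimes> s)"
      unfolding e by (simp add: prod_carr theta theta_den theta_prod I prod.distrib [symmetric])
    then show "den M I = finprod R (\<lambda>j. (xs ! j) [^] (M - e j)) I \<otimes> s"
      by (rule theta_eqI [rotated 2]) (auto simp: prod_carr den_carr I e)
  qed (rule prod_carr [OF I])
  then show ?thesis by (intro exI [of _ N]) simp
qed

lemma over_den_closed: "I \<subseteq> {..<length xs} \<Longrightarrow> r \<in> carrier R \<Longrightarrow> over_den I N r \<in> carrier (cech_ring R xs I)"
  unfolding over_den_def cech_ring_eq by (rule denominators.localization_carrierI [OF denominators]) (auto simp: den_in)

lemma carrier_fr: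
  assumes I: "I \<subseteq> {..<length xs}" and c: "c \<in> carrier (cech_ring R xs I)"
  shows "\<exists>N. \<forall>M\<ge>N. \<exists>r\<in>carrier R. c = over_den I M r"
proof -
  interpret D: denominators R \<theta> "denoms I" by (rule denominators [OF I])
  obtain r s where rs: "r \<in> carrier R" "s \<in> denoms I" "c = fraction R (denoms I) r s"
    using c unfolding cech_ring_eq by (rule D.localization_carrierE)
  obtain N where N: "\<And>M. M \<ge> N \<Longrightarrow> \<exists>u\<in>carrier R. den M I = u \<otimes> s"
    using denoms_cofinal [OF I rs(2)] by blast
  have "\<exists>r\<in>carrier R. c = over_den I M r" if M: "M \<ge> N" for M
  proof -
    obtain u where u: "u \<in> carrier R" "den M I = u \<otimes> s" using N [OF M] by blast
    have "c = over_den I M (u \<otimes> r)"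
      unfolding rs(3) over_den_def
      by (rule D.fraction_eqI) (use u rs in \<open>auto simp: den_in theta algebra_simps simp flip: u(2)\<close>, simp add: u rs theta)
    then show ?thesis using u rs by blast
  qed
  then show ?thesis by blast
qed

lemma over_den_raise:
  assumes I: "I \<subseteq> {..<length xs}" and r: "r \<in> carrier R"
  shows "over_den I N r = over_den I (N + t) (den t I \<otimes> r)"
proof -
  interpret D: denominators R \<theta> "denoms I" by (rule denominators [OF I])
  show ?thesis unfolding over_den_def
    by (rule D.fraction_eqI)
       (use I r in \<open>auto simp: den_in den_carr theta theta_den power_add prod.distrib algebra_simps\<close>)
qed

lemma over_den_eqD:
  assumes I: "I \<subseteq> {..<length xs}" and r: "r \<in> carrier R" "r' \<in> carrier R" and eq: "over_den I N r = over_den I N r'"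
  shows "\<exists>M. \<forall>t\<ge>M. den t I \<otimes> r = den t I \<otimes> r'"
proof -
  interpret D: denominators R \<theta> "denoms I" by (rule denominators [OF I])
  obtain s where s: "s \<in> denoms I" "\<theta> s * (\<theta> (den N I) * \<theta> r) = \<theta> s * (\<theta> (den N I) * \<theta> r')"
    using eq D.fraction_eq_iff [OF r(1) den_in r(2) den_in] unfolding over_den_def by blast
  obtain M where M: "\<And>t. t \<ge> M \<Longrightarrow> \<exists>u\<in>carrier R. den t I = u \<otimes> s"
    using denoms_cofinal [OF I s(1)] by blast
  have "den t I \<otimes> r = den t I \<otimes> r'" if t: "t \<ge> M + N" for t
  proof -
    obtain u where u: "u \<in> carrier R" "den (t - N) I = u \<otimes> s" using M [of "t - N"] t by (metis add_le_imp_le_diff)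
    have "den t I = u \<otimes> s \<otimes> den N I" using den_mult [OF I, of "t - N" N] u(2) t by simp
    then have "\<theta> (den t I) * \<theta> r = \<theta> (den t I) * \<theta> r'"
      using u(1) s(1) s(2) by (simp add: theta den_carr I mult.assoc)
    then show ?thesis using r I by (intro theta_eqI) (auto simp: den_carr theta)
  qed
  then show ?thesis by blast
qed


lemma over_den_pow:
  assumes I: "I \<subseteq> {..<length xs}" and r: "r \<in> carrier R"
  shows "over_den I N r [^]\<^bsub>cech_ring R xs I\<^esub> p = over_den I (N * p) (r [^] p)"
proof -
  interpret D: denominators R \<theta> "denoms I" by (rule denominators [OF I])
  have "den N I [^] p = den (N * p) I"
    by (rule theta_eqI) (use I in \<open>auto simp: den_carr theta theta_den power_mult prod_power_distrib\<close>)
  then show ?thesis using D.localization_pow [OF r den_in, of N p] by (simp add: over_den_def cech_ring_eq)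
qed

lemma over_den_add:
  assumes I: "I \<subseteq> {..<length xs}" and r: "r \<in> carrier R" "r' \<in> carrier R"
  shows "over_den I N r \<oplus>\<^bsub>cech_ring R xs I\<^esub> over_den I N r' = over_den I N (r \<oplus> r')"
  unfolding over_den_def cech_ring_eq
  by (rule denominators.localization_add_same [OF denominators]) (use assms den_in in auto)

lemma over_den_zero:
  assumes I: "I \<subseteq> {..<length xs}"
  shows "\<zero>\<^bsub>cech_ring R xs I\<^esub> = over_den I N \<zero>"
  unfolding over_den_def cech_ring_eq
  by (rule denominators.localization_zero [OF denominators]) (use assms den_in in auto)

lemma over_den_minus:
  assumes I: "I \<subseteq> {..<length xs}" and r: "r \<in> carrier R"
  shows "\<ominus>\<^bsub>cech_ring R xs I\<^esub> over_den I N r = over_den I N (\<ominus> r)"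
  unfolding over_den_def cech_ring_eq
  by (rule denominators.localization_minus [OF denominators]) (use assms den_in in auto)

lemma over_den_finsum:
  assumes I: "I \<subseteq> {..<length xs}" and f: "f \<in> I \<rightarrow> carrier R"
  shows "finsum (cech_ring R xs I) (\<lambda>j. over_den I N (f j)) I = over_den I N (finsum R f I)"
  unfolding over_den_def cech_ring_eq
  by (rule denominators.localization_finsum [OF denominators]) (use assms den_in fin_ix in auto)

lemma over_den_map:
  assumes J: "J \<subseteq> {..<length xs}" and j: "j \<in> J" and r: "r \<in> carrier R"
  shows "cech_map R xs J (over_den (J - {j}) N r) = over_den J N ((xs ! j) [^] N \<otimes> r)"
proof -
  interpret D: denominators R \<theta> "denoms J" by (rule denominators [OF J])
  have J': "J - {j} \<subseteq> {..<length xs}" using J by auto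
  have xj: "xs ! j \<in> carrier R" using J j xs_carr by auto
  have sub: "denoms (J - {j}) \<subseteq> denoms J"
  proof
    fix s assume "s \<in> denoms (J - {j})"
    then obtain e where e: "s = finprod R (\<lambda>i. (xs ! i) [^] (e i :: nat)) (J - {j})"
      by (auto simp: denoms_def)
    have eq: "(\<Prod>i\<in>J. x i ^ (e(j := 0)) i) = (\<Prod>i\<in>J - {j}. x i ^ e i)"
      using fin_ix [OF J] j by (subst prod.remove [of J j]) (auto intro!: prod.cong)
    have "s = finprod R (\<lambda>i. (xs ! i) [^] (e(j := 0)) i) J"
      unfolding e by (rule theta_eqI) (auto simp only: prod_carr [OF J] prod_carr [OF J'] theta_prod [OF J] theta_prod [OF J'] eq)
    then show "s \<in> denoms J" unfolding denoms_def by blast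
  qed
  have "cech_map R xs J (over_den (J - {j}) N r) = fraction R (denoms J) r (den N (J - {j}))"
    unfolding cech_map_eq over_den_def
    by (rule denominators.localization_map_fraction [OF denominators [OF J'] denominators [OF J] sub])
       (use r den_in in auto)
  also have "\<dots> = over_den J N ((xs ! j) [^] N \<otimes> r)"
    unfolding over_den_def
  proof (rule D.fraction_eqI)
    show "den N (J - {j}) \<in> denoms J" using sub den_in by blast
    show "\<theta> (den N J) * \<theta> r = \<theta> (den N (J - {j})) * \<theta> ((xs ! j) [^] N \<otimes> r)"
      using r xj prod.remove [OF fin_ix [OF J] j, of "\<lambda>i. x i ^ N"]
      by (simp add: theta theta_den J J' x_def algebra_simps)
  qed (use r xj den_in in auto)
  finally show ?thesis .
qed

text \<open>Every Cech cochain has this form, for all large \<open>N\<close>, because there are only finitely many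
  components.\<close>

definition cochain :: "nat \<Rightarrow> nat \<Rightarrow> (nat set \<Rightarrow> 'a) \<Rightarrow> nat set \<Rightarrow> ('a \<times> 'a) set" where
  "cochain i N r = (\<lambda>I\<in>cech_index xs i. over_den I N (r I))"

definition ring_valued :: "nat \<Rightarrow> (nat set \<Rightarrow> 'a) \<Rightarrow> bool" where
  "ring_valued i r \<longleftrightarrow> (\<forall>I\<in>cech_index xs i. r I \<in> carrier R)"

text \<open>Written with the signs of the Cech differential; \<open>\<theta>\<close> turns it into \<open>kd\<close>.\<close>

definition dk :: "nat \<Rightarrow> (nat set \<Rightarrow> 'a) \<Rightarrow> nat set \<Rightarrow> 'a" where
  "dk N r J = finsum R (\<lambda>j. if even (card {l\<in>J. l < j}) then (xs ! j) [^] N \<otimes> r (J - {j})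
     else \<ominus> ((xs ! j) [^] N \<otimes> r (J - {j}))) J"

lemma index_sub: "I \<in> cech_index xs i \<Longrightarrow> I \<subseteq> {..<length xs}"
  by (auto simp: cech_index_def)

lemma index_remove: "J \<in> cech_index xs (Suc i) \<Longrightarrow> j \<in> J \<Longrightarrow> J - {j} \<in> cech_index xs i"
  using fin_ix by (auto simp: cech_index_def)

lemma finite_index: "finite (cech_index xs i)"
  by (rule finite_subset [of _ "Pow {..<length xs}"]) (auto simp: cech_index_def)

lemma dk_Pi:
  assumes "ring_valued i r" "J \<in> cech_index xs (Suc i)"
  shows "(\<lambda>j. if even (card {l\<in>J. l < j}) then (xs ! j) [^] (N::nat) \<otimes> r (J - {j})
     else \<ominus> ((xs ! j) [^] N \<otimes> r (J - {j}))) \<in> J \<rightarrow> carrier R"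
proof -
  have "(xs ! j) [^] N \<otimes> r (J - {j}) \<in> carrier R" if "j \<in> J" for j
  proof -
    have "j < length xs" using that index_sub [OF assms(2)] by auto
    then show ?thesis
      using assms(1) index_remove [OF assms(2) that] xs_carr by (auto simp: ring_valued_def)
  qed
  then show ?thesis by auto
qed

lemma ring_valued_dk: "ring_valued i r \<Longrightarrow> ring_valued (Suc i) (dk N r)"
  unfolding ring_valued_def dk_def using dk_Pi by (auto intro!: finsum_closed simp: ring_valued_def)

lemma theta_dk:
  assumes r: "ring_valued i r" and J: "J \<in> cech_index xs (Suc i)"
  shows "\<theta> (dk N r J) = kd (\<lambda>j. x j ^ N) (\<lambda>I. \<theta> (r I)) J"
proof -
  have "\<theta> (dk N r J) = (\<Sum>j\<in>J. \<theta> (if even (card {l\<in>J. l < j}) then (xs ! j) [^] N \<otimes> r (J - {j})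
     else \<ominus> ((xs ! j) [^] N \<otimes> r (J - {j}))))"
    unfolding dk_def by (rule theta_finsum) (use dk_Pi [OF r J] fin_ix [OF index_sub [OF J]] in auto)
  also have "\<dots> = kd (\<lambda>j. x j ^ N) (\<lambda>I. \<theta> (r I)) J"
    unfolding kd_def
  proof (rule sum.cong)
    fix j assume j: "j \<in> J"
    have "j < length xs" using j index_sub [OF J] by auto
    then have "r (J - {j}) \<in> carrier R" "xs ! j \<in> carrier R"
      using index_remove [OF J j] r xs_carr [of j] by (auto simp: ring_valued_def)
    then show "\<theta> (if even (card {l\<in>J. l < j}) then (xs ! j) [^] N \<otimes> r (J - {j})
        else \<ominus> ((xs ! j) [^] N \<otimes> r (J - {j}))) = ksgn j J * x j ^ N * \<theta> (r (J - {j}))"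
      by (simp add: theta x_def ksgn_def)
  qed simp
  finally show ?thesis .
qed

lemma cochain_cong:
  assumes "\<And>I. I \<in> cech_index xs i \<Longrightarrow> r I = r' I"
  shows "cochain i N r = cochain i N r'"
  unfolding cochain_def using assms by (intro restrict_ext) auto

lemma cochain_closed: "ring_valued i r \<Longrightarrow> cochain i N r \<in> carrier (cech_group R xs i)"
  by (auto simp: cochain_def cech_group_def ring_valued_def intro!: over_den_closed dest: index_sub)

lemma cochain_exists:
  assumes c: "c \<in> carrier (cech_group R xs i)"
  shows "\<exists>N. \<forall>M\<ge>N. \<exists>r. ring_valued i r \<and> c = cochain i M r"
proof -
  have "\<forall>I\<in>cech_index xs i. \<exists>N. \<forall>M\<ge>N. \<exists>r\<in>carrier R. c I = over_den I M r"
    using c carrier_fr index_sub by (auto simp: cech_group_def PiE_def Pi_def)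
  then obtain N where N: "\<And>I M. I \<in> cech_index xs i \<Longrightarrow> M \<ge> N I \<Longrightarrow> \<exists>r\<in>carrier R. c I = over_den I M r"
    by metis
  define N0 where "N0 = Max (insert 0 (N ` cech_index xs i))"
  have N0: "N I \<le> N0" if "I \<in> cech_index xs i" for I
    using that finite_index by (auto simp: N0_def)
  have "\<exists>r. ring_valued i r \<and> c = cochain i M r" if M: "M \<ge> N0" for M
  proof -
    have "\<forall>I\<in>cech_index xs i. \<exists>r\<in>carrier R. c I = over_den I M r" using N N0 M by (meson order_trans)
    then obtain r where r: "\<And>I. I \<in> cech_index xs i \<Longrightarrow> r I \<in> carrier R \<and> c I = over_den I M (r I)" by metis
    have "c = cochain i M r"
    proof
      fix I show "c I = cochain i M r I"
        using c r [of I] by (cases "I \<in> cech_index xs i") (auto simp: cochain_def cech_group_def PiE_def extensional_def)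
    qed
    then show ?thesis using r by (auto simp: ring_valued_def)
  qed
  then show ?thesis by blast
qed

lemma cochain_raise:
  assumes "ring_valued i r"
  shows "cochain i N r = cochain i (N + t) (\<lambda>I. den t I \<otimes> r I)"
  unfolding cochain_def
  by (rule restrict_ext) (use assms over_den_raise index_sub in \<open>auto simp: ring_valued_def\<close>)

lemma ring_valued_den: "ring_valued i r \<Longrightarrow> ring_valued i (\<lambda>I. den t I \<otimes> r I)"
  by (auto simp: ring_valued_def intro!: m_closed den_carr [OF index_sub])

lemma cochain_eqD:
  assumes "ring_valued i r" "ring_valued i r'" "cochain i N r = cochain i N r'"
  shows "\<exists>t. \<forall>I\<in>cech_index xs i. den t I \<otimes> r I = den t I \<otimes> r' I"
proof -
  have "\<forall>I\<in>cech_index xs i. \<exists>M. \<forall>t\<ge>M. den t I \<otimes> r I = den t I \<otimes> r' I"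
  proof
    fix I assume I: "I \<in> cech_index xs i"
    then have "over_den I N (r I) = over_den I N (r' I)" using fun_cong [OF assms(3), of I] by (simp add: cochain_def)
    then show "\<exists>M. \<forall>t\<ge>M. den t I \<otimes> r I = den t I \<otimes> r' I"
      using assms I by (intro over_den_eqD [OF index_sub [OF I]]) (auto simp: ring_valued_def)
  qed
  then obtain M where M: "\<And>I t. I \<in> cech_index xs i \<Longrightarrow> t \<ge> M I \<Longrightarrow> den t I \<otimes> r I = den t I \<otimes> r' I"
    by metis
  define t where "t = Max (insert 0 (M ` cech_index xs i))"
  have "M I \<le> t" if "I \<in> cech_index xs i" for I
    using that finite_index by (auto simp: t_def)
  then show ?thesis using M by blast
qed

lemma cochain_mult:
  assumes "ring_valued i r" "ring_valued i r'"
  shows "cochain i N r \<otimes>\<^bsub>cech_group R xs i\<^esub> cochain i N r' = cochain i N (\<lambda>I. r I \<oplus> r' I)"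
  unfolding cech_group_def cochain_def monoid.simps
  by (rule restrict_ext) (use assms over_den_add index_sub in \<open>auto simp: ring_valued_def\<close>)

lemma cochain_one: "\<one>\<^bsub>cech_group R xs i\<^esub> = cochain i N (\<lambda>_. \<zero>)"
  unfolding cech_group_def cochain_def monoid.simps
  by (rule restrict_ext) (use over_den_zero index_sub in auto)

lemma cech_diff_cochain:
  assumes r: "ring_valued i r"
  shows "cech_diff R xs i (cochain i N r) = cochain (Suc i) N (dk N r)"
  unfolding cech_diff_def cochain_def [of "Suc i"]
proof (rule restrict_ext)
  fix J assume J: "J \<in> cech_index xs (Suc i)"
  note Js = index_sub [OF J]
  let ?f = "\<lambda>j. if even (card {l\<in>J. l < j}) then (xs ! j) [^] N \<otimes> r (J - {j})
     else \<ominus> ((xs ! j) [^] N \<otimes> r (J - {j}))"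
  have summand: "(if even (card {l\<in>J. l < j}) then cech_map R xs J (cochain i N r (J - {j}))
       else \<ominus>\<^bsub>cech_ring R xs J\<^esub> cech_map R xs J (cochain i N r (J - {j}))) = over_den J N (?f j)" if j: "j \<in> J" for j
  proof -
    have "j < length xs" using j Js by auto
    then have c: "r (J - {j}) \<in> carrier R" "xs ! j \<in> carrier R"
      using index_remove [OF J j] r xs_carr [of j] by (auto simp: ring_valued_def)
    have "cech_map R xs J (cochain i N r (J - {j})) = over_den J N ((xs ! j) [^] N \<otimes> r (J - {j}))"
      using index_remove [OF J j] over_den_map [OF Js j c(1)] by (simp add: cochain_def)
    then show ?thesis using over_den_minus [OF Js] c by simp
  qed
  interpret D: denominators R \<theta> "denoms J" by (rule denominators [OF Js])
  interpret L: abelian_group "cech_ring R xs J"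
    unfolding cech_ring_eq by (rule D.localization_abelian_group)
  have "finsum (cech_ring R xs J)
        (\<lambda>j. if even (card {l\<in>J. l < j}) then cech_map R xs J (cochain i N r (J - {j}))
             else \<ominus>\<^bsub>cech_ring R xs J\<^esub> cech_map R xs J (cochain i N r (J - {j}))) J
      = finsum (cech_ring R xs J) (\<lambda>j. over_den J N (?f j)) J"
    by (rule L.finsum_cong') (use summand dk_Pi [OF r J, of N] in \<open>auto simp: Pi_def intro!: over_den_closed [OF Js]\<close>)
  also have "\<dots> = over_den J N (dk N r J)"
    unfolding dk_def by (rule over_den_finsum [OF Js dk_Pi [OF r J]])
  finally show "finsum (cech_ring R xs J)
        (\<lambda>j. if even (card {l\<in>J. l < j}) then cech_map R xs J (cochain i N r (J - {j}))
             else \<ominus>\<^bsub>cech_ring R xs J\<^esub> cech_map R xs J (cochain i N r (J - {j}))) J = over_den J N (dk N r J)" .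
qed

lemma cech_frobenius_cochain:
  assumes "ring_valued i r"
  shows "cech_frobenius p R xs i (cochain i N r) = cochain i (N * p) (\<lambda>I. r I [^] p)"
  unfolding cech_frobenius_def cochain_def
  by (rule restrict_ext) (use assms over_den_pow index_sub in \<open>auto simp: ring_valued_def\<close>)


lemma coboundaryE:
  assumes "c \<in> cech_coboundaries R xs (Suc i)"
  shows "\<exists>N. \<forall>M\<ge>N. \<exists>w. ring_valued i w \<and> c = cochain (Suc i) M (dk M w)"
proof -
  obtain b where b: "b \<in> carrier (cech_group R xs i)" "c = cech_diff R xs i b"
    using assms by (auto simp: cech_coboundaries_def)
  then show ?thesis using cochain_exists [OF b(1)] cech_diff_cochain by metis
qed

lemma coboundaryI: "ring_valued i w \<Longrightarrow> cochain (Suc i) M (dk M w) \<in> cech_coboundaries R xs (Suc i)"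
  by (simp add: cech_coboundaries_def cech_diff_cochain [symmetric] cochain_closed)

lemma dk_add:
  assumes "ring_valued i w" "ring_valued i w'" "J \<in> cech_index xs (Suc i)"
  shows "dk N w J \<oplus> dk N w' J = dk N (\<lambda>I. w I \<oplus> w' I) J"
proof -
  have c: "ring_valued i (\<lambda>I. w I \<oplus> w' I)" using assms by (auto simp: ring_valued_def)
  have "kd (\<lambda>j. x j ^ N) (\<lambda>I. \<theta> (w I \<oplus> w' I)) J = kd (\<lambda>j. x j ^ N) (\<lambda>I. \<theta> (w I) + \<theta> (w' I)) J"
    by (rule kd_cong) (use assms index_remove [OF assms(3)] in \<open>auto simp: ring_valued_def theta\<close>)
  then show ?thesis
    using ring_valued_dk [OF c] ring_valued_dk [OF assms(1)] ring_valued_dk [OF assms(2)] assms(3)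
    by (intro theta_eqI)
       (auto simp: theta theta_dk [OF assms(1,3)] theta_dk [OF assms(2,3)] theta_dk [OF c assms(3)] kd_add ring_valued_def)
qed

lemma dk_minus:
  assumes "ring_valued i w" "J \<in> cech_index xs (Suc i)"
  shows "\<ominus> dk N w J = dk N (\<lambda>I. \<ominus> w I) J"
proof -
  have c: "ring_valued i (\<lambda>I. \<ominus> w I)" using assms by (auto simp: ring_valued_def)
  have "kd (\<lambda>j. x j ^ N) (\<lambda>I. \<theta> (\<ominus> w I)) J = kd (\<lambda>j. x j ^ N) (\<lambda>I. (-1) * \<theta> (w I)) J"
    by (rule kd_cong) (use assms index_remove [OF assms(2)] in \<open>auto simp: ring_valued_def theta\<close>)
  then show ?thesis
    using ring_valued_dk [OF c] ring_valued_dk [OF assms(1)] assms(2) unfolding kd_mult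
    by (intro theta_eqI)
       (auto simp: theta theta_dk [OF assms(1,2)] theta_dk [OF c assms(2)] ring_valued_def)
qed

lemma coboundary_add:
  assumes "a \<in> cech_coboundaries R xs (Suc i)" "b \<in> cech_coboundaries R xs (Suc i)"
  shows "a \<otimes>\<^bsub>cech_group R xs (Suc i)\<^esub> b \<in> cech_coboundaries R xs (Suc i)"
proof -
  obtain M N where "\<And>K. K \<ge> M \<Longrightarrow> \<exists>w. ring_valued i w \<and> a = cochain (Suc i) K (dk K w)"
    "\<And>K. K \<ge> N \<Longrightarrow> \<exists>w. ring_valued i w \<and> b = cochain (Suc i) K (dk K w)"
    using coboundaryE assms by meson
  then obtain w w' where w: "ring_valued i w" "a = cochain (Suc i) (M + N) (dk (M + N) w)"
    "ring_valued i w'" "b = cochain (Suc i) (M + N) (dk (M + N) w')"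
    by (meson le_add1 le_add2)
  have "a \<otimes>\<^bsub>cech_group R xs (Suc i)\<^esub> b = cochain (Suc i) (M + N) (dk (M + N) (\<lambda>I. w I \<oplus> w' I))"
    unfolding w(2,4) cochain_mult [OF ring_valued_dk [OF w(1)] ring_valued_dk [OF w(3)]]
    by (rule cochain_cong) (rule dk_add [OF w(1,3)])
  then show ?thesis using w by (auto intro!: coboundaryI simp: ring_valued_def)
qed

lemma coset_coboundary:
  assumes b: "b \<in> cech_coboundaries R xs (Suc i)"
  shows "cech_coboundaries R xs (Suc i) #>\<^bsub>cech_group R xs (Suc i)\<^esub> b = cech_coboundaries R xs (Suc i)"
proof (intro equalityI subsetI)
  fix a assume "a \<in> cech_coboundaries R xs (Suc i) #>\<^bsub>cech_group R xs (Suc i)\<^esub> b"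
  then show "a \<in> cech_coboundaries R xs (Suc i)" using b by (auto simp: r_coset_def coboundary_add)
next
  fix a assume a: "a \<in> cech_coboundaries R xs (Suc i)"
  obtain M N where "\<And>K. K \<ge> M \<Longrightarrow> \<exists>w. ring_valued i w \<and> a = cochain (Suc i) K (dk K w)"
    "\<And>K. K \<ge> N \<Longrightarrow> \<exists>w. ring_valued i w \<and> b = cochain (Suc i) K (dk K w)"
    using coboundaryE a b by meson
  then obtain w w' where w: "ring_valued i w" "a = cochain (Suc i) (M + N) (dk (M + N) w)"
    "ring_valued i w'" "b = cochain (Suc i) (M + N) (dk (M + N) w')"
    by (meson le_add1 le_add2)
  define u where "u I = w I \<oplus> \<ominus> w' I" for I
  have u: "ring_valued i u" using w by (auto simp: u_def ring_valued_def)
  have "cochain (Suc i) (M + N) (dk (M + N) u) \<otimes>\<^bsub>cech_group R xs (Suc i)\<^esub> b = a"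
    unfolding w(2,4) cochain_mult [OF ring_valued_dk [OF u] ring_valued_dk [OF w(3)]]
  proof (rule cochain_cong)
    fix J assume J: "J \<in> cech_index xs (Suc i)"
    have m: "ring_valued i (\<lambda>I. \<ominus> w' I)" using w by (auto simp: ring_valued_def)
    have c: "dk (M + N) w J \<in> carrier R" "dk (M + N) w' J \<in> carrier R"
      using ring_valued_dk w J by (auto simp: ring_valued_def)
    have "dk (M + N) u J = dk (M + N) w J \<oplus> \<ominus> dk (M + N) w' J"
      unfolding u_def [abs_def] dk_minus [OF w(3) J] dk_add [OF w(1) m J] ..
    then show "dk (M + N) u J \<oplus> dk (M + N) w' J = dk (M + N) w J"
      using c by (simp add: a_assoc l_neg)
  qed
  then show "a \<in> cech_coboundaries R xs (Suc i) #>\<^bsub>cech_group R xs (Suc i)\<^esub> b"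
    using coboundaryI [OF u] unfolding r_coset_def by blast
qed

context
  fixes p :: nat
  assumes p: "p > 0"
    and frob_add: "\<And>a b. a \<in> carrier R \<Longrightarrow> b \<in> carrier R \<Longrightarrow> (a \<oplus> b) [^] p = a [^] p \<oplus> b [^] p"
begin

lemma zero_pow: "\<zero> [^] p = \<zero>"
  by (rule theta_eqI) (simp_all add: theta zero_power [OF p])

lemma frob_minus: "a \<in> carrier R \<Longrightarrow> (\<ominus> a) [^] p = \<ominus> (a [^] p)"
  using frob_add [of "\<ominus> a" a] by (simp add: l_neg zero_pow minus_equality)

lemma frob_finsum: "finite J \<Longrightarrow> f \<in> J \<rightarrow> carrier R \<Longrightarrow> finsum R f J [^] p = finsum R (\<lambda>j. f j [^] p) J"
  by (induction J rule: finite_induct) (auto simp: zero_pow frob_add Pi_def)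

lemma frob_dk:
  assumes w: "ring_valued i w" and J: "J \<in> cech_index xs (Suc i)"
  shows "dk N w J [^] p = dk (N * p) (\<lambda>I. w I [^] p) J"
proof -
  let ?f = "\<lambda>j. if even (card {l\<in>J. l < j}) then (xs ! j) [^] N \<otimes> w (J - {j})
     else \<ominus> ((xs ! j) [^] N \<otimes> w (J - {j}))"
  have "dk N w J [^] p = finsum R (\<lambda>j. ?f j [^] p) J"
    unfolding dk_def by (rule frob_finsum [OF fin_ix [OF index_sub [OF J]] dk_Pi [OF w J]])
  also have "\<dots> = dk (N * p) (\<lambda>I. w I [^] p) J"
    unfolding dk_def
  proof (rule finsum_cong')
    show "(\<lambda>j. if even (card {l\<in>J. l < j}) then (xs ! j) [^] (N * p) \<otimes> w (J - {j}) [^] p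
       else \<ominus> ((xs ! j) [^] (N * p) \<otimes> w (J - {j}) [^] p)) \<in> J \<rightarrow> carrier R"
      using dk_Pi [of i "\<lambda>I. w I [^] p", OF _ J] w by (auto simp: ring_valued_def)
    fix j assume j: "j \<in> J"
    have "j < length xs" using j index_sub [OF J] by auto
    then have c: "w (J - {j}) \<in> carrier R" "xs ! j \<in> carrier R"
      using index_remove [OF J j] w xs_carr [of j] by (auto simp: ring_valued_def)
    then show "?f j [^] p = (if even (card {l\<in>J. l < j}) then (xs ! j) [^] (N * p) \<otimes> w (J - {j}) [^] p
       else \<ominus> ((xs ! j) [^] (N * p) \<otimes> w (J - {j}) [^] p))"
      by (simp add: frob_minus nat_pow_distrib nat_pow_pow)
  qed simp
  finally show ?thesis .
qed

lemma frobenius_coset: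
  assumes r: "ring_valued (Suc i) r"
    and F: "cech_frobenius p R xs (Suc i) (cochain (Suc i) N r) \<in> cech_coboundaries R xs (Suc i)"
  shows "local_cohomology_frobenius p R xs (Suc i)
      (cech_coboundaries R xs (Suc i) #>\<^bsub>cech_group R xs (Suc i)\<^esub> cochain (Suc i) N r)
    = cech_coboundaries R xs (Suc i)"
proof -
  let ?B = "cech_coboundaries R xs (Suc i)" and ?G = "cech_group R xs (Suc i)"
  let ?F = "cech_frobenius p R xs (Suc i)"
  have "?F c \<in> ?B" if c: "c \<in> ?B #>\<^bsub>?G\<^esub> cochain (Suc i) N r" for c
  proof -
    obtain b where b: "b \<in> ?B" "c = b \<otimes>\<^bsub>?G\<^esub> cochain (Suc i) N r"
      using c by (auto simp: r_coset_def)
    obtain M0 where "\<And>K. K \<ge> M0 \<Longrightarrow> \<exists>w. ring_valued i w \<and> b = cochain (Suc i) K (dk K w)"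
      using coboundaryE [OF b(1)] by blast
    then obtain w where w: "ring_valued i w" "b = cochain (Suc i) (N + M0) (dk (N + M0) w)"
      by (meson le_add2)
    define M where "M = N + M0"
    define r' where "r' I = den M0 I \<otimes> r I" for I
    have r': "ring_valued (Suc i) r'" unfolding r'_def [abs_def] by (rule ring_valued_den [OF r])
    have cr': "cochain (Suc i) N r = cochain (Suc i) M r'"
      unfolding M_def r'_def [abs_def] by (rule cochain_raise [OF r])
    have wp: "ring_valued i (\<lambda>I. w I [^] p)" using w by (auto simp: ring_valued_def)
    have rp: "ring_valued (Suc i) (\<lambda>I. r' I [^] p)" using r' by (auto simp: ring_valued_def)
    have dw: "ring_valued (Suc i) (dk M w)" by (rule ring_valued_dk [OF w(1)])
    have "c = cochain (Suc i) M (\<lambda>I. dk M w I \<oplus> r' I)"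
      unfolding b(2) w(2) cr' M_def [symmetric] by (rule cochain_mult [OF dw r'])
    then have "?F c = cochain (Suc i) (M * p) (\<lambda>I. (dk M w I \<oplus> r' I) [^] p)"
      using dw r' by (simp add: cech_frobenius_cochain ring_valued_def)
    also have "\<dots> = cochain (Suc i) (M * p) (\<lambda>I. dk (M * p) (\<lambda>I. w I [^] p) I \<oplus> r' I [^] p)"
      by (rule cochain_cong) (use dw r' frob_dk [OF w(1)] in \<open>auto simp: ring_valued_def frob_add\<close>)
    also have "\<dots> = cochain (Suc i) (M * p) (dk (M * p) (\<lambda>I. w I [^] p)) \<otimes>\<^bsub>?G\<^esub> ?F (cochain (Suc i) N r)"
      unfolding cr' cech_frobenius_cochain [OF r'] by (rule cochain_mult [symmetric, OF ring_valued_dk [OF wp] rp])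
    finally show ?thesis using coboundary_add [OF coboundaryI [OF wp] F] by simp
  qed
  moreover have "cochain (Suc i) 0 (dk 0 (\<lambda>_. \<zero>)) \<otimes>\<^bsub>?G\<^esub> cochain (Suc i) N r \<in> ?B #>\<^bsub>?G\<^esub> cochain (Suc i) N r"
    using coboundaryI [of i "\<lambda>_. \<zero>" 0] by (auto simp: r_coset_def ring_valued_def)
  ultimately show ?thesis
    unfolding local_cohomology_frobenius_def using coset_coboundary by blast
qed

text \<open>The hypothesis on \<open>w\<close> says that the Frobenius image of the class of the cocycle \<open>r\<close> is zero.
  Both this class and the zero class are mapped to the set of coboundaries, so they coincide.\<close>

theorem frobenius_inj_koszul:
  assumes inj: "inj_on (local_cohomology_frobenius p R xs (Suc i)) (carrier (local_cohomology R xs (Suc i)))"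
    and r: "ring_valued (Suc i) r" and cocycle: "\<And>J. J \<in> cech_index xs (Suc (Suc i)) \<Longrightarrow> dk N r J = \<zero>"
    and w: "ring_valued i w" "\<And>J. J \<in> cech_index xs (Suc i) \<Longrightarrow> r J [^] p = dk (N * p) w J"
  shows "\<exists>t v. ring_valued i v \<and> (\<forall>J\<in>cech_index xs (Suc i). den t J \<otimes> r J = dk (N + t) v J)"
proof -
  let ?B = "cech_coboundaries R xs (Suc i)" and ?G = "cech_group R xs (Suc i)"
  let ?H = "local_cohomology R xs (Suc i)" and ?F = "local_cohomology_frobenius p R xs (Suc i)"
  define c where "c = cochain (Suc i) N r"
  define z where "z = cochain (Suc i) N (\<lambda>_. \<zero>)"
  have z: "ring_valued (Suc i) (\<lambda>_. \<zero>)" by (simp add: ring_valued_def)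
  have dz: "dk N (\<lambda>_. \<zero>) J = \<zero>" if J: "J \<in> cech_index xs (Suc k)" for J k
  proof (rule theta_eqI)
    have c: "ring_valued k (\<lambda>_. \<zero>)" by (simp add: ring_valued_def)
    show "dk N (\<lambda>_. \<zero>) J \<in> carrier R" using ring_valued_dk [OF c] J by (auto simp: ring_valued_def)
    show "\<theta> (dk N (\<lambda>_. \<zero>) J) = \<theta> \<zero>" by (simp add: theta_dk [OF c J] theta kd_def)
  qed simp
  have coset: "?B #>\<^bsub>?G\<^esub> cochain (Suc i) N s \<in> carrier ?H"
    if s: "ring_valued (Suc i) s" "\<And>J. J \<in> cech_index xs (Suc (Suc i)) \<Longrightarrow> dk N s J = \<zero>" for s
  proof -
    have "cech_diff R xs (Suc i) (cochain (Suc i) N s) = cochain (Suc (Suc i)) N (dk N s)"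
      by (rule cech_diff_cochain [OF s(1)])
    also have "\<dots> = \<one>\<^bsub>cech_group R xs (Suc (Suc i))\<^esub>"
      unfolding cochain_one [of _ N] by (rule cochain_cong) (rule s(2))
    finally have "cochain (Suc i) N s \<in> cech_cocycles R xs (Suc i)"
      using cochain_closed [OF s(1)] by (simp add: cech_cocycles_def kernel_def)
    then show ?thesis
      unfolding local_cohomology_def FactGroup_def RCOSETS_def r_coset_def by auto
  qed
  have "cech_frobenius p R xs (Suc i) c = cochain (Suc i) (N * p) (dk (N * p) w)"
    unfolding c_def cech_frobenius_cochain [OF r] by (rule cochain_cong) (rule w(2))
  then have Fc: "?F (?B #>\<^bsub>?G\<^esub> c) = ?B"
    unfolding c_def using coboundaryI [OF w(1)] by (intro frobenius_coset [OF r]) simp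
  have "cech_frobenius p R xs (Suc i) z = cochain (Suc i) (N * p) (dk (N * p) (\<lambda>_. \<zero>))"
    unfolding z_def cech_frobenius_cochain [OF z]
  proof (rule cochain_cong)
    fix J assume J: "J \<in> cech_index xs (Suc i)"
    have c: "ring_valued i (\<lambda>_. \<zero>)" by (simp add: ring_valued_def)
    show "\<zero> [^] p = dk (N * p) (\<lambda>_. \<zero>) J"
      using ring_valued_dk [OF c] J by (intro theta_eqI) (auto simp: ring_valued_def zero_pow theta_dk [OF c J] theta kd_def)
  qed
  then have Fz: "?F (?B #>\<^bsub>?G\<^esub> z) = ?B"
    unfolding z_def using coboundaryI [of i "\<lambda>_. \<zero>" "N * p"] by (intro frobenius_coset [OF z]) (auto simp: ring_valued_def)
  have "?B #>\<^bsub>?G\<^esub> c = ?B #>\<^bsub>?G\<^esub> z"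
    using inj_onD [OF inj, of "?B #>\<^bsub>?G\<^esub> c" "?B #>\<^bsub>?G\<^esub> z"] Fc Fz coset [OF r cocycle] coset [OF z dz]
    by (simp add: c_def z_def)
  moreover have zB: "z \<in> ?B"
  proof -
    have "z = cochain (Suc i) N (dk N (\<lambda>_. \<zero>))"
      unfolding z_def by (rule cochain_cong) (simp add: dz)
    then show ?thesis using coboundaryI [of i "\<lambda>_. \<zero>" N] by (simp add: ring_valued_def)
  qed
  moreover have "z \<otimes>\<^bsub>?G\<^esub> c = c"
    unfolding z_def c_def cochain_mult [OF z r] by (rule cochain_cong) (use r in \<open>auto simp: ring_valued_def\<close>)
  then have "c \<in> ?B #>\<^bsub>?G\<^esub> c" using zB unfolding r_coset_def by force
  ultimately have "c \<in> ?B" using coset_coboundary by simp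
  then obtain M0 where "\<And>K. K \<ge> M0 \<Longrightarrow> \<exists>v. ring_valued i v \<and> c = cochain (Suc i) K (dk K v)"
    using coboundaryE by blast
  then obtain v where v: "ring_valued i v" "c = cochain (Suc i) (N + M0) (dk (N + M0) v)" by (meson le_add2)
  have "cochain (Suc i) (N + M0) (\<lambda>I. den M0 I \<otimes> r I) = cochain (Suc i) (N + M0) (dk (N + M0) v)"
    using v(2) cochain_raise [OF r, of N M0] by (simp add: c_def)
  then obtain t where t: "\<And>J. J \<in> cech_index xs (Suc i) \<Longrightarrow>
      den t J \<otimes> (den M0 J \<otimes> r J) = den t J \<otimes> dk (N + M0) v J"
    using cochain_eqD [OF ring_valued_den [OF r] ring_valued_dk [OF v(1)]] by meson
  define u where "u I = den t I \<otimes> v I" for I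
  have u: "ring_valued i u" unfolding u_def [abs_def] by (rule ring_valued_den [OF v(1)])
  have "den (t + M0) J \<otimes> r J = dk (N + (t + M0)) u J" if J: "J \<in> cech_index xs (Suc i)" for J
  proof -
    have Js: "J \<subseteq> {..<length xs}" by (rule index_sub [OF J])
    have rJ: "r J \<in> carrier R" using r J by (simp add: ring_valued_def)
    have "den (t + M0) J \<otimes> r J = den t J \<otimes> dk (N + M0) v J"
      using t [OF J] rJ den_carr [OF Js] by (simp add: den_mult [OF Js, symmetric] m_assoc)
    also have "\<dots> = dk (N + (t + M0)) u J"
    proof (rule theta_eqI)
      have "kd (\<lambda>j. x j ^ (N + (t + M0))) (\<lambda>I. \<theta> (u I)) J
          = kd (\<lambda>j. x j ^ t * x j ^ (N + M0)) (\<lambda>I. (\<Prod>j\<in>I. x j ^ t) * \<theta> (v I)) J"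
      proof (rule kd_cong)
        fix j assume j: "j \<in> J"
        have "\<theta> (u (J - {j})) = (\<Prod>j\<in>J - {j}. x j ^ t) * \<theta> (v (J - {j}))"
          unfolding u_def using v(1) index_remove [OF J j] index_sub
          by (auto simp: ring_valued_def theta den_carr theta_den)
        then show "x j ^ (N + (t + M0)) * \<theta> (u (J - {j}))
            = x j ^ t * x j ^ (N + M0) * ((\<Prod>j\<in>J - {j}. x j ^ t) * \<theta> (v (J - {j})))"
          by (simp add: power_add algebra_simps)
      qed
      also have "\<dots> = (\<Prod>j\<in>J. x j ^ t) * kd (\<lambda>j. x j ^ (N + M0)) (\<lambda>I. \<theta> (v I)) J"
        by (rule kd_rescale [OF fin_ix [OF Js]])
      finally show "\<theta> (den t J \<otimes> dk (N + M0) v J) = \<theta> (dk (N + (t + M0)) u J)"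
        using ring_valued_dk [OF v(1)] J den_carr [OF Js]
        by (simp add: theta theta_den [OF Js] theta_dk [OF v(1) J] theta_dk [OF u J] ring_valued_def)
    qed (use ring_valued_dk [OF u] ring_valued_dk [OF v(1)] J den_carr [OF Js] in \<open>auto simp: ring_valued_def\<close>)
    finally show ?thesis .
  qed
  then show ?thesis using u by blast
qed

end

end


section \<open>From the Frobenius map to Koszul complexes\<close>

lemma kd_hom:
  assumes add: "\<And>a b. \<phi> (a + b) = \<phi> a + \<phi> b" and mult: "\<And>a b. \<phi> (a * b) = \<phi> a * \<phi> b" and one: "\<phi> 1 = 1"
  shows "\<phi> (kd x r J) = kd (\<lambda>j. \<phi> (x j)) (\<lambda>I. \<phi> (r I)) J"
proof -
  have zero: "\<phi> 0 = 0" using add [of 0 0] by simp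
  have minus: "\<phi> (- 1) = - 1" using add [of "- 1" 1] one zero by (simp add: eq_neg_iff_add_eq_0)
  have pow: "\<phi> (a ^ n) = \<phi> a ^ n" for a n by (induction n) (auto simp: one mult)
  have sum: "\<phi> (sum f S) = (\<Sum>i\<in>S. \<phi> (f i))" for f and S :: "nat set"
    by (induction S rule: infinite_finite_induct) (auto simp: zero add)
  show ?thesis unfolding kd_def sum mult ksgn_def pow minus ..
qed

context frobenius_subring
begin

lemma frobenius_zero: "(0 :: 'a) ^ p = 0"
  by (rule zero_power [OF p_pos])

lemma frobenius_uminus: "(- f :: 'a) ^ p = - (f ^ p)"
  using frobenius_add [of "- f" f] by (simp add: frobenius_zero eq_neg_iff_add_eq_0)

lemma frobenius_sum: "(sum f S :: 'a) ^ p = (\<Sum>i\<in>S. f i ^ p)"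
  by (induction S rule: infinite_finite_induct) (auto simp: frobenius_zero frobenius_add)

lemma frobenius_ksgn: "(ksgn j J :: 'a) ^ p = ksgn j J"
  using frobenius_uminus [of 1] by (cases "even (card {l \<in> J. l < j})") (auto simp: ksgn_def)

lemma frobenius_kd: "(kd x s J :: 'a) ^ p = kd (\<lambda>j. x j ^ p) (\<lambda>I. s I ^ p) J"
  unfolding kd_def frobenius_sum by (simp add: power_mult_distrib frobenius_ksgn)

lemma koszul_inj_cong:
  assumes "\<And>j. j \<in> T \<Longrightarrow> x j = y j" "koszul_inj x T"
  shows "koszul_inj y T"
proof -
  have kd: "kd (\<lambda>j. y j ^ N) s J = kd (\<lambda>j. x j ^ N) s J" if "J \<subseteq> T" for N s J
    by (rule kd_cong) (use assms that in auto)
  have pr: "(\<Prod>j\<in>J. y j ^ t) = (\<Prod>j\<in>J. x j ^ t)" if "J \<subseteq> T" for t J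
    by (rule prod.cong) (use assms that in auto)
  show ?thesis
    using assms(2) unfolding koszul_inj_def by (simp add: kd pr cong: conj_cong imp_cong)
qed

end

context cech
begin

lemma subring_set_image: "subring_set (\<theta> ` carrier R)"
proof
  show "1 \<in> \<theta> ` carrier R" using theta_one by (metis image_eqI one_closed)
  fix a b assume "a \<in> \<theta> ` carrier R" "b \<in> \<theta> ` carrier R"
  then obtain r s where rs: "r \<in> carrier R" "a = \<theta> r" "s \<in> carrier R" "b = \<theta> s" by auto
  then have "a - b = \<theta> (r \<oplus> \<ominus> s)" "a * b = \<theta> (r \<otimes> s)" by (simp_all add: theta)
  then show "a - b \<in> \<theta> ` carrier R" "a * b \<in> \<theta> ` carrier R" using rs by auto
qed

text \<open>If \<open>s\<close> has entries in \<open>frobenius_preimage\<close>, then the \<open>p\<close>-th power of its coboundary is the coboundary of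
  \<open>s\<^sup>p\<close>, whose entries are in the ring; so the Frobenius map kills the class of the coboundary of \<open>s\<close>.\<close>

theorem koszul_inj_generators:
  assumes fs: "frobenius_subring (\<theta> ` carrier R) p"
    and inj: "\<And>i. inj_on (local_cohomology_frobenius p R xs i) (carrier (local_cohomology R xs i))"
  shows "frobenius_subring.koszul_inj (\<theta> ` carrier R) p x {..<length xs}"
proof -
  let ?A = "\<theta> ` carrier R" and ?n = "length xs"
  interpret F: frobenius_subring ?A p by (fact fs)
  define pre where "pre = inv_into (carrier R) \<theta>"
  have pre: "pre a \<in> carrier R" "\<theta> (pre a) = a" if "a \<in> ?A" for a
    unfolding pre_def using inv_into_into [OF that] f_inv_into_f [OF that] by auto
  have frob: "(a \<oplus> b) [^] p = a [^] p \<oplus> b [^] p" if "a \<in> carrier R" "b \<in> carrier R" for a b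
    by (rule theta_eqI) (use that in \<open>auto simp: theta F.frobenius_add\<close>)
  have xA: "x j \<in> ?A" if "j < ?n" for j using that xs_carr by (auto simp: x_def)
  show ?thesis
    unfolding F.koszul_inj_def
  proof (intro allI impI)
    fix N s
    assume s: "\<forall>I. I \<subseteq> {..<?n} \<longrightarrow> s I \<in> F.frobenius_preimage" and z: "\<forall>J. J \<subseteq> {..<?n} \<longrightarrow> kd (\<lambda>j. x j ^ N) s J \<in> ?A"
    define r where "r J = pre (kd (\<lambda>j. x j ^ N) s J)" for J
    define u where "u I = pre (s I ^ p)" for I
    have r: "r J \<in> carrier R" "\<theta> (r J) = kd (\<lambda>j. x j ^ N) s J" if "J \<subseteq> {..<?n}" for J
    proof -
      have "kd (\<lambda>j. x j ^ N) s J \<in> ?A" using z that by simp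
      then show "r J \<in> carrier R" "\<theta> (r J) = kd (\<lambda>j. x j ^ N) s J" unfolding r_def by (rule pre)+
    qed
    have u: "u I \<in> carrier R" "\<theta> (u I) = s I ^ p" if "I \<subseteq> {..<?n}" for I
    proof -
      have "s I ^ p \<in> ?A" using s that by (simp add: F.frobenius_preimage_def)
      then show "u I \<in> carrier R" "\<theta> (u I) = s I ^ p" unfolding u_def by (rule pre)+
    qed
    have "\<exists>t v. ring_valued i v \<and> (\<forall>J\<in>cech_index xs (Suc i). den t J \<otimes> r J = dk (N + t) v J)" for i
    proof (rule frobenius_inj_koszul [OF F.p_pos frob inj])
      show cr: "ring_valued (Suc i) r" and cu: "ring_valued i u" using r u by (auto simp: ring_valued_def dest: index_sub)
      show "dk N r J = \<zero>" if J: "J \<in> cech_index xs (Suc (Suc i))" for J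
      proof (rule theta_eqI)
        have "kd (\<lambda>j. x j ^ N) (\<lambda>I. \<theta> (r I)) J = kd (\<lambda>j. x j ^ N) (kd (\<lambda>j. x j ^ N) s) J"
          by (rule kd_cong) (use r index_sub [OF index_remove [OF J]] in auto)
        then show "\<theta> (dk N r J) = \<theta> \<zero>"
          by (simp add: theta_dk [OF cr J] kd_kd [OF fin_ix [OF index_sub [OF J]]] theta)
      qed (use ring_valued_dk [OF cr] J in \<open>auto simp: ring_valued_def\<close>)
      show "r J [^] p = dk (N * p) u J" if J: "J \<in> cech_index xs (Suc i)" for J
      proof (rule theta_eqI)
        have "kd (\<lambda>j. x j ^ (N * p)) (\<lambda>I. \<theta> (u I)) J = kd (\<lambda>j. (x j ^ N) ^ p) (\<lambda>I. s I ^ p) J"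
          by (rule kd_cong) (use u index_sub [OF index_remove [OF J]] in \<open>auto simp: power_mult\<close>)
        then show "\<theta> (r J [^] p) = \<theta> (dk (N * p) u J)"
          using r [OF index_sub [OF J]] by (simp add: theta_dk [OF cu J] theta F.frobenius_kd)
      qed (use ring_valued_dk [OF cu] J r [OF index_sub [OF J]] in \<open>auto simp: ring_valued_def\<close>)
    qed
    then obtain t v where v: "\<And>i. ring_valued i (v i)"
      "\<And>i J. J \<in> cech_index xs (Suc i) \<Longrightarrow> den (t i) J \<otimes> r J = dk (N + t i) (v i) J"
      by metis
    \<comment> \<open>One exponent that serves all degrees.\<close>
    define e where "e = Max (t ` {..?n})"
    have e: "t i \<le> e" if "i \<le> ?n" for i using that by (auto simp: e_def)
    define w where "w I = (\<Prod>j\<in>I. x j ^ (e - t (card I))) * \<theta> (v (card I) I)" for I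
    have "w I \<in> ?A" if I: "I \<subseteq> {..<?n}" for I
    proof -
      have "v (card I) I \<in> carrier R" using v(1) [of "card I"] I by (auto simp: ring_valued_def cech_index_def)
      then show ?thesis unfolding w_def using I xA
        by (intro F.mult_mem F.prod_mem F.power_mem) auto
    qed
    moreover have "(\<Prod>j\<in>J. x j ^ e) * kd (\<lambda>j. x j ^ N) s J = kd (\<lambda>j. x j ^ (N + e)) w J"
      if J: "J \<subseteq> {..<?n}" for J
    proof (cases "card J")
      case 0
      then have "J = {}" using fin_ix [OF J] by simp
      then show ?thesis by (simp add: kd_def)
    next
      case (Suc i)
      have Ji: "J \<in> cech_index xs (Suc i)" using J Suc by (simp add: cech_index_def)
      have "card J \<le> ?n" using card_mono [OF _ J] by simp
      then have te: "t i \<le> e" using e Suc by simp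
      have "kd (\<lambda>j. x j ^ (N + e)) w J
          = kd (\<lambda>j. x j ^ (e - t i) * x j ^ (N + t i)) (\<lambda>I. (\<Prod>j\<in>I. x j ^ (e - t i)) * \<theta> (v i I)) J"
      proof (rule kd_cong)
        fix j assume j: "j \<in> J"
        have "card (J - {j}) = i" using Suc j fin_ix [OF J] by simp
        then show "x j ^ (N + e) * w (J - {j})
            = x j ^ (e - t i) * x j ^ (N + t i) * ((\<Prod>j\<in>J - {j}. x j ^ (e - t i)) * \<theta> (v i (J - {j})))"
          using te by (simp add: w_def power_add [symmetric] add.commute)
      qed
      also have "\<dots> = (\<Prod>j\<in>J. x j ^ (e - t i)) * kd (\<lambda>j. x j ^ (N + t i)) (\<lambda>I. \<theta> (v i I)) J"
        by (rule kd_rescale [OF fin_ix [OF J]])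
      also have "kd (\<lambda>j. x j ^ (N + t i)) (\<lambda>I. \<theta> (v i I)) J = \<theta> (den (t i) J \<otimes> r J)"
        unfolding v(2) [OF Ji] by (rule theta_dk [OF v(1) Ji, symmetric])
      also have "\<dots> = (\<Prod>j\<in>J. x j ^ t i) * kd (\<lambda>j. x j ^ N) s J"
        using r [OF J] den_carr [OF J] by (simp add: theta theta_den [OF J])
      also have "(\<Prod>j\<in>J. x j ^ (e - t i)) * ((\<Prod>j\<in>J. x j ^ t i) * kd (\<lambda>j. x j ^ N) s J)
          = (\<Prod>j\<in>J. x j ^ e) * kd (\<lambda>j. x j ^ N) s J"
        using te by (simp add: mult.assoc [symmetric] prod.distrib [symmetric] power_add [symmetric])
      finally show ?thesis ..
    qed
    ultimately show "\<exists>t w. (\<forall>I. I \<subseteq> {..<?n} \<longrightarrow> w I \<in> ?A) \<and>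
        (\<forall>J. J \<subseteq> {..<?n} \<longrightarrow> (\<Prod>j\<in>J. x j ^ t) * kd (\<lambda>j. x j ^ N) s J = kd (\<lambda>j. x j ^ (N + t)) w J)"
      by blast
  qed
qed

lemma in_ideal_genideal:
  assumes "f \<in> Idl\<^bsub>R\<^esub> (set xs)"
  shows "f \<in> carrier R \<and> subring_set.in_ideal (\<theta> ` carrier R) x {..<length xs} (\<theta> f)"
proof -
  let ?A = "\<theta> ` carrier R" and ?T = "{..<length xs}"
  interpret S: subring_set ?A by (rule subring_set_image)
  let ?a = "{f \<in> carrier R. S.in_ideal x ?T (\<theta> f)}"
  have "ideal ?a R"
  proof (rule idealI)
    show "ring R" by (rule ring_axioms)
    show "subgroup ?a (add_monoid R)"
    proof
      fix f g assume fg: "f \<in> ?a" "g \<in> ?a"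
      then show "f \<otimes>\<^bsub>add_monoid R\<^esub> g \<in> ?a" by (auto simp: theta S.in_ideal_add)
    next
      fix f assume f: "f \<in> ?a"
      then have "S.in_ideal x ?T (- 1 * \<theta> f)" by (intro S.in_ideal_mult S.uminus_mem S.one_mem) auto
      then have "\<ominus> f \<in> ?a" using f by (auto simp: theta)
      then show "inv\<^bsub>add_monoid R\<^esub> f \<in> ?a" by (simp add: a_inv_def)
    qed (auto simp: theta S.in_ideal_zero)
    fix a r assume ar: "a \<in> ?a" "r \<in> carrier R"
    then have "S.in_ideal x ?T (\<theta> r * \<theta> a)" by (intro S.in_ideal_mult) auto
    then show "r \<otimes> a \<in> ?a" "a \<otimes> r \<in> ?a" using ar by (auto simp: theta mult.commute)
  qed
  moreover have "set xs \<subseteq> ?a"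
  proof
    fix f assume "f \<in> set xs"
    then obtain j where j: "j < length xs" "f = xs ! j" by (auto simp: in_set_conv_nth)
    then have "S.in_ideal x ?T (\<theta> f)" using S.in_ideal_gen [of ?T j x] by (auto simp: x_def)
    then show "f \<in> ?a" using j xs_carr by auto
  qed
  ultimately have "Idl\<^bsub>R\<^esub> (set xs) \<subseteq> ?a" by (rule genideal_minimal)
  then show ?thesis using assms by auto
qed

end


section \<open>Fans and affine monoids\<close>

lemma of_int_vec_nth [simp]: "of_int_vec a $ i = real_of_int (a $ i)"
  by (simp add: of_int_vec_def)

lemma of_int_vec_add: "of_int_vec (a + b) = of_int_vec a + of_int_vec b"
  by (simp add: vec_eq_iff)

lemma of_int_vec_diff: "of_int_vec (a - b) = of_int_vec a - of_int_vec b"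
  by (simp add: vec_eq_iff)

lemma of_int_vec_zero [simp]: "of_int_vec 0 = 0"
  by (simp add: vec_eq_iff)

lemma of_int_vec_eq_0 [simp]: "of_int_vec a = 0 \<longleftrightarrow> a = 0"
  by (simp add: vec_eq_iff)

lemma of_int_vec_smult: "of_int_vec (int n *s a) = real n *\<^sub>R of_int_vec a"
  by (simp add: vec_eq_iff)

lemma of_int_vec_sum: "of_int_vec (sum f S) = (\<Sum>i\<in>S. of_int_vec (f i))"
  by (induction S rule: infinite_finite_induct) (auto simp: of_int_vec_add)

lemma monoid_closure_smult: "a \<in> monoid_closure S \<Longrightarrow> int n *s a \<in> monoid_closure S"
proof (induction n)
  case 0
  then show ?case using monoid_closure.zero by (simp add: vector_smult_lzero)
next
  case (Suc n)
  then have "int n *s a + a \<in> monoid_closure S" by (intro monoid_closure.add) auto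
  then show ?case by (simp add: vector_sadd_rdistrib add.commute)
qed

lemma cone_face_sub: "cone_face D C \<Longrightarrow> D \<subseteq> C"
  by (auto simp: cone_face_def)

lemma cone_face_addD:
  assumes "cone_face D C" "x \<in> C" "y \<in> C" "x + y \<in> D"
  shows "x \<in> D" "y \<in> D"
proof -
  have "x \<in> D \<and> y \<in> D"
  proof (cases "D = C")
    case False
    then obtain a where a: "\<And>x. x \<in> C \<Longrightarrow> 0 \<le> a \<bullet> x" "D = C \<inter> {x. a \<bullet> x = 0}"
      using assms(1) by (auto simp: cone_face_def)
    have "a \<bullet> x + a \<bullet> y = 0" using assms(4) a(2) by (simp add: inner_add_right)
    then show ?thesis using a(1) [OF assms(2)] a(1) [OF assms(3)] a(2) assms(2,3) by auto
  qed (use assms in auto)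
  then show "x \<in> D" "y \<in> D" by auto
qed

locale fan_complex =
  fixes \<Phi> :: "(real ^ 'd) set set" and M :: "(real ^ 'd) set \<Rightarrow> (int ^ 'd) set"
  assumes fan: "rational_pointed_fan \<Phi>" and complex: "monoidal_complex \<Phi> M"
begin

definition normals :: "(real ^ 'd) set \<Rightarrow> (real ^ 'd) set" where
  "normals C = (SOME H. finite H \<and> C = {x. \<forall>h\<in>H. 0 \<le> h \<bullet> x})"

lemma normals:
  assumes "C \<in> \<Phi>"
  shows "finite (normals C)" "x \<in> C \<longleftrightarrow> (\<forall>h\<in>normals C. 0 \<le> h \<bullet> x)"
proof -
  have "rational_cone C" using assms fan by (simp add: rational_pointed_fan_def)
  then obtain A :: "(int ^ 'd) set" where A: "finite A" "C = (\<Inter>a\<in>A. {x. 0 \<le> of_int_vec a \<bullet> x})"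
    unfolding rational_cone_def by blast
  have "finite (of_int_vec ` A) \<and> C = {x. \<forall>h\<in>of_int_vec ` A. 0 \<le> h \<bullet> x}" using A by auto
  then have *: "finite (normals C) \<and> C = {x. \<forall>h\<in>normals C. 0 \<le> h \<bullet> x}"
    unfolding normals_def by (rule someI)
  then show "finite (normals C)" by blast
  have "C = {x. \<forall>h\<in>normals C. 0 \<le> h \<bullet> x}" using * by blast
  then show "x \<in> C \<longleftrightarrow> (\<forall>h\<in>normals C. 0 \<le> h \<bullet> x)" by blast
qed

lemma cone_zero: "C \<in> \<Phi> \<Longrightarrow> 0 \<in> C"
  by (simp add: normals)

lemma cone_add: "C \<in> \<Phi> \<Longrightarrow> x \<in> C \<Longrightarrow> y \<in> C \<Longrightarrow> x + y \<in> C"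
  by (simp add: normals inner_add_right)

lemma cone_scale: "C \<in> \<Phi> \<Longrightarrow> x \<in> C \<Longrightarrow> 0 \<le> c \<Longrightarrow> c *\<^sub>R x \<in> C"
  by (simp add: normals)

lemma cone_scale_iff:
  assumes "C \<in> \<Phi>" "0 < c"
  shows "c *\<^sub>R x \<in> C \<longleftrightarrow> x \<in> C"
  using cone_scale [OF assms(1), of "c *\<^sub>R x" "1 / c"] cone_scale [OF assms(1), of x c] assms(2) by auto

lemma cone_sum: "C \<in> \<Phi> \<Longrightarrow> (\<And>i. i \<in> S \<Longrightarrow> f i \<in> C) \<Longrightarrow> sum f S \<in> C"
  by (induction S rule: infinite_finite_induct) (auto simp: cone_zero cone_add)

lemma face_in_fan: "C \<in> \<Phi> \<Longrightarrow> cone_face D C \<Longrightarrow> D \<in> \<Phi>"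
  using fan by (auto simp: rational_pointed_fan_def)

lemma inter_face: "C \<in> \<Phi> \<Longrightarrow> D \<in> \<Phi> \<Longrightarrow> cone_face (C \<inter> D) C"
  using fan by (auto simp: rational_pointed_fan_def)

lemma zero_face: "C \<in> \<Phi> \<Longrightarrow> cone_face {0} C"
  using fan by (auto simp: rational_pointed_fan_def pointed_cone_def)

lemma zero_in_fan: "{0} \<in> \<Phi>"
  using fan zero_face face_in_fan by (auto simp: rational_pointed_fan_def)

text \<open>The intersection of the two cones is a face of \<open>C\<close>, and a face contains both summands of each of its
  points.\<close>

lemma cone_addD:
  assumes "C \<in> \<Phi>" "D \<in> \<Phi>" "x \<in> C" "y \<in> C" "x + y \<in> D"
  shows "x \<in> D" "y \<in> D"
  using cone_face_addD [OF inter_face [OF assms(1,2)] assms(3,4)] cone_add [OF assms(1,3,4)] assms(5) by auto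

lemma cone_pointed:
  assumes "C \<in> \<Phi>" "x \<in> C" "- x \<in> C"
  shows "x = 0"
  using cone_addD(1) [OF assms(1) zero_in_fan assms(2,3)] by simp

lemma monoid_sub: "C \<in> \<Phi> \<Longrightarrow> a \<in> M C \<Longrightarrow> of_int_vec a \<in> C"
  using complex by (auto simp: monoidal_complex_def)

lemma monoid_face: "C \<in> \<Phi> \<Longrightarrow> cone_face D C \<Longrightarrow> M D = {a \<in> M C. of_int_vec a \<in> D}"
  using complex unfolding monoidal_complex_def by blast

lemma monoid_gen: "C \<in> \<Phi> \<Longrightarrow> \<exists>S. finite S \<and> M C = monoid_closure S"
  using complex by (auto simp: monoidal_complex_def affine_monoid_def)

lemma monoid_hull: "C \<in> \<Phi> \<Longrightarrow> convex_cone hull (of_int_vec ` M C) = C"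
  using complex by (auto simp: monoidal_complex_def)

definition support :: "(int ^ 'd) set" where
  "support = (\<Union>C\<in>\<Phi>. M C)"

lemma mem_monoid_iff:
  assumes C: "C \<in> \<Phi>"
  shows "a \<in> M C \<longleftrightarrow> a \<in> support \<and> of_int_vec a \<in> C"
proof
  assume "a \<in> support \<and> of_int_vec a \<in> C"
  then obtain D where D: "D \<in> \<Phi>" "a \<in> M D" "of_int_vec a \<in> C" by (auto simp: support_def)
  have "a \<in> M (D \<inter> C)"
    using monoid_face [OF D(1) inter_face [OF D(1) C]] D monoid_sub by auto
  moreover have "M (C \<inter> D) = {a \<in> M C. of_int_vec a \<in> C \<inter> D}"
    by (rule monoid_face [OF C inter_face [OF C D(1)]])
  ultimately show "a \<in> M C" by (simp add: Int_commute)
qed (use C monoid_sub in \<open>auto simp: support_def\<close>)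

lemma monoid_mono:
  assumes "C \<in> \<Phi>" "D \<in> \<Phi>" "C \<subseteq> D" "a \<in> M C"
  shows "a \<in> M D"
  using assms mem_monoid_iff by auto

lemma monoid_zero: "C \<in> \<Phi> \<Longrightarrow> 0 \<in> M C"
  using monoid_gen [of C] monoid_closure.zero by auto

lemma monoid_add: "C \<in> \<Phi> \<Longrightarrow> a \<in> M C \<Longrightarrow> b \<in> M C \<Longrightarrow> a + b \<in> M C"
  using monoid_gen [of C] monoid_closure.add by auto

lemma monoid_smult: "C \<in> \<Phi> \<Longrightarrow> a \<in> M C \<Longrightarrow> int n *s a \<in> M C"
  using monoid_gen [of C] monoid_closure_smult by auto

lemma monoid_sum: "C \<in> \<Phi> \<Longrightarrow> (\<And>i. i \<in> S \<Longrightarrow> f i \<in> M C) \<Longrightarrow> sum f S \<in> M C"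
  by (induction S rule: infinite_finite_induct) (auto simp: monoid_zero monoid_add)

end

text \<open>One indexed system serves all cones, so that the subsets of \<open>T\<close> index the terms of a single Cech
  complex.\<close>

locale generated_fan_complex = fan_complex \<Phi> M
  for \<Phi> :: "(real ^ 'd) set set" and M +
  fixes T :: "nat set" and v :: "nat \<Rightarrow> int ^ 'd"
  assumes finite_T: "finite T" and v_nonzero: "\<And>j. j \<in> T \<Longrightarrow> v j \<noteq> 0"
    and v_support: "\<And>j. j \<in> T \<Longrightarrow> v j \<in> support"
    and v_gen: "\<And>C. C \<in> \<Phi> \<Longrightarrow> \<exists>S. M C = monoid_closure S \<and> S \<subseteq> insert 0 (v ` T)"
begin

abbreviation rv :: "nat \<Rightarrow> real ^ 'd" where
  "rv j \<equiv> of_int_vec (v j)"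

definition gens :: "(real ^ 'd) set \<Rightarrow> nat set" where
  "gens C = {j \<in> T. rv j \<in> C}"

lemma gens_sub: "gens C \<subseteq> T"
  by (auto simp: gens_def)

lemma finite_gens [simp]: "finite (gens C)"
  by (rule finite_subset [OF gens_sub finite_T])

lemma gens_mono: "C \<subseteq> D \<Longrightarrow> gens C \<subseteq> gens D"
  by (auto simp: gens_def)

lemma gens_monoid: "C \<in> \<Phi> \<Longrightarrow> j \<in> gens C \<Longrightarrow> v j \<in> M C"
  using mem_monoid_iff v_support by (auto simp: gens_def)

lemma monoid_eq_sums:
  assumes C: "C \<in> \<Phi>" and a: "a \<in> M C"
  shows "\<exists>n :: nat \<Rightarrow> nat. a = (\<Sum>j\<in>gens C. int (n j) *s v j)"
proof -
  from v_gen [OF C] obtain S where S: "M C = monoid_closure S" "S \<subseteq> insert 0 (v ` T)"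
    by (elim exE conjE)
  have "a \<in> monoid_closure S" using a S by simp
  then show ?thesis
  proof induction
    case zero
    show ?case by (rule exI [of _ "\<lambda>_. 0"]) (simp add: vector_smult_lzero)
  next
    case (base s)
    show ?case
    proof (cases "s = 0")
      case False
      then obtain j where j: "j \<in> T" "s = v j" using base S by auto
      have "s \<in> M C" using base S monoid_closure.base by auto
      then have "j \<in> gens C" using j monoid_sub [OF C] by (auto simp: gens_def)
      then show ?thesis using j
        by (intro exI [of _ "\<lambda>i. if i = j then 1 else 0"])
           (simp add: if_distrib [of "\<lambda>c. int c *s _"] vector_smult_lzero cong: if_cong)
    qed (rule exI [of _ "\<lambda>_. 0"], simp add: vector_smult_lzero)
  next
    case (add s t)
    then obtain m n where "s = (\<Sum>j\<in>gens C. int (m j) *s v j)" "t = (\<Sum>j\<in>gens C. int (n j) *s v j)" by auto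
    then show ?case
      by (intro exI [of _ "\<lambda>j. m j + n j"]) (simp add: vector_sadd_rdistrib sum.distrib)
  qed
qed

lemma cone_eq_sums:
  assumes C: "C \<in> \<Phi>" and x: "x \<in> C"
  shows "\<exists>c. (\<forall>j\<in>gens C. 0 \<le> c j) \<and> x = (\<Sum>j\<in>gens C. c j *\<^sub>R rv j)"
proof -
  let ?K = "{x. \<exists>c. (\<forall>j\<in>gens C. 0 \<le> c j) \<and> x = (\<Sum>j\<in>gens C. c j *\<^sub>R rv j)}"
  have "convex_cone ?K"
    unfolding convex_cone_iff
  proof (intro conjI ballI allI impI)
    have "0 \<in> ?K" by (intro CollectI exI [of _ "\<lambda>_. 0"]) auto
    then show "0 \<in> ?K" .
    fix x y assume "x \<in> ?K" "y \<in> ?K"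
    then obtain c d where "\<forall>j\<in>gens C. 0 \<le> c j" "x = (\<Sum>j\<in>gens C. c j *\<^sub>R rv j)"
      "\<forall>j\<in>gens C. 0 \<le> d j" "y = (\<Sum>j\<in>gens C. d j *\<^sub>R rv j)" by auto
    then show "x + y \<in> ?K"
      by (intro CollectI exI [of _ "\<lambda>j. c j + d j"]) (auto simp: scaleR_add_left sum.distrib)
  next
    fix x and r :: real assume "x \<in> ?K" "0 \<le> r"
    then obtain c where "\<forall>j\<in>gens C. 0 \<le> c j" "x = (\<Sum>j\<in>gens C. c j *\<^sub>R rv j)" by auto
    then show "r *\<^sub>R x \<in> ?K"
      using \<open>0 \<le> r\<close> by (intro CollectI exI [of _ "\<lambda>j. r * c j"]) (auto simp: scaleR_sum_right)
  qed
  moreover have "of_int_vec ` M C \<subseteq> ?K"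
  proof
    fix y assume "y \<in> of_int_vec ` M C"
    then obtain a where a: "a \<in> M C" "y = of_int_vec a" by auto
    then obtain n where "a = (\<Sum>j\<in>gens C. int (n j) *s v j)" using monoid_eq_sums [OF C a(1)] by blast
    then show "y \<in> ?K" using a(2)
      by (intro CollectI exI [of _ "\<lambda>j. real (n j)"]) (simp add: of_int_vec_sum of_int_vec_smult)
  qed
  ultimately have "convex_cone hull (of_int_vec ` M C) \<subseteq> ?K" by (intro hull_minimal)
  then show ?thesis using x monoid_hull [OF C] by auto
qed

text \<open>Simultaneous Dirichlet approximation replaces the real coefficients of \<open>a\<close> by integers, up to
  an error that is an integer vector with entries smaller than \<open>1\<close>, hence zero.\<close>

lemma multiple_in_monoid:
  assumes C: "C \<in> \<Phi>" and a: "of_int_vec a \<in> C"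
  shows "\<exists>q>0. int q *s a \<in> M C"
proof -
  obtain c where c: "\<And>j. j \<in> gens C \<Longrightarrow> 0 \<le> c j" "of_int_vec a = (\<Sum>j\<in>gens C. c j *\<^sub>R rv j)"
    using cone_eq_sums [OF assms] by blast
  define B where "B = (\<Sum>j\<in>gens C. \<Sum>i\<in>UNIV. nat \<bar>v j $ i\<bar>)"
  define n where "n = Suc (Max (insert 0 (gens C)))"
  have n: "j < n" if "j \<in> gens C" for j using that by (auto simp: n_def less_Suc_eq_le)
  obtain q r where q: "0 < q" and r: "\<And>j. j < n \<Longrightarrow> \<bar>of_int q * c j - of_int (r j)\<bar> < 1 / real (Suc B)"
    by (rule Dirichlet_approx_simult [where N = "Suc B" and n = n and \<theta> = c]) auto
  have "real_of_int ((q *s a) $ i - (\<Sum>j\<in>gens C. r j *s v j) $ i) = 0" for i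
  proof -
    have "real_of_int ((q *s a) $ i - (\<Sum>j\<in>gens C. r j *s v j) $ i)
        = of_int q * (of_int_vec a $ i) - (\<Sum>j\<in>gens C. of_int (r j) * of_int (v j $ i))"
      by simp
    also have "of_int_vec a $ i = (\<Sum>j\<in>gens C. c j * of_int (v j $ i))" by (simp add: c(2))
    finally have eq: "real_of_int ((q *s a) $ i - (\<Sum>j\<in>gens C. r j *s v j) $ i)
        = (\<Sum>j\<in>gens C. (of_int q * c j - of_int (r j)) * of_int (v j $ i))"
      by (simp add: sum_distrib_left sum_subtractf algebra_simps)
    have "\<bar>\<Sum>j\<in>gens C. (of_int q * c j - of_int (r j)) * of_int (v j $ i)\<bar>
        \<le> (\<Sum>j\<in>gens C. \<bar>of_int q * c j - of_int (r j)\<bar> * \<bar>of_int (v j $ i)\<bar>)"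
      by (rule order_trans [OF sum_abs]) (simp add: abs_mult)
    also have "\<dots> \<le> (\<Sum>j\<in>gens C. 1 / real (Suc B) * \<bar>of_int (v j $ i)\<bar>)"
      by (intro sum_mono mult_right_mono) (use r n in \<open>auto simp: less_imp_le\<close>)
    also have "\<dots> = (\<Sum>j\<in>gens C. real (nat \<bar>v j $ i\<bar>)) / real (Suc B)"
      by (simp add: sum_divide_distrib)
    also have "\<dots> \<le> real B / real (Suc B)"
    proof (rule divide_right_mono)
      have "(\<Sum>j\<in>gens C. nat \<bar>v j $ i\<bar>) \<le> B"
        unfolding B_def by (intro sum_mono member_le_sum) auto
      then show "(\<Sum>j\<in>gens C. real (nat \<bar>v j $ i\<bar>)) \<le> real B" by (metis of_nat_le_iff of_nat_sum)
    qed simp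
    also have "\<dots> < 1" by simp
    finally have "\<bar>real_of_int ((q *s a) $ i - (\<Sum>j\<in>gens C. r j *s v j) $ i)\<bar> < 1" unfolding eq .
    moreover have "real_of_int z = 0" if "\<bar>real_of_int z\<bar> < 1" for z
    proof -
      have "z < 1" "- 1 < z" using that by linarith+
      then show ?thesis by simp
    qed
    ultimately show ?thesis by blast
  qed
  then have "(q *s a) $ i = (\<Sum>j\<in>gens C. r j *s v j) $ i" for i
    by (metis of_int_eq_0_iff eq_iff_diff_eq_0)
  then have qa: "q *s a = (\<Sum>j\<in>gens C. r j *s v j)" unfolding vec_eq_iff by blast
  have r0: "0 \<le> r j" if j: "j \<in> gens C" for j
  proof -
    have "0 \<le> of_int q * c j" using c(1) [OF j] q by simp
    moreover have "1 / real (Suc B) \<le> 1" by simp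
    ultimately have "- 1 < real_of_int (r j)" using r [OF n [OF j]] by linarith
    then show ?thesis by linarith
  qed
  have "(\<Sum>j\<in>gens C. int (nat (r j)) *s v j) \<in> M C"
    by (intro monoid_sum monoid_smult C gens_monoid)
  then have "int (nat q) *s a \<in> M C" using qa r0 q by simp
  then show ?thesis using q by (intro exI [of _ "nat q"]) auto
qed

text \<open>A large multiple of \<open>g\<close> minus \<open>f\<close> is in the real cone; after multiplication by some \<open>q\<close> it
  is in the monoid, and the \<open>q - 1\<close> superfluous copies of \<open>f\<close> can be added back.\<close>

lemma multiple_dominates:
  assumes C: "C \<in> \<Phi>" and g: "g \<in> M C" and f: "f \<in> M C"
    and face: "\<And>h. h \<in> normals C \<Longrightarrow> h \<bullet> of_int_vec g = 0 \<Longrightarrow> h \<bullet> of_int_vec f = 0"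
  shows "\<exists>n. \<forall>m\<ge>n. int m *s g - f \<in> M C"
proof -
  have "\<exists>n::nat. 0 \<le> h \<bullet> (real n *\<^sub>R of_int_vec g - of_int_vec f) \<and>
      (\<forall>m\<ge>n. 0 \<le> h \<bullet> (real m *\<^sub>R of_int_vec g - of_int_vec f))" if h: "h \<in> normals C" for h
  proof -
    have nn: "0 \<le> h \<bullet> of_int_vec g" using h normals(2) [OF C] monoid_sub [OF C g] by blast
    obtain n :: nat where n: "h \<bullet> of_int_vec f \<le> real n * (h \<bullet> of_int_vec g)"
    proof (cases "h \<bullet> of_int_vec g = 0")
      case True
      then show ?thesis using face [OF h] that [of 0] by simp
    next
      case False
      obtain n :: nat where "h \<bullet> of_int_vec f / (h \<bullet> of_int_vec g) \<le> real n" using real_arch_simple by blast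
      then show ?thesis using False nn that [of n] by (simp add: field_simps)
    qed
    have "0 \<le> h \<bullet> (real m *\<^sub>R of_int_vec g - of_int_vec f)" if "m \<ge> n" for m
    proof -
      have "real n * (h \<bullet> of_int_vec g) \<le> real m * (h \<bullet> of_int_vec g)"
        using that nn by (intro mult_right_mono) auto
      then show ?thesis using n by (simp add: inner_diff_right)
    qed
    then show ?thesis by blast
  qed
  then obtain n where n: "\<And>h m. h \<in> normals C \<Longrightarrow> m \<ge> n h \<Longrightarrow> 0 \<le> h \<bullet> (real m *\<^sub>R of_int_vec g - of_int_vec f)"
    by metis
  define n0 where "n0 = Max (insert 0 (n ` normals C))"
  have "n h \<le> n0" if "h \<in> normals C" for h using that normals(1) [OF C] by (auto simp: n0_def)
  then have "of_int_vec (int n0 *s g - f) \<in> C"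
    using n by (simp add: normals(2) [OF C] of_int_vec_diff of_int_vec_smult)
  then obtain q where q: "q > 0" "int q *s (int n0 *s g - f) \<in> M C" using multiple_in_monoid [OF C] by blast
  have "int m *s g - f \<in> M C" if m: "m \<ge> q * n0" for m
  proof -
    have "int m *s g - f = int q *s (int n0 *s g - f) + int (q - 1) *s f + int (m - q * n0) *s g"
      using q(1) m by (simp add: vec_eq_iff of_nat_diff algebra_simps)
    then show ?thesis using q(2) f g by (simp add: monoid_add monoid_smult C)
  qed
  then show ?thesis by blast
qed

lemma face_span:
  assumes K: "K \<in> \<Phi>" and E: "E \<in> \<Phi>" "E \<subseteq> K" and x: "x \<in> span (rv ` gens E)" "x \<in> K"
  shows "x \<in> E"
proof -
  have "cone_face E K" using inter_face [OF K E(1)] E(2) by (simp add: Int_absorb1)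
  then consider "E = K" | a where "E = K \<inter> {x. a \<bullet> x = 0}" by (auto simp: cone_face_def)
  then show ?thesis
  proof cases
    case 2
    have "a \<bullet> x = 0" by (rule span_orth [OF x(1)]) (auto simp: 2 gens_def)
    then show ?thesis using 2 x by auto
  qed (use x in auto)
qed

lemma cone_presentation_gens:
  assumes K: "K \<in> \<Phi>" and E: "E \<in> \<Phi>" "E \<subseteq> K"
  shows "cone_presentation rv (normals K) (gens E)"
  unfolding cone_presentation_def
proof (intro conjI ballI impI)
  show "finite (gens E)" "finite (normals K)" using normals(1) [OF K] by auto
  show "0 \<le> h \<bullet> rv l" if "h \<in> normals K" "l \<in> gens E" for h l
    using that E(2) normals(2) [OF K] by (auto simp: gens_def)
  show "\<exists>c. (\<forall>l\<in>gens E. 0 \<le> c l) \<and> x = (\<Sum>l\<in>gens E. c l *\<^sub>R rv l)"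
    if "x \<in> span (rv ` gens E)" "\<forall>h\<in>normals K. 0 \<le> h \<bullet> x" for x
  proof -
    have "x \<in> K" using that(2) normals(2) [OF K] by blast
    then show ?thesis by (intro cone_eq_sums [OF E(1)] face_span [OF K E that(1)])
  qed
  show "\<exists>h\<in>normals K. 0 < h \<bullet> rv l" if l: "l \<in> gens E" for l
  proof (rule ccontr)
    assume "\<not> (\<exists>h\<in>normals K. 0 < h \<bullet> rv l)"
    then have "\<forall>h\<in>normals K. 0 \<le> h \<bullet> (- rv l)" by (auto simp: not_less)
    then have "- rv l \<in> K" using normals(2) [OF K] by blast
    moreover have "rv l \<in> K" using l E(2) by (auto simp: gens_def)
    ultimately have "rv l = 0" using cone_pointed [OF K] by blast
    then show False using v_nonzero l by (auto simp: gens_def)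
  qed
qed

end


section \<open>The toric face ring inside a product of Laurent polynomial rings\<close>

lemma poly_mapping_sum_single: "f = (\<Sum>a\<in>Poly_Mapping.keys f. Poly_Mapping.single a (Poly_Mapping.lookup f a))"
proof (rule poly_mapping_eqI)
  fix k
  have "(\<Sum>a\<in>Poly_Mapping.keys f. Poly_Mapping.lookup (Poly_Mapping.single a (Poly_Mapping.lookup f a)) k)
      = (\<Sum>a\<in>Poly_Mapping.keys f. if k = a then Poly_Mapping.lookup f k else 0)"
    by (rule sum.cong) (auto simp: lookup_single when_def)
  then show "Poly_Mapping.lookup f k
      = Poly_Mapping.lookup (\<Sum>a\<in>Poly_Mapping.keys f. Poly_Mapping.single a (Poly_Mapping.lookup f a)) k"
    by (simp add: lookup_sum in_keys_iff)
qed

lemma frobenius_fun_poly_mapping: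
  fixes f g :: "'c \<Rightarrow> ('a::comm_monoid_add \<Rightarrow>\<^sub>0 'k::field)"
  assumes "CHAR('k) = p" "p > 0"
  shows "(f + g) ^ p = f ^ p + g ^ p"
proof -
  have iff: "of_nat n = (0 :: 'c \<Rightarrow> ('a \<Rightarrow>\<^sub>0 'k)) \<longleftrightarrow> p dvd n" for n
  proof -
    have "of_nat n = (0 :: 'c \<Rightarrow> ('a \<Rightarrow>\<^sub>0 'k)) \<longleftrightarrow> (of_nat n :: 'a \<Rightarrow>\<^sub>0 'k) = 0"
      unfolding of_nat_fun zero_fun_def by (auto dest: fun_cong)
    also have "(of_nat n :: 'a \<Rightarrow>\<^sub>0 'k) = Poly_Mapping.single 0 (of_nat n)"
      by (simp only: of_nat_single o_apply)
    also have "Poly_Mapping.single (0 :: 'a) (of_nat n :: 'k) = 0 \<longleftrightarrow> (of_nat n :: 'k) = 0"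
      by (metis lookup_single_eq lookup_zero single_zero)
    also have "\<dots> \<longleftrightarrow> p dvd n" using assms(1) of_nat_eq_0_iff_char_dvd by blast
    finally show ?thesis .
  qed
  have "CHAR('c \<Rightarrow> ('a \<Rightarrow>\<^sub>0 'k)) = p" by (rule CHAR_eqI) (simp_all add: iff)
  then show ?thesis
    using prime_CHAR_semidom [where 'a = 'k] assms by (intro freshmans_dream) simp_all
qed

context fan_complex
begin

definition restrict_cone :: "(real ^ 'd) set \<Rightarrow> (int ^ 'd \<Rightarrow>\<^sub>0 'k::field) \<Rightarrow> (int ^ 'd \<Rightarrow>\<^sub>0 'k)" where
  "restrict_cone C f = (\<Sum>a\<in>{a \<in> Poly_Mapping.keys f. of_int_vec a \<in> C}. Poly_Mapping.single a (Poly_Mapping.lookup f a))"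

definition some_cone :: "(real ^ 'd) set \<Rightarrow> (real ^ 'd) set" where
  "some_cone C = (if C \<in> \<Phi> then C else {0})"

text \<open>The components are the images of \<open>f\<close> in the monoid rings of the cones. \<open>Theta\<close> is defined for all
  lattice points, so that it also makes sense for monomials outside \<open>R\<close>. The value at sets that are
  not cones of the fan is chosen such that \<open>Theta\<close> preserves the unit.\<close>

definition Theta :: "(int ^ 'd \<Rightarrow>\<^sub>0 'k::field) \<Rightarrow> (real ^ 'd) set \<Rightarrow> (int ^ 'd \<Rightarrow>\<^sub>0 'k)" where
  "Theta f C = restrict_cone (some_cone C) f"

lemma some_cone: "some_cone C \<in> \<Phi>"
  using zero_in_fan by (simp add: some_cone_def)

lemma lookup_restrict_cone:
  "Poly_Mapping.lookup (restrict_cone C f) a = (if of_int_vec a \<in> C then Poly_Mapping.lookup f a else 0)"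
proof -
  have "Poly_Mapping.lookup (restrict_cone C f) a
      = (\<Sum>b\<in>{b \<in> Poly_Mapping.keys f. of_int_vec b \<in> C}. if a = b then Poly_Mapping.lookup f a else 0)"
    unfolding restrict_cone_def lookup_sum by (rule sum.cong) (auto simp: lookup_single when_def)
  then show ?thesis by (simp add: in_keys_iff)
qed

lemma lookup_Theta: "C \<in> \<Phi> \<Longrightarrow>
  Poly_Mapping.lookup (Theta f C) a = (if of_int_vec a \<in> C then Poly_Mapping.lookup f a else 0)"
  by (simp add: Theta_def some_cone_def lookup_restrict_cone)

lemma Theta_add: "Theta (f + g) = Theta f + Theta g"
  by (intro ext poly_mapping_eqI) (simp add: Theta_def lookup_restrict_cone lookup_add)

lemma Theta_zero: "Theta 0 = 0"
  by (intro ext poly_mapping_eqI) (simp add: Theta_def lookup_restrict_cone)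

lemma Theta_sum: "Theta (sum f S) = (\<Sum>i\<in>S. Theta (f i))"
  by (induction S rule: infinite_finite_induct) (auto simp: Theta_zero Theta_add)

lemma restrict_cone_single:
  "restrict_cone C (Poly_Mapping.single a c) = (if of_int_vec a \<in> C then Poly_Mapping.single a c else 0)"
  by (rule poly_mapping_eqI) (auto simp: lookup_restrict_cone lookup_single when_def)

lemma Theta_single: "C \<in> \<Phi> \<Longrightarrow>
  Theta (Poly_Mapping.single a c) C = (if of_int_vec a \<in> C then Poly_Mapping.single a c else 0)"
  by (simp add: Theta_def some_cone_def restrict_cone_single)

lemma Theta_one: "Theta 1 = 1"
proof
  fix C
  have "restrict_cone (some_cone C) (Poly_Mapping.single 0 1) = Poly_Mapping.single 0 1"
    unfolding restrict_cone_single by (simp add: cone_zero [OF some_cone])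
  then show "Theta 1 C = 1 C" by (simp add: Theta_def)
qed

text \<open>A cone of the fan contains \<open>a + b\<close> only if it contains \<open>a\<close> and \<open>b\<close>.\<close>

lemma Theta_single_mult:
  assumes "C \<in> \<Phi>" "of_int_vec a \<in> C" "of_int_vec b \<in> C"
  shows "Theta (Poly_Mapping.single a c) * Theta (Poly_Mapping.single b d) = Theta (Poly_Mapping.single (a + b) (c * d))"
proof
  fix D
  have "of_int_vec (a + b) \<in> some_cone D \<longleftrightarrow> of_int_vec a \<in> some_cone D \<and> of_int_vec b \<in> some_cone D"
    using cone_add [OF some_cone] cone_addD [OF assms(1) some_cone assms(2,3)] by (auto simp: of_int_vec_add)
  then show "(Theta (Poly_Mapping.single a c) * Theta (Poly_Mapping.single b d)) D
      = Theta (Poly_Mapping.single (a + b) (c * d)) D"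
    by (auto simp: Theta_def restrict_cone_single mult_single)
qed

lemma Theta_single_mult_zero:
  assumes "\<not> (\<exists>C\<in>\<Phi>. of_int_vec a \<in> C \<and> of_int_vec b \<in> C)"
  shows "Theta (Poly_Mapping.single a c) * Theta (Poly_Mapping.single b d) = 0"
  using assms some_cone by (intro ext) (auto simp: Theta_def restrict_cone_single)

lemma Theta_single_power:
  assumes "C \<in> \<Phi>" "of_int_vec a \<in> C"
  shows "Theta (Poly_Mapping.single a c) ^ n = Theta (Poly_Mapping.single (int n *s a) (c ^ n))"
proof (induction n)
  case 0
  then show ?case by (simp add: Theta_one vector_smult_lzero)
next
  case (Suc n)
  have "of_int_vec (int n *s a) \<in> C" using cone_scale [OF assms] by (simp add: of_int_vec_smult)
  then show ?case
    using Theta_single_mult [OF assms(1,2), of "int n *s a" c "c ^ n"] Suc by (simp add: vector_sadd_rdistrib)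
qed

abbreviation TR :: "(int ^ 'd \<Rightarrow>\<^sub>0 'k::field) ring" where
  "TR \<equiv> toric_face_ring \<Phi> M"

lemma TR_carrier: "f \<in> carrier TR \<longleftrightarrow> Poly_Mapping.keys f \<subseteq> support"
  by (simp add: toric_face_ring_def support_def)

lemma common_monoid_iff:
  assumes "a \<in> support" "b \<in> support"
  shows "(\<exists>C\<in>\<Phi>. a \<in> M C \<and> b \<in> M C) \<longleftrightarrow> (\<exists>C\<in>\<Phi>. of_int_vec a \<in> C \<and> of_int_vec b \<in> C)"
  using mem_monoid_iff assms by auto

lemma TR_mult: "f \<otimes>\<^bsub>TR\<^esub> g = (\<Sum>a\<in>Poly_Mapping.keys f. \<Sum>b\<in>Poly_Mapping.keys g.
    if \<exists>C\<in>\<Phi>. a \<in> M C \<and> b \<in> M C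
    then Poly_Mapping.single (a + b) (Poly_Mapping.lookup f a * Poly_Mapping.lookup g b) else 0)"
  by (simp add: toric_face_ring_def)

lemma TR_mult_closed:
  assumes "f \<in> carrier TR" "g \<in> carrier TR"
  shows "f \<otimes>\<^bsub>TR\<^esub> g \<in> carrier TR"
proof -
  have "Poly_Mapping.keys (if \<exists>C\<in>\<Phi>. a \<in> M C \<and> b \<in> M C
      then Poly_Mapping.single (a + b) (Poly_Mapping.lookup f a * Poly_Mapping.lookup g b) else 0) \<subseteq> support" for a b
    using monoid_add by (auto simp: support_def)
  then show ?thesis
    unfolding TR_carrier TR_mult
    by (intro order_trans [OF keys_sum] UN_least)
qed

lemma Theta_mult:
  assumes f: "f \<in> carrier TR" and g: "g \<in> carrier TR"
  shows "Theta (f \<otimes>\<^bsub>TR\<^esub> g) = Theta f * Theta g"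
proof -
  let ?f = "\<lambda>a. Poly_Mapping.single a (Poly_Mapping.lookup f a)" and ?g = "\<lambda>b. Poly_Mapping.single b (Poly_Mapping.lookup g b)"
  have "Theta (if \<exists>C\<in>\<Phi>. a \<in> M C \<and> b \<in> M C
      then Poly_Mapping.single (a + b) (Poly_Mapping.lookup f a * Poly_Mapping.lookup g b) else 0)
      = Theta (?f a) * Theta (?g b)" if "a \<in> Poly_Mapping.keys f" "b \<in> Poly_Mapping.keys g" for a b
  proof -
    have "a \<in> support" "b \<in> support" using that f g by (auto simp: TR_carrier)
    note iff = common_monoid_iff [OF this]
    show ?thesis
    proof (cases "\<exists>C\<in>\<Phi>. of_int_vec a \<in> C \<and> of_int_vec b \<in> C")
      case True
      then obtain C where C: "C \<in> \<Phi>" "of_int_vec a \<in> C" "of_int_vec b \<in> C" by blast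
      show ?thesis unfolding iff if_P [OF True] by (rule Theta_single_mult [OF C, symmetric])
    next
      case False
      show ?thesis unfolding iff if_not_P [OF False] Theta_single_mult_zero [OF False] by (rule Theta_zero)
    qed
  qed
  then have "Theta (f \<otimes>\<^bsub>TR\<^esub> g)
      = (\<Sum>a\<in>Poly_Mapping.keys f. \<Sum>b\<in>Poly_Mapping.keys g. Theta (?f a) * Theta (?g b))"
    unfolding TR_mult Theta_sum by (intro sum.cong refl) auto
  also have "\<dots> = Theta (\<Sum>a\<in>Poly_Mapping.keys f. ?f a) * Theta (\<Sum>b\<in>Poly_Mapping.keys g. ?g b)"
    by (simp add: Theta_sum sum_product)
  finally show ?thesis using poly_mapping_sum_single [of f] poly_mapping_sum_single [of g] by simp
qed

lemma Theta_inj: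
  assumes f: "f \<in> carrier TR" and g: "g \<in> carrier TR" and eq: "Theta f = Theta g"
  shows "f = g"
proof (rule poly_mapping_eqI)
  fix a
  show "Poly_Mapping.lookup f a = Poly_Mapping.lookup g a"
  proof (cases "a \<in> support")
    case True
    then obtain C where C: "C \<in> \<Phi>" "of_int_vec a \<in> C" using monoid_sub by (auto simp: support_def)
    then show ?thesis using lookup_Theta [OF C(1), of f a] lookup_Theta [OF C(1), of g a] eq by simp
  next
    case False
    then have "a \<notin> Poly_Mapping.keys f" "a \<notin> Poly_Mapping.keys g" using f g by (auto simp: TR_carrier)
    then show ?thesis by (simp add: in_keys_iff)
  qed
qed

lemma zero_support: "0 \<in> support"
  using zero_in_fan monoid_zero by (auto simp: support_def)

lemma embedded_ring_TR: "embedded_ring (TR :: (int ^ 'd \<Rightarrow>\<^sub>0 'k::field) ring) Theta"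
proof -
  let ?R = "TR :: (int ^ 'd \<Rightarrow>\<^sub>0 'k) ring"
  have add: "f \<oplus>\<^bsub>?R\<^esub> g = f + g" and zero: "\<zero>\<^bsub>?R\<^esub> = 0" and one: "\<one>\<^bsub>?R\<^esub> = 1" for f g
    by (simp_all add: toric_face_ring_def)
  have closed: "f + g \<in> carrier ?R" if "f \<in> carrier ?R" "g \<in> carrier ?R" for f g
    using that keys_add [of f g] by (auto simp: TR_carrier)
  have zero_in: "0 \<in> carrier ?R" by (simp add: TR_carrier)
  have one_in: "\<one>\<^bsub>?R\<^esub> \<in> carrier ?R" using zero_support by (simp add: one TR_carrier)
  have "cring ?R"
  proof (rule cringI)
    show "abelian_group ?R"
    proof (rule abelian_groupI)
      fix f assume f: "f \<in> carrier ?R"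
      show "\<exists>g\<in>carrier ?R. g \<oplus>\<^bsub>?R\<^esub> f = \<zero>\<^bsub>?R\<^esub>"
        using f by (intro bexI [of _ "- f"]) (auto simp: add zero TR_carrier)
    qed (simp_all add: add zero closed zero_in add_ac)
    show "comm_monoid ?R"
    proof (rule comm_monoidI)
      fix f g h assume fgh: "f \<in> carrier ?R" "g \<in> carrier ?R" "h \<in> carrier ?R"
      show "f \<otimes>\<^bsub>?R\<^esub> g \<otimes>\<^bsub>?R\<^esub> h = f \<otimes>\<^bsub>?R\<^esub> (g \<otimes>\<^bsub>?R\<^esub> h)"
        by (rule Theta_inj) (use fgh in \<open>simp_all add: TR_mult_closed Theta_mult mult.assoc\<close>)
    next
      fix f g assume fg: "f \<in> carrier ?R" "g \<in> carrier ?R"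
      show "f \<otimes>\<^bsub>?R\<^esub> g = g \<otimes>\<^bsub>?R\<^esub> f"
        by (rule Theta_inj) (use fg in \<open>simp_all add: TR_mult_closed Theta_mult mult.commute\<close>)
    next
      fix f assume f: "f \<in> carrier ?R"
      have "Theta (\<one>\<^bsub>?R\<^esub> \<otimes>\<^bsub>?R\<^esub> f) = Theta \<one>\<^bsub>?R\<^esub> * Theta f" by (rule Theta_mult [OF one_in f])
      then show "\<one>\<^bsub>?R\<^esub> \<otimes>\<^bsub>?R\<^esub> f = f"
        by (intro Theta_inj TR_mult_closed one_in f) (simp add: one Theta_one)
    qed (rule TR_mult_closed one_in; assumption)+
    fix f g h assume fgh: "f \<in> carrier ?R" "g \<in> carrier ?R" "h \<in> carrier ?R"
    show "(f \<oplus>\<^bsub>?R\<^esub> g) \<otimes>\<^bsub>?R\<^esub> h = f \<otimes>\<^bsub>?R\<^esub> h \<oplus>\<^bsub>?R\<^esub> g \<otimes>\<^bsub>?R\<^esub> h"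
      unfolding add
      by (rule Theta_inj)
         (use fgh in \<open>simp_all add: TR_mult_closed closed Theta_mult Theta_add distrib_right\<close>)
  qed
  then show ?thesis
    by (intro embedded_ring.intro embedded_ring_axioms.intro inj_onI)
       (auto simp: add one Theta_add Theta_mult Theta_one intro: Theta_inj)
qed

lemma frobenius_subring_TR:
  assumes "CHAR('k::field) = p" "p > 0"
  shows "frobenius_subring (Theta ` carrier (TR :: (int ^ 'd \<Rightarrow>\<^sub>0 'k) ring)) p"
proof -
  interpret E: embedded_ring "TR :: (int ^ 'd \<Rightarrow>\<^sub>0 'k) ring" Theta by (rule embedded_ring_TR)
  interpret C: cech "TR :: (int ^ 'd \<Rightarrow>\<^sub>0 'k) ring" Theta "[]" by unfold_locales simp
  show ?thesis
    by (intro frobenius_subring.intro frobenius_subring_axioms.intro C.subring_set_image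
        frobenius_fun_poly_mapping assms)
qed

end


section \<open>Lattice points outside the support\<close>

context generated_fan_complex
begin

definition two_three_support :: "(int ^ 'd) set" where
  "two_three_support = {b. int 2 *s b \<in> support \<and> int 3 *s b \<in> support}"

lemma two_three_support_multiple:
  assumes b: "b \<in> two_three_support" and K: "K \<in> \<Phi>" "of_int_vec b \<in> K" and n: "n \<ge> 2"
  shows "int n *s b \<in> M K"
proof -
  have 23: "int 2 *s b \<in> M K" "int 3 *s b \<in> M K"
    using b K cone_scale [OF K, of "real 2"] cone_scale [OF K, of "real 3"]
      of_int_vec_smult [of 2 b] of_int_vec_smult [of 3 b]
    by (auto simp: two_three_support_def mem_monoid_iff)
  have "\<exists>i j. n = 2 * i + 3 * j" using n by presburger
  then obtain i j where "n = 2 * i + 3 * j" by blast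
  then have eq: "int n *s b = int i *s (int 2 *s b) + int j *s (int 3 *s b)"
    by (simp add: vec_eq_iff algebra_simps)
  show ?thesis unfolding eq
    by (rule monoid_add [OF K(1) monoid_smult [OF K(1) 23(1)] monoid_smult [OF K(1) 23(2)]])
qed

text \<open>Modulo the toric face ring, \<open>X\<^sup>b\<close> is not annihilated by any monomial with exponent in \<open>M E\<close>.\<close>

definition extension_at :: "int ^ 'd \<Rightarrow> (real ^ 'd) set \<Rightarrow> bool" where
  "extension_at b E \<longleftrightarrow> b \<in> two_three_support \<and> E \<in> \<Phi> \<and> (\<exists>K\<in>\<Phi>. of_int_vec b \<in> K \<and> E \<subseteq> K) \<and>
     (\<forall>e\<in>M E. b + e \<notin> support)"

text \<open>Let \<open>F\<close> be the smallest face of \<open>C\<close> that contains \<open>E\<close> and \<open>v j\<close>. As \<open>E\<close> is maximal, \<open>b + f\<close> is in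
  the support for some \<open>f \<in> M F\<close>, and multiples of a point in the relative interior of \<open>F\<close> dominate \<open>f\<close>.
  So \<open>X\<^sup>b\<close> belongs to the localization of the ring at \<open>F\<close>.\<close>

lemma larger_face:
  assumes b: "extension_at b E"
    and max: "\<And>b' F. extension_at b' F \<Longrightarrow> card (gens F) \<le> card (gens E)"
    and C: "C \<in> \<Phi>" "of_int_vec b \<in> C" "E \<subseteq> C" and j: "j \<in> gens C" "j \<notin> gens E"
  shows "\<exists>n. \<forall>m\<ge>n. b + int m *s ((\<Sum>l\<in>gens E. v l) + v j) \<in> M C"
proof -
  define g where "g = (\<Sum>l\<in>gens E. v l) + v j"
  have E: "E \<in> \<Phi>" "b \<in> two_three_support" using b by (auto simp: extension_at_def)
  have gE: "(\<Sum>l\<in>gens E. v l) \<in> M C"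
    by (intro monoid_sum C(1) gens_monoid) (use gens_mono [OF C(3)] in auto)
  have gC: "g \<in> M C" unfolding g_def by (intro monoid_add gE gens_monoid C(1) j)
  have nn: "0 \<le> h \<bullet> rv l" if "h \<in> normals C" "l \<in> gens C" for h l
    using that normals(2) [OF C(1)] by (auto simp: gens_def)
  \<comment> \<open>The smallest face of \<open>C\<close> that contains \<open>E\<close> and \<open>v j\<close>.\<close>
  define H where "H = {h \<in> normals C. h \<bullet> of_int_vec g = 0}"
  define F where "F = {x \<in> C. \<forall>h\<in>H. h \<bullet> x = 0}"
  have finH: "finite H" using normals(1) [OF C(1)] by (simp add: H_def)
  have Hnn: "0 \<le> h \<bullet> x" if "h \<in> H" "x \<in> C" for h x
    using that normals(2) [OF C(1)] by (auto simp: H_def)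
  have sumH: "sum (\<lambda>h. h) H \<bullet> x = 0 \<longleftrightarrow> (\<forall>h\<in>H. h \<bullet> x = 0)" if "x \<in> C" for x
    unfolding inner_sum_left using finH Hnn that by (intro sum_nonneg_eq_0_iff) auto
  have face: "cone_face F C"
  proof (cases "sum (\<lambda>h. h) H = 0")
    case True
    then have "F = C" using sumH by (auto simp: F_def)
    then show ?thesis by (simp add: cone_face_def)
  next
    case False
    moreover have "\<forall>x\<in>C. 0 \<le> sum (\<lambda>h. h) H \<bullet> x"
      unfolding inner_sum_left using Hnn by (auto intro: sum_nonneg)
    moreover have "F = C \<inter> {x. sum (\<lambda>h. h) H \<bullet> x = 0}" using sumH by (auto simp: F_def)
    ultimately show ?thesis by (auto simp: cone_face_def)
  qed
  have F: "F \<in> \<Phi>" "F \<subseteq> C" using face_in_fan [OF C(1) face] cone_face_sub [OF face] by auto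
  have H0: "h \<bullet> rv l = 0" if h: "h \<in> H" and l: "l \<in> insert j (gens E)" for h l
  proof -
    have hC: "h \<in> normals C" using h by (simp add: H_def)
    have nnE: "0 \<le> h \<bullet> rv l" if "l \<in> gens E" for l using nn [OF hC] gens_mono [OF C(3)] that by auto
    have "(\<Sum>l\<in>gens E. h \<bullet> rv l) + h \<bullet> rv j = 0"
      using h by (simp add: H_def g_def of_int_vec_add of_int_vec_sum inner_add_right inner_sum_right)
    moreover have "0 \<le> (\<Sum>l\<in>gens E. h \<bullet> rv l)" by (intro sum_nonneg nnE)
    ultimately have "(\<Sum>l\<in>gens E. h \<bullet> rv l) = 0" "h \<bullet> rv j = 0" using nn [OF hC j(1)] by auto
    moreover from this(1) have "\<forall>l\<in>gens E. h \<bullet> rv l = 0"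
      using nnE by (subst (asm) sum_nonneg_eq_0_iff) auto
    ultimately show ?thesis using l by auto
  qed
  have EF: "E \<subseteq> F"
  proof
    fix x assume x: "x \<in> E"
    then obtain c where c: "x = (\<Sum>l\<in>gens E. c l *\<^sub>R rv l)" using cone_eq_sums [OF E(1)] by blast
    have "h \<bullet> x = 0" if "h \<in> H" for h using H0 [OF that] by (simp add: c inner_sum_right)
    then show "x \<in> F" using x C(3) by (auto simp: F_def)
  qed
  have "j \<in> gens F" using j H0 by (auto simp: gens_def F_def)
  then have "gens E \<subset> gens F" using gens_mono [OF EF] j(2) by auto
  then have "card (gens E) < card (gens F)" by (intro psubset_card_mono) auto
  then have "\<not> extension_at b F" using max by (meson not_le)
  then obtain f where f: "f \<in> M F" "b + f \<in> support"
    using E F C by (auto simp: extension_at_def)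
  have fC: "f \<in> M C" by (rule monoid_mono [OF F(1) C(1) F(2) f(1)])
  have "\<exists>n. \<forall>m\<ge>n. int m *s g - f \<in> M C"
  proof (rule multiple_dominates [OF C(1) gC fC])
    fix h assume "h \<in> normals C" "h \<bullet> of_int_vec g = 0"
    then show "h \<bullet> of_int_vec f = 0" using monoid_sub [OF F(1) f(1)] by (auto simp: F_def H_def)
  qed
  then obtain n where n: "\<And>m. m \<ge> n \<Longrightarrow> int m *s g - f \<in> M C" by blast
  have "b + f \<in> M C"
    using f(2) cone_add [OF C(1,2) monoid_sub [OF C(1) fC]] by (simp add: mem_monoid_iff [OF C(1)] of_int_vec_add)
  then have "b + int m *s g \<in> M C" if "m \<ge> n" for m
    using monoid_add [OF C(1) _ n [OF that], of "b + f"] by simp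
  then show ?thesis unfolding g_def by blast
qed

end


section \<open>The obstruction in local cohomology\<close>

context generated_fan_complex
begin

lemma ksgn_Theta_single:
  "ksgn j J * Theta (Poly_Mapping.single a c) = Theta (Poly_Mapping.single a (ksgn j J * c :: 'k::field))"
proof -
  have "Theta (Poly_Mapping.single a (- c)) = - Theta (Poly_Mapping.single a c)"
    using Theta_add [of "Poly_Mapping.single a (- c)" "Poly_Mapping.single a c"]
    by (simp add: single_add [symmetric] Theta_zero eq_neg_iff_add_eq_0)
  then show ?thesis by (cases "even (card {l \<in> J. l < j})") (auto simp: ksgn_def)
qed

lemma single_sum: "Poly_Mapping.single a (sum f S) = (\<Sum>i\<in>S. Poly_Mapping.single a (f i))"
  by (induction S rule: infinite_finite_induct) (auto simp: single_add)

lemma lookup_single_times: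
  fixes f :: "int ^ 'd \<Rightarrow>\<^sub>0 'k::field"
  shows "Poly_Mapping.lookup (Poly_Mapping.single a c * f) (a + g) = c * Poly_Mapping.lookup f g"
proof -
  have "Poly_Mapping.lookup (Poly_Mapping.single a c * (\<Sum>b\<in>Poly_Mapping.keys f. Poly_Mapping.single b (Poly_Mapping.lookup f b))) (a + g)
      = (\<Sum>b\<in>Poly_Mapping.keys f. if g = b then c * Poly_Mapping.lookup f g else 0)"
    unfolding sum_distrib_left lookup_sum
    by (rule sum.cong) (auto simp: mult_single lookup_single when_def)
  then show ?thesis by (simp add: poly_mapping_sum_single [of f, symmetric] in_keys_iff)
qed

text \<open>The cochain \<open>s\<close> has the entries \<open>\<sigma> I\<close> in degree \<open>b - \<kappa> c0\<close>, multiplied by the common denominator of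
  Cech cochains, where \<open>\<sigma>\<close> is a nontrivial cocycle on the sets of generators whose smallest face is \<open>E\<close>.
  Its coboundary has entries in the ring: on sets of generators of \<open>E\<close> it vanishes, and on other sets
  \<open>larger_face\<close> applies. If \<open>w\<close> has the same coboundary over the ring, its coefficients \<open>\<omega>\<close> in degree
  \<open>b - \<kappa> c0\<close> over \<open>K\<close> vanish on sets of generators of \<open>E\<close>. Then \<open>\<sigma> - \<omega>\<close> is a cocycle on an acyclic family
  and restricts to \<open>\<sigma>\<close>, so \<open>\<sigma>\<close> is trivial.\<close>

theorem no_extension:
  fixes A :: "((real ^ 'd) set \<Rightarrow> (int ^ 'd \<Rightarrow>\<^sub>0 'k::field)) set"
  defines "A \<equiv> Theta ` carrier TR"
  assumes fs: "frobenius_subring A p" and p: "p \<ge> 2"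
    and inj: "frobenius_subring.koszul_inj A p (\<lambda>j. Theta (Poly_Mapping.single (v j) 1)) T"
    and b: "extension_at b E"
    and max: "\<And>b' F. extension_at b' F \<Longrightarrow> card (gens F) \<le> card (gens E)"
  shows False
proof -
  interpret F: frobenius_subring A p by (fact fs)
  let ?X = "\<lambda>a c. Theta (Poly_Mapping.single a (c :: 'k))"
  let ?y = "\<lambda>j. ?X (v j) 1"
  obtain K where K: "K \<in> \<Phi>" "of_int_vec b \<in> K" "E \<subseteq> K" using b by (auto simp: extension_at_def)
  have E: "E \<in> \<Phi>" and bh: "b \<in> two_three_support" and bE: "\<And>e. e \<in> M E \<Longrightarrow> b + e \<notin> support"
    using b by (auto simp: extension_at_def)
  have gEK: "gens E \<subseteq> gens K" by (rule gens_mono [OF K(3)])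
  have gKT: "gens K \<subseteq> T" by (rule gens_sub)
  have EK: "a \<in> M K" if "a \<in> M E" for a by (rule monoid_mono [OF E K(1,3) that])
  have XA: "?X a c \<in> A" if "a \<in> support" for a c
    unfolding A_def by (rule imageI) (use that in \<open>auto simp: TR_carrier\<close>)

  define H where "H = normals K"
  define c0 where "c0 = (\<Sum>l\<in>gens E. v l)"
  have c0: "c0 \<in> M E" unfolding c0_def by (intro monoid_sum E gens_monoid)
  have h_nn: "0 \<le> h \<bullet> rv l" if "h \<in> H" "l \<in> gens K" for h l
    using that normals(2) [OF K(1)] by (auto simp: H_def gens_def)
  have h_c0: "h \<bullet> of_int_vec c0 = (\<Sum>l\<in>gens E. h \<bullet> rv l)" for h
    by (simp add: c0_def of_int_vec_sum inner_sum_right)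
  have h_c0_pos: "0 < h \<bullet> of_int_vec c0 \<longleftrightarrow> (\<exists>l\<in>gens E. 0 < h \<bullet> rv l)" if "h \<in> H" for h
  proof
    assume "\<exists>l\<in>gens E. 0 < h \<bullet> rv l"
    then obtain l where "l \<in> gens E" "0 < h \<bullet> rv l" by blast
    then show "0 < h \<bullet> of_int_vec c0"
      unfolding h_c0 by (intro sum_pos2 [where i = l]) (use h_nn [OF that] gEK in auto)
  next
    assume "0 < h \<bullet> of_int_vec c0"
    then show "\<exists>l\<in>gens E. 0 < h \<bullet> rv l"
      unfolding h_c0 by (metis not_le sum_nonpos)
  qed
  define q where "q = - of_int_vec c0"
  have q_span: "q \<in> span (rv ` gens E)"
  proof -
    have "of_int_vec c0 \<in> span (rv ` gens E)"
      unfolding c0_def of_int_vec_sum by (rule span_sum, rule span_base) auto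
    then show ?thesis unfolding q_def by (rule span_neg)
  qed
  define \<E> where "\<E> = hit_family rv H (gens E) q"
  define \<K> where "\<K> = hit_family rv H (gens K) q"
  have mem_\<E>: "I \<in> \<E> \<longleftrightarrow> I \<subseteq> gens E \<and> I \<in> \<K>" for I
    using gEK by (auto simp: \<E>_def \<K>_def hit_family_def)

  \<comment> \<open>\<open>b\<close> does not lie in \<open>E\<close>, so \<open>E\<close> is a proper face of \<open>K\<close>.\<close>
  have E_ne_K: "E \<noteq> K"
  proof
    assume "E = K"
    then have "int 2 *s b \<in> M E" "int 3 *s b \<in> support"
      using two_three_support_multiple [OF bh K(1,2), of 2] two_three_support_multiple [OF bh K(1,2), of 3] mem_monoid_iff [OF K(1)]
      by auto
    moreover have "b + int 2 *s b = int 3 *s b" by (simp add: vec_eq_iff)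
    ultimately show False using bE by metis
  qed
  have nE: "\<not> acyclic_on TYPE('k) \<E>"
    unfolding \<E>_def acyclic_on_hit_family [OF cone_presentation_gens [OF K(1) E K(3), folded H_def] q_span]
    using h_c0_pos by (auto simp: q_def)
  have aK: "acyclic_on TYPE('k) \<K>"
  proof -
    have qK: "q \<in> span (rv ` gens K)" using q_span span_mono [OF image_mono [OF gEK]] by blast
    have cf: "cone_face E K" using inter_face [OF K(1) E] K(3) by (simp add: Int_absorb1)
    then obtain a where a: "\<And>x. x \<in> K \<Longrightarrow> 0 \<le> a \<bullet> x" "E = K \<inter> {x. a \<bullet> x = 0}"
      using E_ne_K by (auto simp: cone_face_def)
    have "\<not> gens K \<subseteq> gens E"
    proof
      assume sub: "gens K \<subseteq> gens E"
      have "x \<in> E" if x: "x \<in> K" for x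
      proof -
        obtain c where c: "\<And>j. j \<in> gens K \<Longrightarrow> 0 \<le> c j" "x = (\<Sum>j\<in>gens K. c j *\<^sub>R rv j)"
          using cone_eq_sums [OF K(1) x] by blast
        have "rv j \<in> E" if "j \<in> gens K" for j using that sub by (auto simp: gens_def)
        then show ?thesis unfolding c(2) by (intro cone_sum E cone_scale c(1))
      qed
      then show False using E_ne_K K(3) by blast
    qed
    then obtain j where j: "j \<in> gens K" "j \<notin> gens E" by blast
    have "\<not> (\<forall>h\<in>H. (\<exists>l\<in>gens K. 0 < h \<bullet> rv l) \<longrightarrow> h \<bullet> q < 0)"
    proof
      assume *: "\<forall>h\<in>H. (\<exists>l\<in>gens K. 0 < h \<bullet> rv l) \<longrightarrow> h \<bullet> q < 0"
      have "\<exists>n. \<forall>m\<ge>n. int m *s c0 - v j \<in> M K"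
      proof (rule multiple_dominates [OF K(1) EK [OF c0] gens_monoid [OF K(1) j(1)]])
        fix h assume h: "h \<in> normals K" "h \<bullet> of_int_vec c0 = 0"
        then have "\<not> 0 < h \<bullet> rv j" using * j(1) by (auto simp: H_def q_def)
        then show "h \<bullet> rv j = 0" using h_nn [of h j] h(1) j(1) by (auto simp: H_def)
      qed
      then obtain n where "int n *s c0 - v j \<in> M K" by blast
      then have "0 \<le> a \<bullet> of_int_vec (int n *s c0 - v j)" using a(1) monoid_sub [OF K(1)] by blast
      moreover have "a \<bullet> of_int_vec c0 = 0" using monoid_sub [OF E c0] a(2) by auto
      moreover have "rv j \<in> K" "rv j \<notin> E" using j by (auto simp: gens_def)
      then have "0 < a \<bullet> rv j" using a(1) [of "rv j"] a(2) by (auto simp: less_le)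
      ultimately show False by (simp add: of_int_vec_diff of_int_vec_smult inner_diff_right)
    qed
    then show ?thesis
      unfolding \<K>_def acyclic_on_hit_family [OF cone_presentation_gens [OF K(1) K(1) subset_refl, folded H_def] qK] .
  qed
  obtain \<sigma> :: "nat set \<Rightarrow> 'k" where \<sigma>: "\<And>I. I \<notin> \<E> \<Longrightarrow> \<sigma> I = 0" "\<And>J. J \<in> \<E> \<Longrightarrow> cobd \<sigma> J = 0"
    and no_e: "\<And>e. (\<And>I. I \<notin> \<E> \<Longrightarrow> e I = 0) \<Longrightarrow> (\<And>J. J \<in> \<E> \<Longrightarrow> cobd e J = \<sigma> J) \<Longrightarrow> False"
  proof (rule ccontr)
    assume no: "\<not> thesis"
    have "acyclic_on TYPE('k) \<E>"
      unfolding acyclic_on_def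
    proof (intro allI impI, rule ccontr)
      fix c :: "nat set \<Rightarrow> 'k"
      assume "\<forall>I. I \<notin> \<E> \<longrightarrow> c I = 0" "\<forall>J\<in>\<E>. cobd c J = 0"
        and "\<nexists>e. (\<forall>I. I \<notin> \<E> \<longrightarrow> e I = 0) \<and> (\<forall>J\<in>\<E>. cobd e J = c J)"
      then show False using no that [of c] by blast
    qed
    then show False using nE by simp
  qed
  have \<sigma>_cobd: "cobd \<sigma> J = 0" if "J \<subseteq> gens E" for J
  proof (cases "J \<in> \<E>")
    case False
    then have "J - {j} \<notin> \<E>" for j
      using that hit_family_up [of "J - {j}" rv H "gens E" q J] by (auto simp: \<E>_def)
    then show ?thesis using \<sigma>(1) by (intro kd_zero) auto
  qed (rule \<sigma>(2))

  \<comment> \<open>The multiple of \<open>c0\<close> by which degrees are shifted down: it beats \<open>b\<close> on every normal of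
    \<open>K\<close> that does not vanish on \<open>E\<close>.\<close>
  obtain \<kappa> :: nat where \<kappa>: "\<And>h. h \<in> H \<Longrightarrow> 0 < h \<bullet> of_int_vec c0 \<Longrightarrow> h \<bullet> of_int_vec b < real \<kappa> * (h \<bullet> of_int_vec c0)"
  proof -
    have "\<exists>k::nat. \<forall>m\<ge>k. h \<bullet> of_int_vec b < real m * (h \<bullet> of_int_vec c0)" if "0 < h \<bullet> of_int_vec c0" for h
    proof -
      obtain k :: nat where k: "h \<bullet> of_int_vec b / (h \<bullet> of_int_vec c0) < real k" using reals_Archimedean2 by blast
      have "h \<bullet> of_int_vec b < real m * (h \<bullet> of_int_vec c0)" if "m \<ge> k" for m
      proof -
        have "h \<bullet> of_int_vec b / (h \<bullet> of_int_vec c0) < real m" using k that by linarith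
        then show ?thesis using \<open>0 < h \<bullet> of_int_vec c0\<close> by (simp add: field_simps)
      qed
      then show ?thesis by blast
    qed
    then obtain k where k: "\<And>h m. 0 < h \<bullet> of_int_vec c0 \<Longrightarrow> m \<ge> k h \<Longrightarrow> h \<bullet> of_int_vec b < real m * (h \<bullet> of_int_vec c0)"
      by metis
    have "k h \<le> Max (insert 0 (k ` H))" if "h \<in> H" for h
      using that normals(1) [OF K(1)] by (auto simp: H_def)
    then show ?thesis using k that by blast
  qed
  obtain n1 :: nat where n1: "n1 \<ge> 1" and n1': "\<And>C j. C \<in> \<Phi> \<Longrightarrow> of_int_vec b \<in> C \<Longrightarrow> E \<subseteq> C \<Longrightarrow> j \<in> gens C \<Longrightarrow>
      j \<notin> gens E \<Longrightarrow> b + int n1 *s (c0 + v j) \<in> M C"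
  proof -
    define P where "P = {(C, j). C \<in> \<Phi> \<and> of_int_vec b \<in> C \<and> E \<subseteq> C \<and> j \<in> gens C \<and> j \<notin> gens E}"
    have finP: "finite P"
      by (rule finite_subset [of _ "\<Phi> \<times> T"])
         (use fan finite_T gens_sub in \<open>auto simp: P_def rational_pointed_fan_def\<close>)
    have "\<forall>x\<in>P. \<exists>n. \<forall>m\<ge>n. b + int m *s (c0 + v (snd x)) \<in> M (fst x)"
      unfolding c0_def using larger_face [OF b max] by (auto simp: P_def)
    then obtain n where n: "\<And>x m. x \<in> P \<Longrightarrow> m \<ge> n x \<Longrightarrow> b + int m *s (c0 + v (snd x)) \<in> M (fst x)"
      by metis
    have "n x \<le> Max (insert 1 (n ` P))" if "x \<in> P" for x using that finP by auto
    moreover have "1 \<le> Max (insert 1 (n ` P))" using finP by (intro Max_ge) auto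
    ultimately show ?thesis using n that by (force simp: P_def)
  qed
  obtain N :: nat where N: "N \<ge> n1" and N': "\<And>I. I \<in> \<E> \<Longrightarrow> int N *s (\<Sum>l\<in>I. v l) - int (\<kappa> + n1) *s c0 \<in> M E"
  proof -
    have "\<exists>n. \<forall>m\<ge>n. int m *s (\<Sum>l\<in>I. v l) - int (\<kappa> + n1) *s c0 \<in> M E" if I: "I \<in> \<E>" for I
    proof -
      have IE: "I \<subseteq> gens E" using I mem_\<E> by blast
      have gE: "(\<Sum>l\<in>I. v l) \<in> M E" by (intro monoid_sum E gens_monoid) (use IE in auto)
      have fE: "int (\<kappa> + n1) *s c0 \<in> M E" by (rule monoid_smult [OF E c0])
      have "\<exists>n. \<forall>m\<ge>n. int m *s (\<Sum>l\<in>I. v l) - int (\<kappa> + n1) *s c0 \<in> M K"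
      proof (rule multiple_dominates [OF K(1) EK [OF gE] EK [OF fE]])
        fix h assume h: "h \<in> normals K" "h \<bullet> of_int_vec (\<Sum>l\<in>I. v l) = 0"
        have hH: "h \<in> H" using h by (simp add: H_def)
        have "(\<Sum>l\<in>I. h \<bullet> rv l) = 0" using h by (simp add: of_int_vec_sum inner_sum_right)
        moreover have "finite I" by (rule finite_subset [OF IE finite_gens])
        ultimately have "\<forall>l\<in>I. h \<bullet> rv l = 0"
          using h_nn [OF hH] IE gEK by (subst (asm) sum_nonneg_eq_0_iff) auto
        then have "\<not> h \<bullet> q < 0" using I hH by (auto simp: \<E>_def hit_family_def)
        moreover have "0 \<le> h \<bullet> of_int_vec c0"
          unfolding h_c0 by (intro sum_nonneg h_nn [OF hH]) (use gEK in auto)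
        ultimately have "h \<bullet> of_int_vec c0 = 0" by (simp add: q_def)
        then show "h \<bullet> of_int_vec (int (\<kappa> + n1) *s c0) = 0" by (simp only: of_int_vec_smult inner_scaleR_right)
      qed
      then obtain n where n: "\<And>m. m \<ge> n \<Longrightarrow> int m *s (\<Sum>l\<in>I. v l) - int (\<kappa> + n1) *s c0 \<in> M K" by blast
      have "int m *s (\<Sum>l\<in>I. v l) - int (\<kappa> + n1) *s c0 \<in> M E" if m: "m \<ge> n" for m
      proof -
        have "of_int_vec (int m *s (\<Sum>l\<in>I. v l) - int (\<kappa> + n1) *s c0) \<in> span (rv ` gens E)"
          unfolding of_int_vec_diff of_int_vec_smult of_int_vec_sum c0_def
          by (intro span_diff span_scale span_sum span_base) (use IE in auto)
        then have "of_int_vec (int m *s (\<Sum>l\<in>I. v l) - int (\<kappa> + n1) *s c0) \<in> E"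
          by (rule face_span [OF K(1) E K(3)]) (rule monoid_sub [OF K(1) n [OF m]])
        then show ?thesis using n [OF m] mem_monoid_iff [OF K(1)] mem_monoid_iff [OF E] by blast
      qed
      then show ?thesis by blast
    qed
    then obtain n where n: "\<And>I m. I \<in> \<E> \<Longrightarrow> m \<ge> n I \<Longrightarrow> int m *s (\<Sum>l\<in>I. v l) - int (\<kappa> + n1) *s c0 \<in> M E"
      by metis
    have fE: "finite \<E>"
      by (rule finite_subset [of _ "Pow (gens E)"]) (auto simp: mem_\<E>)
    have "n I \<le> Max (insert n1 (n ` \<E>))" if "I \<in> \<E>" for I using that fE by auto
    moreover have "n1 \<le> Max (insert n1 (n ` \<E>))" using fE by (intro Max_ge) auto
    ultimately show ?thesis using n that by blast
  qed

  define u where "u N I = b - int \<kappa> *s c0 + int N *s (\<Sum>l\<in>I. v l)" for N :: nat and I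
  have u_step: "int N *s v j + u N (J - {j}) = u N J" if "finite J" "j \<in> J" for N j J
    using that by (simp add: u_def sum.remove vector_add_ldistrib)
  define s where "s I = ?X (u N I) (\<sigma> I)" for I
  have s0: "s I = 0" if "I \<notin> \<E>" for I using that by (simp add: s_def \<sigma>(1) Theta_zero)
  have uE: "u N I - b - int n1 *s c0 \<in> M E" if "I \<in> \<E>" for I
  proof -
    have eq: "u N I - b - int n1 *s c0 = int N *s (\<Sum>l\<in>I. v l) - int (\<kappa> + n1) *s c0"
      by (simp add: u_def vec_eq_iff algebra_simps)
    show ?thesis unfolding eq by (rule N' [OF that])
  qed
  have uE': "u N I - b \<in> M E" if "I \<in> \<E>" for I
    using monoid_add [OF E uE [OF that] monoid_smult [OF E c0, of n1]] by simp
  have uK: "of_int_vec (u N I) \<in> K" if "I \<in> \<E>" for I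
    using cone_add [OF K(1,2) monoid_sub [OF K(1) EK [OF uE' [OF that]]]] by (simp flip: of_int_vec_add)
  have s_frobenius_preimage: "s I \<in> F.frobenius_preimage" for I
  proof (cases "I \<in> \<E>")
    case True
    have "int p *s u N I = int p *s b + int p *s (u N I - b)" by (simp add: vec_eq_iff algebra_simps)
    also have "\<dots> \<in> M K" by (intro monoid_add K(1) two_three_support_multiple bh K p EK monoid_smult E uE' True)
    finally have "int p *s u N I \<in> support" using mem_monoid_iff [OF K(1)] by blast
    then have "?X (int p *s u N I) (\<sigma> I ^ p) \<in> A" by (rule XA)
    then show ?thesis by (simp add: F.frobenius_preimage_def s_def Theta_single_power [OF K(1) uK [OF True]])
  qed (simp add: s0 F.mem_frobenius_preimage F.zero_mem)
  have y_pow: "?y j ^ n = ?X (int n *s v j) 1" if j: "j \<in> T" for j n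
  proof -
    obtain C where "C \<in> \<Phi>" "rv j \<in> C" using v_support [OF j] monoid_sub by (auto simp: support_def)
    then show ?thesis by (simp add: Theta_single_power)
  qed

  have dsA: "kd (\<lambda>j. ?y j ^ N) s J \<in> A" if JT: "J \<subseteq> T" for J
  proof (cases "J \<subseteq> gens E")
    case True
    have finJ: "finite J" by (rule finite_subset [OF True finite_gens])
    have "kd (\<lambda>j. ?y j ^ N) s J = (\<Sum>j\<in>J. ?X (u N J) (ksgn j J * \<sigma> (J - {j})))"
      unfolding kd_def
    proof (rule sum.cong)
      fix j assume j: "j \<in> J"
      show "ksgn j J * ?y j ^ N * s (J - {j}) = ?X (u N J) (ksgn j J * \<sigma> (J - {j}))"
      proof (cases "J - {j} \<in> \<E>")
        case in\<E>: True
        have "rv j \<in> K" using j True gEK by (auto simp: gens_def)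
        then have jK: "of_int_vec (int N *s v j) \<in> K" using cone_scale [OF K(1)] by (simp add: of_int_vec_smult)
        have "?y j ^ N * s (J - {j}) = ?X (u N J) (\<sigma> (J - {j}))"
          unfolding s_def y_pow [OF subsetD [OF JT j]] Theta_single_mult [OF K(1) jK uK [OF in\<E>]]
          using u_step [OF finJ j] by simp
        then show ?thesis by (simp add: mult.assoc ksgn_Theta_single)
      qed (simp add: s0 \<sigma>(1) Theta_zero)
    qed simp
    also have "\<dots> = ?X (u N J) (\<Sum>j\<in>J. ksgn j J * \<sigma> (J - {j}))" by (simp add: single_sum Theta_sum)
    also have "(\<Sum>j\<in>J. ksgn j J * \<sigma> (J - {j})) = cobd \<sigma> J" by (simp add: kd_def)
    finally show ?thesis by (simp only: \<sigma>_cobd [OF True] single_zero Theta_zero F.zero_mem)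
  next
    case False
    have "ksgn j J * ?y j ^ N * s (J - {j}) \<in> A" if j: "j \<in> J" for j
    proof (cases "J - {j} \<in> \<E>")
      case in\<E>: True
      let ?I = "J - {j}"
      have jE: "j \<notin> gens E" using False in\<E> by (auto simp: mem_\<E>)
      have jT: "j \<in> T" using j JT by auto
      have "?y j ^ N * s ?I \<in> A"
      proof (cases "\<exists>C\<in>\<Phi>. of_int_vec (int N *s v j) \<in> C \<and> of_int_vec (u N ?I) \<in> C")
        case True
        then obtain C where C: "C \<in> \<Phi>" "of_int_vec (int N *s v j) \<in> C" "of_int_vec (u N ?I) \<in> C" by blast
        have "0 < real N" using n1 N by simp
        then have jC: "j \<in> gens C" using C(2) jT cone_scale_iff [OF C(1)] by (simp add: gens_def of_int_vec_smult)
        let ?e = "u N ?I - b - int n1 *s c0"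
        have eK: "of_int_vec ?e \<in> K" by (rule monoid_sub [OF K(1) EK [OF uE [OF in\<E>]]])
        have c0K: "of_int_vec c0 \<in> K" by (rule monoid_sub [OF K(1) EK [OF c0]])
        have n1c0K: "of_int_vec (int n1 *s c0) \<in> K" using cone_scale [OF K(1) c0K] by (simp add: of_int_vec_smult)
        have "of_int_vec b + (of_int_vec ?e + of_int_vec (int n1 *s c0)) \<in> C"
          using C(3) by (simp flip: of_int_vec_add)
        note split = cone_addD [OF K(1) C(1) K(2) cone_add [OF K(1) eK n1c0K] this]
        have bC: "of_int_vec b \<in> C" by (rule split(1))
        have eC: "of_int_vec ?e \<in> C" "of_int_vec (int n1 *s c0) \<in> C"
          using cone_addD [OF K(1) C(1) eK n1c0K split(2)] by auto
        have c0C: "of_int_vec c0 \<in> C" using eC(2) n1 cone_scale_iff [OF C(1), of "real n1"] by (simp add: of_int_vec_smult)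
        have "rv l \<in> C" if l: "l \<in> gens E" for l
        proof -
          have "of_int_vec c0 = rv l + (\<Sum>i\<in>gens E - {l}. rv i)"
            unfolding c0_def of_int_vec_sum by (rule sum.remove) (use l in auto)
          then have "rv l + (\<Sum>i\<in>gens E - {l}. rv i) \<in> C" using c0C by simp
          then show ?thesis
            by (rule cone_addD(1) [OF K(1) C(1), rotated 2])
               (use l gEK in \<open>auto intro!: cone_sum K(1) simp: gens_def\<close>)
        qed
        then have EC: "E \<subseteq> C" using cone_eq_sums [OF E] by (auto intro!: cone_sum cone_scale C(1))
        have "?e \<in> M C" using uE [OF in\<E>] eC(1) mem_monoid_iff [OF C(1)] mem_monoid_iff [OF E] by blast
        then have "(b + int n1 *s (c0 + v j)) + int (N - n1) *s v j + ?e \<in> M C"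
          by (intro monoid_add C(1) n1' bC EC jC jE monoid_smult gens_monoid)
        also have "(b + int n1 *s (c0 + v j)) + int (N - n1) *s v j + ?e = int N *s v j + u N ?I"
          using N by (simp add: vec_eq_iff of_nat_diff algebra_simps)
        finally have "int N *s v j + u N ?I \<in> support" using mem_monoid_iff [OF C(1)] by blast
        then have "?X (int N *s v j + u N ?I) (1 * \<sigma> ?I) \<in> A" by (rule XA)
        then show ?thesis unfolding s_def y_pow [OF jT] Theta_single_mult [OF C] .
      next
        case False
        then show ?thesis unfolding s_def y_pow [OF jT] Theta_single_mult_zero [OF False] by (simp only: F.zero_mem)
      qed
      then show ?thesis unfolding mult.assoc by (rule F.mult_mem [OF F.ksgn_mem])
    qed (simp only: s0 mult_zero_right F.zero_mem not_False_eq_True)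
    then show ?thesis unfolding kd_def by (rule F.sum_mem)
  qed

  have sF: "\<forall>I. I \<subseteq> T \<longrightarrow> s I \<in> F.frobenius_preimage" using s_frobenius_preimage by simp
  have zA: "\<forall>J. J \<subseteq> T \<longrightarrow> kd (\<lambda>j. ?y j ^ N) s J \<in> A" using dsA by simp
  from inj [unfolded F.koszul_inj_def, THEN spec [of _ N], THEN spec [of _ s], THEN mp [OF _ sF], THEN mp [OF _ zA]]
  obtain t w where w': "\<forall>I. I \<subseteq> T \<longrightarrow> w I \<in> A"
    "\<forall>J. J \<subseteq> T \<longrightarrow> (\<Prod>j\<in>J. ?y j ^ t) * kd (\<lambda>j. ?y j ^ N) s J = kd (\<lambda>j. ?y j ^ (N + t)) w J"
    by (elim exE conjE)
  have w: "w I \<in> A" if "I \<subseteq> T" for I using w'(1) that by simp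
  have w_eq: "(\<Prod>j\<in>J. ?y j ^ t) * kd (\<lambda>j. ?y j ^ N) s J = kd (\<lambda>j. ?y j ^ (N + t)) w J" if "J \<subseteq> T" for J
    by (rule w'(2) [THEN spec, THEN mp, OF that])

  \<comment> \<open>Compare the coefficients in the cone \<open>K\<close> in degree \<open>u (N + t) J\<close>.\<close>
  define \<omega> where "\<omega> I = (if I \<subseteq> gens K then Poly_Mapping.lookup (w I K) (u (N + t) I) else 0)" for I
  have y_K: "(?y j ^ n) K = Poly_Mapping.single (int n *s v j) 1" if "j \<in> gens K" for j n
  proof -
    have "j \<in> T" "rv j \<in> K" using that by (auto simp: gens_def)
    then show ?thesis using cone_scale [OF K(1), of "rv j" "real n"]
      by (simp add: y_pow Theta_single [OF K(1)] of_int_vec_smult)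
  qed
  have s_K: "s I K = Poly_Mapping.single (u N I) (\<sigma> I)" for I
    using uK [of I] \<sigma>(1) [of I] s0 [of I] by (cases "I \<in> \<E>") (auto simp: s_def Theta_single [OF K(1)])
  have kd_K: "kd x r J K = kd (\<lambda>j. x j K) (\<lambda>I. r I K) J"
    for r J and K :: "(real ^ 'd) set" and x :: "nat \<Rightarrow> (real ^ 'd) set \<Rightarrow> (int ^ 'd \<Rightarrow>\<^sub>0 'k)"
    by (rule kd_hom [of "\<lambda>f. f K"]) auto
  have prod_K: "(\<Prod>j\<in>J. ?y j ^ t) K = Poly_Mapping.single (int t *s (\<Sum>l\<in>J. v l)) 1" if "J \<subseteq> gens K" for J
  proof -
    have "finite J" by (rule finite_subset [OF that finite_gens])
    then show ?thesis using that
    proof (induction J rule: finite_induct)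
      case (insert j J)
      then show ?case by (simp add: y_K mult_single vector_add_ldistrib del: power_Suc)
    qed (simp add: vector_smult_rzero)
  qed
  have compare: "cobd \<sigma> J = cobd \<omega> J" if J: "J \<subseteq> gens K" for J
  proof -
    have finJ: "finite J" by (rule finite_subset [OF J finite_gens])
    have "kd (\<lambda>j. ?y j ^ N) s J K = (\<Sum>j\<in>J. Poly_Mapping.single (u N J) (ksgn j J * \<sigma> (J - {j})))"
        unfolding kd_K unfolding kd_def
    proof (rule sum.cong)
      fix j assume j: "j \<in> J"
      then have "(?y j ^ N) K * s (J - {j}) K = Poly_Mapping.single (u N J) (\<sigma> (J - {j}))"
        using J by (simp add: y_K s_K mult_single u_step [OF finJ] subset_iff)
      moreover have "ksgn j J * Poly_Mapping.single a c = Poly_Mapping.single a (ksgn j J * c)" for a :: "int ^ 'd" and c :: 'k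
        by (cases "even (card {l \<in> J. l < j})") (auto simp: ksgn_def single_uminus)
      ultimately show "ksgn j J * (?y j ^ N) K * s (J - {j}) K = Poly_Mapping.single (u N J) (ksgn j J * \<sigma> (J - {j}))"
        by (simp add: mult.assoc)
    qed simp
    also have "\<dots> = Poly_Mapping.single (u N J) (cobd \<sigma> J)" by (simp add: single_sum kd_def)
    finally have "((\<Prod>j\<in>J. ?y j ^ t) * kd (\<lambda>j. ?y j ^ N) s J) K = Poly_Mapping.single (u (N + t) J) (cobd \<sigma> J)"
      by (simp add: prod_K [OF J] mult_single u_def vector_sadd_rdistrib add_ac)
    then have "cobd \<sigma> J = Poly_Mapping.lookup (kd (\<lambda>j. ?y j ^ (N + t)) w J K) (u (N + t) J)"
      using w_eq [OF order_trans [OF J gKT]] by simp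
    also have "\<dots> = (\<Sum>j\<in>J. ksgn j J * \<omega> (J - {j}))"
      unfolding kd_K unfolding kd_def lookup_sum
    proof (rule sum.cong)
      fix j assume j: "j \<in> J"
      have "ksgn j J * (?y j ^ (N + t)) K * w (J - {j}) K
          = Poly_Mapping.single (int (N + t) *s v j) (ksgn j J) * w (J - {j}) K"
      proof -
        have "ksgn j J * Poly_Mapping.single a 1 = Poly_Mapping.single a (ksgn j J :: 'k)" for a :: "int ^ 'd"
          by (cases "even (card {l \<in> J. l < j})") (auto simp: ksgn_def single_uminus)
        then show ?thesis using y_K [of j "N + t"] j J by auto
      qed
      moreover have "J - {j} \<subseteq> gens K" using J by auto
      ultimately show "Poly_Mapping.lookup (ksgn j J * (?y j ^ (N + t)) K * w (J - {j}) K) (u (N + t) J)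
          = ksgn j J * \<omega> (J - {j})"
        using lookup_single_times [of "int (N + t) *s v j" "ksgn j J" "w (J - {j}) K" "u (N + t) (J - {j})"]
          u_step [OF finJ j, of "N + t"] by (simp add: \<omega>_def)
    qed simp
    also have "\<dots> = cobd \<omega> J" by (simp add: kd_def)
    finally show ?thesis .
  qed
  have \<omega>_M: "u (N + t) I \<in> M K" if "\<omega> I \<noteq> 0" for I
  proof -
    have IK: "I \<subseteq> gens K" "Poly_Mapping.lookup (w I K) (u (N + t) I) \<noteq> 0" using that by (auto simp: \<omega>_def split: if_splits)
    then obtain f where f: "f \<in> carrier TR" "w I = Theta f" using w [OF order_trans [OF IK(1) gKT]] by (auto simp: A_def)
    then have "of_int_vec (u (N + t) I) \<in> K" "u (N + t) I \<in> Poly_Mapping.keys f"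
      using IK(2) by (auto simp: lookup_Theta [OF K(1)] in_keys_iff split: if_splits)
    then show ?thesis using f(1) by (auto simp: TR_carrier mem_monoid_iff [OF K(1)])
  qed
  have \<omega>_\<K>: "I \<in> \<K>" if "\<omega> I \<noteq> 0" for I
  proof -
    have IK: "I \<subseteq> gens K" using that by (auto simp: \<omega>_def split: if_splits)
    have "\<exists>l\<in>I. 0 < h \<bullet> rv l" if h: "h \<in> H" "h \<bullet> q < 0" for h
    proof (rule ccontr)
      assume no: "\<not> (\<exists>l\<in>I. 0 < h \<bullet> rv l)"
      then have "h \<bullet> rv l = 0" if "l \<in> I" for l using h_nn [OF h(1), of l] IK that by force
      then have "h \<bullet> of_int_vec (\<Sum>l\<in>I. v l) = 0" by (simp add: of_int_vec_sum inner_sum_right)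
      then have "h \<bullet> of_int_vec (u (N + t) I) = h \<bullet> of_int_vec b - real \<kappa> * (h \<bullet> of_int_vec c0)"
        unfolding u_def of_int_vec_add of_int_vec_diff of_int_vec_smult by (simp add: inner_simps)
      also have "\<dots> < 0" using \<kappa> [OF h(1)] h(2) by (simp add: q_def)
      finally show False
        using monoid_sub [OF K(1) \<omega>_M [OF \<open>\<omega> I \<noteq> 0\<close>]] normals(2) [OF K(1)] h(1) by (force simp: H_def)
    qed
    then show ?thesis using IK by (auto simp: \<K>_def hit_family_def)
  qed
  have \<omega>_E: "\<omega> I = 0" if I: "I \<subseteq> gens E" for I
  proof (rule ccontr)
    assume "\<omega> I \<noteq> 0"
    then have "u (N + t) I + int \<kappa> *s c0 \<in> M K"
      by (intro monoid_add K(1) \<omega>_M monoid_smult EK c0)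
    then have "b + int (N + t) *s (\<Sum>l\<in>I. v l) \<in> support"
      using mem_monoid_iff [OF K(1)] by (simp add: u_def add_ac)
    moreover have "int (N + t) *s (\<Sum>l\<in>I. v l) \<in> M E"
      by (intro monoid_smult E monoid_sum gens_monoid) (use I in auto)
    ultimately show False using bE by blast
  qed

  define \<delta> where "\<delta> I = \<sigma> I - \<omega> I" for I
  have \<delta>0: "\<delta> I = 0" if "I \<notin> \<K>" for I
    using that \<sigma>(1) [of I] \<omega>_\<K> [of I] mem_\<E> by (auto simp: \<delta>_def)
  have d\<delta>: "cobd \<delta> J = 0" if "J \<in> \<K>" for J
  proof -
    have "J \<subseteq> gens K" using that by (auto simp: \<K>_def hit_family_def)
    then show ?thesis unfolding \<delta>_def [abs_def] kd_diff by (simp add: compare)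
  qed
  obtain e where e: "\<And>I. I \<notin> \<K> \<Longrightarrow> e I = 0" "\<And>J. J \<in> \<K> \<Longrightarrow> cobd e J = \<delta> J"
    using acyclic_onE [OF aK \<delta>0 d\<delta>] by blast
  define e' where "e' I = (if I \<in> \<E> then e I else 0)" for I
  have "cobd e' J = \<sigma> J" if J: "J \<in> \<E>" for J
  proof -
    have JE: "J \<subseteq> gens E" "J \<in> \<K>" using J mem_\<E> by auto
    have "e' (J - {j}) = e (J - {j})" for j
    proof (cases "J - {j} \<in> \<E>")
      case False
      then have "J - {j} \<notin> \<K>" using JE mem_\<E> [of "J - {j}"] by auto
      then show ?thesis using False e(1) by (simp add: e'_def)
    qed (simp add: e'_def)
    then have "cobd e' J = cobd e J" by (intro kd_cong) auto
    then show ?thesis using e(2) [OF JE(2)] \<omega>_E [OF JE(1)] by (simp add: \<delta>_def)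
  qed
  then show False by (intro no_e [of e']) (auto simp: e'_def)
qed

end


section \<open>F-injectivity and seminormality\<close>

context generated_fan_complex
begin

lemma generator_split:
  assumes C: "C \<in> \<Phi>" and a: "a \<in> M C" "a \<noteq> 0"
  shows "\<exists>j\<in>gens C. a - v j \<in> M C"
proof -
  obtain n :: "nat \<Rightarrow> nat" where n: "a = (\<Sum>j\<in>gens C. int (n j) *s v j)" using monoid_eq_sums [OF C a(1)] by blast
  have "\<exists>j\<in>gens C. n j \<noteq> 0"
  proof (rule ccontr)
    assume "\<not> (\<exists>j\<in>gens C. n j \<noteq> 0)"
    then have "a = 0" unfolding n by (intro sum.neutral) (simp add: vector_smult_lzero)
    then show False using a(2) by simp
  qed
  then obtain j where j: "j \<in> gens C" "n j \<noteq> 0" by blast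
  have "a = int (n j) *s v j + (\<Sum>i\<in>gens C - {j}. int (n i) *s v i)"
    unfolding n by (rule sum.remove) (use j in auto)
  moreover have "int (n j) *s v j = v j + int (n j - 1) *s v j"
    using j(2) by (simp add: vec_eq_iff of_nat_diff algebra_simps)
  ultimately have "a - v j = int (n j - 1) *s v j + (\<Sum>i\<in>gens C - {j}. int (n i) *s v i)" by simp
  also have "\<dots> \<in> M C"
    by (intro monoid_add monoid_sum monoid_smult C gens_monoid) (use j in auto)
  finally show ?thesis using j by blast
qed

text \<open>Each nonzero element of a monoid is the sum of a generator and an element of the monoid.\<close>

lemma max_ideal_in_ideal:
  fixes f :: "int ^ 'd \<Rightarrow>\<^sub>0 'k::field"
  assumes f: "f \<in> toric_max_ideal \<Phi> M"
  shows "subring_set.in_ideal (Theta ` carrier (TR :: (int ^ 'd \<Rightarrow>\<^sub>0 'k) ring))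
    (\<lambda>j. Theta (Poly_Mapping.single (v j) 1)) T (Theta f)"
proof -
  interpret E: embedded_ring "TR :: (int ^ 'd \<Rightarrow>\<^sub>0 'k) ring" Theta by (rule embedded_ring_TR)
  interpret C: cech "TR :: (int ^ 'd \<Rightarrow>\<^sub>0 'k) ring" Theta "[]" by unfold_locales simp
  interpret S: subring_set "Theta ` carrier (TR :: (int ^ 'd \<Rightarrow>\<^sub>0 'k) ring)" by (rule C.subring_set_image)
  let ?y = "\<lambda>j. Theta (Poly_Mapping.single (v j) (1 :: 'k))"
  have fk: "Poly_Mapping.keys f \<subseteq> support" "0 \<notin> Poly_Mapping.keys f"
    using f by (auto simp: toric_max_ideal_def TR_carrier)
  have "S.in_ideal ?y T (Theta (Poly_Mapping.single a c))" if a: "a \<in> Poly_Mapping.keys f" for a c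
  proof -
    obtain C where C: "C \<in> \<Phi>" "a \<in> M C" using fk a by (auto simp: support_def)
    have "a \<noteq> 0" using fk a by auto
    then obtain j where j: "j \<in> gens C" "a - v j \<in> M C" using generator_split [OF C] by blast
    have "Theta (Poly_Mapping.single (a - v j) c) * ?y j = Theta (Poly_Mapping.single ((a - v j) + v j) (c * 1))"
      by (rule Theta_single_mult [OF C(1) monoid_sub [OF C(1) j(2)] monoid_sub [OF C(1) gens_monoid [OF C(1) j(1)]]])
    then have eq: "Theta (Poly_Mapping.single a c) = Theta (Poly_Mapping.single (a - v j) c) * ?y j" by simp
    have "Poly_Mapping.single (a - v j) c \<in> carrier TR"
      using j(2) C(1) by (auto simp: TR_carrier support_def)
    then show ?thesis
      unfolding eq using gens_sub j(1)
      by (intro S.in_ideal_mult imageI S.in_ideal_gen [of T j ?y] finite_T) auto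
  qed
  then have "S.in_ideal ?y T (\<Sum>a\<in>Poly_Mapping.keys f. Theta (Poly_Mapping.single a (Poly_Mapping.lookup f a)))"
    by (intro S.in_ideal_sum)
  then show ?thesis using poly_mapping_sum_single [of f] by (simp flip: Theta_sum)
qed

end

context fan_complex
begin

lemma finite_generators:
  "\<exists>G. finite G \<and> 0 \<notin> G \<and> G \<subseteq> support \<and> (\<forall>C\<in>\<Phi>. \<exists>S. M C = monoid_closure S \<and> S \<subseteq> insert 0 G)"
proof -
  obtain S where S: "\<And>C. C \<in> \<Phi> \<Longrightarrow> finite (S C) \<and> M C = monoid_closure (S C)"
    using monoid_gen by metis
  define G where "G = (\<Union>C\<in>\<Phi>. S C) - {0}"
  have "finite G" using S fan by (auto simp: G_def rational_pointed_fan_def)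
  moreover have "G \<subseteq> support" using S monoid_closure.base by (fastforce simp: G_def support_def)
  moreover have "\<exists>S'. M C = monoid_closure S' \<and> S' \<subseteq> insert 0 G" if "C \<in> \<Phi>" for C
    using S [OF that] that by (intro exI [of _ "S C"]) (auto simp: G_def)
  ultimately show ?thesis by (intro exI [of _ G]) (auto simp: G_def)
qed

text \<open>The given generators of the maximal ideal are exchanged for the monomials of the \<open>v j\<close>, which
  generate the same ideal.\<close>

theorem F_injective_koszul:
  assumes char: "CHAR('k::field) = p" "p > 0"
    and Finj: "F_injective p (TR :: (int ^ 'd \<Rightarrow>\<^sub>0 'k) ring) (toric_max_ideal \<Phi> M)"
  shows "\<exists>T v. generated_fan_complex \<Phi> M T v \<and>
    frobenius_subring.koszul_inj (Theta ` carrier (TR :: (int ^ 'd \<Rightarrow>\<^sub>0 'k) ring)) p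
      (\<lambda>j. Theta (Poly_Mapping.single (v j) 1)) T"
proof -
  let ?R = "TR :: (int ^ 'd \<Rightarrow>\<^sub>0 'k) ring" and ?m = "toric_max_ideal \<Phi> M :: (int ^ 'd \<Rightarrow>\<^sub>0 'k) set"
  let ?A = "Theta ` carrier ?R"
  obtain xs where xs: "set xs \<subseteq> carrier ?R" "Idl\<^bsub>?R\<^esub> (set xs) = ?m"
    "\<And>i. inj_on (local_cohomology_frobenius p ?R xs i) (carrier (local_cohomology ?R xs i))"
    using Finj by (auto simp: F_injective_def)
  from finite_generators obtain G where G: "finite G" "0 \<notin> G" "G \<subseteq> support"
    and G_gen: "\<forall>C\<in>\<Phi>. \<exists>S. M C = monoid_closure S \<and> S \<subseteq> insert 0 G"
    by (elim exE conjE)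
  obtain ys where ys: "set ys = G" using finite_list [OF G(1)] by blast
  define n where "n = length xs"
  define v where "v j = ys ! (j - n)" for j
  define T where "T = {n..<n + length ys}"
  have vT: "v ` T = G"
  proof (intro equalityI subsetI)
    fix a assume "a \<in> v ` T"
    then obtain j where "j \<in> T" "a = v j" by (rule imageE)
    then have "j - n < length ys" "a = ys ! (j - n)" by (auto simp: T_def v_def)
    then show "a \<in> G" using ys nth_mem by blast
  next
    fix a assume "a \<in> G"
    then obtain i where "i < length ys" "a = ys ! i" using ys by (metis in_set_conv_nth)
    then have "n + i \<in> T" "a = v (n + i)" by (auto simp: T_def v_def)
    then show "a \<in> v ` T" by (rule rev_image_eqI)
  qed
  have vG: "v j \<in> G" if "j \<in> T" for j using vT that by blast
  have gfc: "generated_fan_complex \<Phi> M T v"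
  proof
    show "\<exists>S. M C = monoid_closure S \<and> S \<subseteq> insert 0 (v ` T)" if "C \<in> \<Phi>" for C
      unfolding vT by (rule bspec [OF G_gen that])
    show "v j \<noteq> 0" "v j \<in> support" if "j \<in> T" for j using vG [OF that] G(2,3) by auto
  qed (simp add: T_def)
  interpret W: generated_fan_complex \<Phi> M T v by (rule gfc)
  interpret E: embedded_ring ?R Theta by (rule embedded_ring_TR)
  interpret C: cech ?R Theta xs by unfold_locales (rule xs(1))
  interpret F: frobenius_subring ?A p by (rule frobenius_subring_TR [OF char])
  define y where "y j = (Theta (Poly_Mapping.single (v j) 1) :: (real ^ 'd) set \<Rightarrow> (int ^ 'd \<Rightarrow>\<^sub>0 'k))" for j
  define z where "z j = (if j < n then C.x j else y j)" for j
  have zC: "z j = C.x j" if "j \<in> {..<n}" for j using that by (simp add: z_def)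
  have zy: "z j = y j" if "j \<in> T" for j using that by (simp add: z_def T_def)
  have ideal_cong: "F.in_ideal f S = F.in_ideal g S" if "\<And>j. j \<in> S \<Longrightarrow> f j = g j" for f g and S :: "nat set"
    using that by (intro ext) (simp add: F.in_ideal_def cong: sum.cong)
  have zi: "F.in_ideal z {..<n} = F.in_ideal C.x {..<n}" by (rule ideal_cong) (rule zC)
  have zi': "F.in_ideal z T = F.in_ideal y T" by (rule ideal_cong) (rule zy)
  have "F.koszul_inj C.x {..<n}"
    unfolding n_def by (rule C.koszul_inj_generators [OF F.frobenius_subring_axioms xs(3)])
  then have "F.koszul_inj z {..<n}" by (rule F.koszul_inj_cong [rotated]) (rule zC [symmetric])
  then have "F.koszul_inj z T"
  proof (rule F.koszul_inj_change [rotated -1])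
    show "finite {..<n}" "finite T" by (simp_all add: T_def)
    have m: "single_v \<in> ?m" if "single_v = Poly_Mapping.single (v j) 1" "j \<in> T" for single_v j
    proof -
      have "v j \<in> support" "v j \<noteq> 0" using vG [OF that(2)] G by auto
      then show ?thesis by (simp add: that(1) toric_max_ideal_def TR_carrier)
    qed
    have xm: "xs ! j \<in> ?m" if "j < n" for j
      using E.genideal_self [OF xs(1)] that xs(2) by (auto simp: n_def)
    show "F.in_ideal z {..<n} (z j)" if "j \<in> T" for j
      unfolding zi zy [OF that] unfolding y_def n_def
      using C.in_ideal_genideal [of "Poly_Mapping.single (v j) 1"] m [OF refl that] xs(2) by simp
    show "F.in_ideal z T (z j)" if "j \<in> {..<n}" for j
      unfolding zi' zC [OF that] C.x_def
      unfolding y_def by (rule W.max_ideal_in_ideal [OF xm]) (use that in simp)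
    show "z j \<in> ?A" if "j \<in> {..<n} \<union> T" for j
    proof (cases "j < n")
      case True
      then have "xs ! j \<in> carrier ?R" using xs(1) by (auto simp: n_def)
      then show ?thesis using True by (simp add: z_def C.x_def)
    next
      case False
      then have "j \<in> T" using that by auto
      then have "Poly_Mapping.single (v j) 1 \<in> carrier ?R" using m [OF refl] by (simp add: toric_max_ideal_def)
      then show ?thesis using False by (simp add: z_def y_def)
    qed
  qed
  then have "F.koszul_inj y T" by (rule F.koszul_inj_cong [rotated]) (rule zy)
  then show ?thesis unfolding y_def using gfc by blast
qed

end

theorem mainTheorem6:
  fixes \<F> :: "(real ^ 'd) set set"
    and M :: "(real ^ 'd) set \<Rightarrow> (int ^ 'd) set"
    and p :: nat
  assumes "CHAR('k::field) = p" and "p > 0"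
    and "rational_pointed_fan \<F>"
    and "monoidal_complex \<F> M"
    and "F_injective p (toric_face_ring \<F> M :: (int ^ 'd \<Rightarrow>\<^sub>0 'k) ring) (toric_max_ideal \<F> M)"
  shows "seminormal_complex \<F> M"
  unfolding seminormal_complex_def seminormal_monoid_def
proof (intro ballI impI, elim conjE)
  fix C x assume C: "C \<in> \<F>" and x: "x + x \<in> M C" "x + x + x \<in> M C"
  interpret fan_complex \<F> M using assms(3,4) by unfold_locales
  obtain T v where "generated_fan_complex \<F> M T v" and
    inj: "frobenius_subring.koszul_inj (Theta ` carrier (TR :: (int ^ 'd \<Rightarrow>\<^sub>0 'k) ring)) p
      (\<lambda>j. Theta (Poly_Mapping.single (v j) 1)) T"
    using F_injective_koszul [OF assms(1,2,5)] by blast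
  then interpret generated_fan_complex \<F> M T v by simp
  have p2: "p \<ge> 2" using prime_CHAR_semidom [where 'a = 'k, THEN prime_ge_2_nat] assms(1,2) by simp
  show "x \<in> M C"
  proof (rule ccontr)
    assume nx: "x \<notin> M C"
    have eq: "int 2 *s x = x + x" "int 3 *s x = x + x + x" by (simp_all add: vec_eq_iff)
    have "2 *\<^sub>R of_int_vec x \<in> C"
      using monoid_sub [OF C x(1)] of_int_vec_smult [of 2 x] eq by simp
    then have xC: "of_int_vec x \<in> C" using cone_scale_iff [OF C, of 2] by simp
    have "x \<notin> support" using nx xC mem_monoid_iff [OF C] by blast
    moreover have "e = 0" if "e \<in> M {0}" for e using monoid_sub [OF zero_in_fan that] by simp
    ultimately have "\<forall>e\<in>M {0}. x + e \<notin> support" by fastforce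
    moreover have "x \<in> two_three_support"
      unfolding two_three_support_def mem_Collect_eq eq support_def using x C by blast
    moreover have "\<exists>K\<in>\<F>. of_int_vec x \<in> K \<and> {0} \<subseteq> K" using C xC cone_zero [OF C] by blast
    ultimately have start: "extension_at x {0}" using zero_in_fan by (simp add: extension_at_def)
    define size where "size E = card (gens E)" for E
    have "size E \<le> card T" for E
      unfolding size_def by (rule card_mono [OF finite_T gens_sub])
    then have "\<exists>E. (\<exists>b. extension_at b E) \<and> (\<forall>F. (\<exists>b. extension_at b F) \<longrightarrow> size F \<le> size E)"
      using start by (intro ex_has_greatest_nat [of "\<lambda>E. \<exists>b. extension_at b E" "{0}" size "Suc (card T)"])
        (auto simp: less_Suc_eq_le)
    then obtain b E where bE: "extension_at b E"
      and max: "\<And>b' F. extension_at b' F \<Longrightarrow> card (gens F) \<le> card (gens E)"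
      unfolding size_def by blast
    show False
      by (rule no_extension [OF frobenius_subring_TR [OF assms(1,2)] p2 inj bE max])
  qed
qed

end
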